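(* Let $X$ be a Hilbert space, $E$ an Asplund space, $K\subset X$ a closed convex set, and let $\psi:X\times E\to\overline{\mathbb{R}}$ be given by $\psi(u,e)=\phi(u,e)+\delta(u;K)$, where $\phi:X\times E\to\overline{\mathbb{R}}$ is of class $\mathcal{C}^2$ around the point $(\bar u,\bar e)\in\mathrm{dom}\,\psi$. Let $\bar u^*\in\partial_u\psi(\bar u,\bar e)$. Then the following statements are equivalent: (i) $\bar u$ is a Lipschitzian fully stable local minimizer of $\mathcal{P}_{Abs}(\bar u^*,\bar e)$. (ii) $\bar u$ is a Hölderian fully stable local minimizer of $\mathcal{P}_{Abs}(\bar u^*,\bar e)$. (iii) There are $\eta,\delta>0$ such that for all $(u,e,u^* )\in\mathrm{gph}\,\partial_u\psi\cap\bar B_\eta(\bar u,\bar e,\bar u^* )$ we have $$\langle v^*,v\rangle\ge\delta\|v\|_X^2\quad\text{whenever}\quad (v^*,e^* )\in\widehat D^*(\partial_u\psi)(u,e,u^* )(v)\ \text{ for } v\in X.$$ (iv) There are $\eta,\delta>0$ such that for all $(u,e,u^* )\in\mathrm{gph}\,\partial_u\psi\cap\bar B_\eta(\bar u,\bar e,\bar u^* )$ we have $$\langle v^*,v\rangle\ge\delta\|v\|_X^2\quad\text{whenever}\quad v^*\in\breve\partial^2\psi_e(u,u^* )(v)\ \text{ for } v\in X.$$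
   Context: $\overline{\mathbb{R}}$ denotes the extended reals; $\delta(u;K)=0$ if $u\in K$ and $+\infty$ otherwise; $\mathrm{dom}\,\psi=\{(u,e):\psi(u,e)<\infty\}$; $\psi_e:=\psi(\cdot,e)$. $X$ is identified with its dual. Product spaces carry the sum norm, and $\bar B_\eta(\cdot)$ is the closed ball of radius $\eta$. Problem: for $(u^*,e)\in X\times E$, $\mathcal{P}_{Abs}(u^*,e)$ is: minimize $\psi(u,e)-\langle u^*,u\rangle$ over $u\in X$. For $\gamma>0$ put $$m_\gamma(u^*,e)=\inf_{\|u-\bar u\|\le\gamma}\{\psi(u,e)-\langle u^*,u\rangle\},\qquad M_\gamma(u^*,e)=\mathrm{argmin}_{\|u-\bar u\|\le\gamma}\{\psi(u,e)-\langle u^*,u\rangle\}.$$ Full stability. $\bar u$ is a Lipschitzian fully stable local minimizer of $\mathcal{P}_{Abs}(\bar u^*,\bar e)$ if there is $\gamma>0$ such that, around $(\bar u^*,\bar e)$, $M_\gamma$ is single-valued and Lipschitz continuous with $M_\gamma(\bar u^*,\bar e)=\bar u$, and $m_\gamma$ is Lipschitz continuous. It is a Hölderian fully stable local minimizer if there are $\gamma,\kappa>0$ and a neighborhood $U^*\times V$ of $(\bar u^*,\bar e)$ such that $M_\gamma$ is single-valued on $U^*\times V$ with $M_\gamma(\bar u^*,\bar e)=\bar u$, $$\|M_\gamma(u^*,e)-M_\gamma(\tilde u^*,\tilde e)\|\le\kappa\big(\|u^*-\tilde u^*\|+\|e-\tilde e\|^{1/2}\big)$$ for all $(u^*,e),(\tilde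 u^*,\tilde e)\in U^*\times V$, and $m_\gamma$ is Lipschitz continuous on $U^*\times V$. Generalized differentiation. For a proper function $\varphi:Z\to\overline{\mathbb{R}}$ on a Banach space $Z$, lower semicontinuous around $\bar z\in\mathrm{dom}\,\varphi$, the regular subdifferential is $$\widehat\partial\varphi(\bar z)=\Big\{z^*\in Z^*:\liminf_{z\to\bar z}\frac{\varphi(z)-\varphi(\bar z)-\langle z^*,z-\bar z\rangle}{\|z-\bar z\|}\ge0\Big\},$$ and the limiting subdifferential $\partial\varphi(\bar z)$ is the set of all $z^*$ for which there are $z_n\to\bar z$ with $\varphi(z_n)\to\varphi(\bar z)$ and $z_n^*\in\widehat\partial\varphi(z_n)$ with $z_n^*\rightharpoonup z^*$ weakly*. $\partial_u\psi(u,e)$ is the limiting subdifferential of $\psi(\cdot,e)$ at $u$; it is regarded as a multifunction $\partial_u\psi:X\times E\rightrightarrows X$, with graph $\mathrm{gph}\,\partial_u\psi=\{(u,e,u^* ):u^*\in\partial_u\psi(u,e)\}$. The regular normal cone to a set $\Theta$ at $\bar z\in\Theta$ is $\widehat N(\bar z;\Theta)=\widehat\partial\delta(\cdot;\Theta)(\bar z)$. The regular coderivative of $F:Z\rightrightarrows W$ at $(\bar z,\bar w)\in\mathrm{gph}\,F$ is $\widehat D^*F(\bar z,\bar w)(w^* )=\{z^*\in Z^*:(z^*,-w^* )\in\widehat N((\bar z,\bar w);\mathrm{gph}\,F)\}$. For $u^*\in\partial\varphi(u)$ the combined second-order subdifferential is $\breve\partial^2\varphi(u,u^* )(v)=(\widehat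 D^*\partial\varphi)(u,u^* )(v)$. *)

theory Defs
  imports "HOL-Analysis.Analysis"
begin

section \<open>Standing notions\<close>

definition asplund_space :: "'e::banach itself \<Rightarrow> bool" where
  "asplund_space _ \<longleftrightarrow>
     (\<forall>(U::'e set) (f::'e \<Rightarrow> real).
        open U \<longrightarrow> convex U \<longrightarrow> convex_on U f \<longrightarrow> continuous_on U f \<longrightarrow>
        (\<exists>D\<subseteq>U. U \<subseteq> closure D \<and> (\<forall>x\<in>D. f differentiable (at x))))"

definition C2_around :: "('z::real_normed_vector \<Rightarrow> ereal) \<Rightarrow> 'z \<Rightarrow> bool" where
  "C2_around \<phi> z0 \<longleftrightarrow>
     (\<exists>S (\<phi>'::'z \<Rightarrow> 'z \<Rightarrow>\<^sub>L real) (\<phi>''::'z \<Rightarrow> 'z \<Rightarrow>\<^sub>L ('z \<Rightarrow>\<^sub>L real)).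
        open S \<and> z0 \<in> S \<and>
        (\<forall>z\<in>S. \<bar>\<phi> z\<bar> \<noteq> \<infinity> \<and>
          ((\<lambda>x. real_of_ereal (\<phi> x)) has_derivative blinfun_apply (\<phi>' z)) (at z) \<and>
          (\<phi>' has_derivative blinfun_apply (\<phi>'' z)) (at z)) \<and>
        continuous_on S \<phi>'')"

definition set_delta :: "'z set \<Rightarrow> 'z \<Rightarrow> ereal" where
  "set_delta K z = (if z \<in> K then 0 else \<infinity>)"

text \<open>
  Adding \<open>set_delta K\<close> makes a function infinite off \<open>K\<close>, whatever its value there, because
  \<open>- \<infinity> + \<infinity> = \<infinity>\<close> in \<^typ>\<open>ereal\<close>.
\<close>

definition eff_dom :: "('z \<Rightarrow> ereal) \<Rightarrow> 'z set" where
  "eff_dom \<psi> = {z. \<psi> z < \<infinity>}"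

section \<open>Generalized differentiation\<close>

text \<open>
  At points where the function is not finite both subdifferentials are empty. They depend only on
  the values of the function near the reference point.
\<close>

definition regular_subdifferential ::
    "('z::real_normed_vector \<Rightarrow> ereal) \<Rightarrow> 'z \<Rightarrow> ('z \<Rightarrow>\<^sub>L real) set" where
  "regular_subdifferential \<phi> z =
     {zs. \<bar>\<phi> z\<bar> \<noteq> \<infinity> \<and>
          0 \<le> Liminf (at z) (\<lambda>x. (\<phi> x - \<phi> z - ereal (blinfun_apply zs (x - z))) / ereal (norm (x - z)))}"

definition limiting_subdifferential ::
    "('z::real_normed_vector \<Rightarrow> ereal) \<Rightarrow> 'z \<Rightarrow> ('z \<Rightarrow>\<^sub>L real) set" where
  "limiting_subdifferential \<phi> z =
     {zs. \<bar>\<phi> z\<bar> \<noteq> \<infinity> \<and>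
          (\<exists>(x::nat \<Rightarrow> 'z) (xs::nat \<Rightarrow> 'z \<Rightarrow>\<^sub>L real).
             x \<longlonglongrightarrow> z \<and> (\<lambda>n. \<phi> (x n)) \<longlonglongrightarrow> \<phi> z \<and>
             (\<forall>n. xs n \<in> regular_subdifferential \<phi> (x n)) \<and>
             (\<forall>h. (\<lambda>n. blinfun_apply (xs n) h) \<longlonglongrightarrow> blinfun_apply zs h))}"

definition regular_normal_cone ::
    "'z::real_normed_vector \<Rightarrow> 'z set \<Rightarrow> ('z \<Rightarrow>\<^sub>L real) set" where
  "regular_normal_cone z \<Theta> = regular_subdifferential (set_delta \<Theta>) z"

text \<open>
  The library norm on a product is the Euclidean combination of the two norms, not their sum.
  The next lemma shows that the regular subdifferential, hence also the regular normal cone and the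
  coderivative below, is the same for both.
\<close>

lemma regular_subdifferential_sum_norm:
  fixes \<phi> :: "'a::real_normed_vector \<times> 'b::real_normed_vector \<Rightarrow> ereal"
  shows "regular_subdifferential \<phi> p =
     {zs. \<bar>\<phi> p\<bar> \<noteq> \<infinity> \<and>
          0 \<le> Liminf (at p) (\<lambda>x. (\<phi> x - \<phi> p - ereal (blinfun_apply zs (x - p))) /
                               ereal (norm (fst x - fst p) + norm (snd x - snd p)))}"
proof -
  have key: "y < a / ereal t" if y: "y < 0" and st: "0 < s" "0 < t" "t \<le> 2 * s" "s \<le> 2 * t"
    and a: "y / 2 < a / ereal s" for y a :: ereal and s t :: real
  proof (cases a)
    case (real r)
    show ?thesis
    proof (cases y)
      case (real q)
      have q: "q < 0" using y real by simp
      have *: "q / 2 * s < r" using a \<open>a = ereal r\<close> real st by (simp add: field_simps)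
      have "q * t \<le> q * (s / 2)" using q st by (intro mult_left_mono_neg) auto
      hence "q * t < r" using * by simp
      thus ?thesis using \<open>a = ereal r\<close> real st by (simp add: field_simps)
    qed (use y \<open>a = ereal r\<close> st in auto)
  qed (use y a st in \<open>auto simp: divide_ereal_def\<close>)
  have half: "y / 2 < 0" if "y < 0" for y :: ereal
    using that by (cases y) auto
  have ev: "\<forall>\<^sub>F x in at p. x \<noteq> p" by (simp add: eventually_at_filter)
  have bounds: "0 < norm (x - p) \<and> 0 < norm (fst x - fst p) + norm (snd x - snd p) \<and>
      norm (x - p) \<le> 2 * (norm (fst x - fst p) + norm (snd x - snd p)) \<and>
      norm (fst x - fst p) + norm (snd x - snd p) \<le> 2 * norm (x - p)" if "x \<noteq> p" for x
  proof -
    have xp: "x - p = (fst x - fst p, snd x - snd p)" by (simp add: prod_eq_iff)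
    have "norm (x - p) > 0" using that by simp
    moreover have "norm (x - p) \<le> norm (fst x - fst p) + norm (snd x - snd p)"
      unfolding xp by (rule norm_Pair_le)
    moreover have "norm (fst x - fst p) \<le> norm (x - p)" "norm (snd x - snd p) \<le> norm (x - p)"
      unfolding xp by (rule norm_fst_le, rule norm_snd_le)
    moreover have "0 < n \<and> 0 < a + b \<and> n \<le> 2 * (a + b) \<and> a + b \<le> 2 * n"
      if "0 < n" "n \<le> a + b" "a \<le> n" "b \<le> n" for n a b :: real
      using that by auto
    ultimately show ?thesis by blast
  qed
  have "0 \<le> Liminf (at p) (\<lambda>x. a x / ereal (norm (x - p))) \<longleftrightarrow>
        0 \<le> Liminf (at p) (\<lambda>x. a x / ereal (norm (fst x - fst p) + norm (snd x - snd p)))"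
    (is "?L \<longleftrightarrow> ?R") for a :: "'a \<times> 'b \<Rightarrow> ereal"
  proof
    assume ?L
    show ?R unfolding le_Liminf_iff
    proof (intro allI impI)
      fix y :: ereal assume y: "y < 0"
      have "\<forall>\<^sub>F x in at p. y / 2 < a x / ereal (norm (x - p))"
        using \<open>?L\<close> half[OF y] unfolding le_Liminf_iff by blast
      with ev show "\<forall>\<^sub>F x in at p. y < a x / ereal (norm (fst x - fst p) + norm (snd x - snd p))"
      proof eventually_elim
        case (elim x)
        show ?case
          by (rule key[OF y _ _ _ _ elim(2)]) (use bounds[OF elim(1)] in blast)+
      qed
    qed
  next
    assume ?R
    show ?L unfolding le_Liminf_iff
    proof (intro allI impI)
      fix y :: ereal assume y: "y < 0"
      have "\<forall>\<^sub>F x in at p. y / 2 < a x / ereal (norm (fst x - fst p) + norm (snd x - snd p))"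
        using \<open>?R\<close> half[OF y] unfolding le_Liminf_iff by blast
      with ev show "\<forall>\<^sub>F x in at p. y < a x / ereal (norm (x - p))"
      proof eventually_elim
        case (elim x)
        show ?case
          by (rule key[OF y _ _ _ _ elim(2)]) (use bounds[OF elim(1)] in blast)+
      qed
    qed
  qed
  thus ?thesis unfolding regular_subdifferential_def by simp
qed

text \<open>The functional \<open>(z, w) \<mapsto> f z + g w\<close>, identifying pairs of functionals with the dual of the product.\<close>

definition pair_functional ::
    "('a::real_normed_vector \<Rightarrow>\<^sub>L real) \<Rightarrow> ('b::real_normed_vector \<Rightarrow>\<^sub>L real) \<Rightarrow> ('a \<times> 'b) \<Rightarrow>\<^sub>L real" where
  "pair_functional f g = (f o\<^sub>L fst_blinfun) + (g o\<^sub>L snd_blinfun)"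

lemma pair_functional_apply: "blinfun_apply (pair_functional f g) (z, w) = blinfun_apply f z + blinfun_apply g w"
  by (simp add: pair_functional_def blinfun.add_left)

definition mgraph :: "('z \<Rightarrow> 'w set) \<Rightarrow> ('z \<times> 'w) set" where
  "mgraph F = {(z, w). w \<in> F z}"

definition regular_coderivative ::
    "('z::real_normed_vector \<Rightarrow> 'w::real_normed_vector set) \<Rightarrow> 'z \<Rightarrow> 'w \<Rightarrow>
      ('w \<Rightarrow>\<^sub>L real) \<Rightarrow> ('z \<Rightarrow>\<^sub>L real) set" where
  "regular_coderivative F z w ws =
     {zs. pair_functional zs (- ws) \<in> regular_normal_cone (z, w) (mgraph F)}"

text \<open>
  On a Hilbert space a vector \<open>v\<close> is identified with the functional \<^term>\<open>blinfun_inner_right v\<close>.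
\<close>

definition limiting_subgradients ::
    "('x::{real_inner,complete_space} \<Rightarrow> ereal) \<Rightarrow> 'x \<Rightarrow> 'x set" where
  "limiting_subgradients \<phi> u = {us. blinfun_inner_right us \<in> limiting_subdifferential \<phi> u}"

definition partial_subdifferential ::
    "('x::{real_inner,complete_space} \<times> 'e \<Rightarrow> ereal) \<Rightarrow> 'x \<times> 'e \<Rightarrow> 'x set" where
  "partial_subdifferential \<psi> = (\<lambda>(u, e). limiting_subgradients (\<lambda>x. \<psi> (x, e)) u)"

definition combined_second_subdifferential ::
    "('x::{real_inner,complete_space} \<Rightarrow> ereal) \<Rightarrow> 'x \<Rightarrow> 'x \<Rightarrow> 'x \<Rightarrow> 'x set" where
  "combined_second_subdifferential \<phi> u us v =
     {vs. blinfun_inner_right vs \<in>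
            regular_coderivative (limiting_subgradients \<phi>) u us (blinfun_inner_right v)}"

section \<open>Full stability\<close>

definition perturbed_objective ::
    "('x::real_inner \<times> 'e \<Rightarrow> ereal) \<Rightarrow> 'x \<times> 'e \<Rightarrow> 'x \<Rightarrow> ereal" where
  "perturbed_objective \<psi> = (\<lambda>(us, e) u. \<psi> (u, e) - ereal (us \<bullet> u))"

definition m_val ::
    "('x::real_inner \<times> 'e \<Rightarrow> ereal) \<Rightarrow> 'x \<Rightarrow> real \<Rightarrow> 'x \<times> 'e \<Rightarrow> ereal" where
  "m_val \<psi> u0 \<gamma> p = (INF u\<in>cball u0 \<gamma>. perturbed_objective \<psi> p u)"

definition M_argmin ::
    "('x::real_inner \<times> 'e \<Rightarrow> ereal) \<Rightarrow> 'x \<Rightarrow> real \<Rightarrow> 'x \<times> 'e \<Rightarrow> 'x set" where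
  "M_argmin \<psi> u0 \<gamma> p = {u. is_arg_min (perturbed_objective \<psi> p) (\<lambda>x. x \<in> cball u0 \<gamma>) u}"

definition sum_lipschitz_on ::
    "('a::real_normed_vector \<times> 'b::real_normed_vector) set \<Rightarrow> ('a \<times> 'b \<Rightarrow> 'c::real_normed_vector) \<Rightarrow> bool" where
  "sum_lipschitz_on W f \<longleftrightarrow>
     (\<exists>\<kappa>\<ge>0. \<forall>(a, b)\<in>W. \<forall>(a', b')\<in>W.
        norm (f (a, b) - f (a', b')) \<le> \<kappa> * (norm (a - a') + norm (b - b')))"

text \<open>Lipschitz continuity of an extended-real-valued function includes its finiteness.\<close>

definition ereal_lipschitz_on ::
    "('a::real_normed_vector \<times> 'b::real_normed_vector) set \<Rightarrow> ('a \<times> 'b \<Rightarrow> ereal) \<Rightarrow> bool" where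
  "ereal_lipschitz_on W f \<longleftrightarrow>
     (\<forall>p\<in>W. \<bar>f p\<bar> \<noteq> \<infinity>) \<and> sum_lipschitz_on W (\<lambda>p. real_of_ereal (f p))"

text \<open>In both definitions \<open>\<theta>\<close> is the single-valued selection that \<^const>\<open>M_argmin\<close> reduces to.\<close>

definition lipschitz_fully_stable ::
    "('x::real_inner \<times> 'e::real_normed_vector \<Rightarrow> ereal) \<Rightarrow> 'x \<Rightarrow> 'x \<Rightarrow> 'e \<Rightarrow> bool" where
  "lipschitz_fully_stable \<psi> u0 us0 e0 \<longleftrightarrow>
     (\<exists>\<gamma>>0. \<exists>W \<theta>. open W \<and> (us0, e0) \<in> W \<and>
        (\<forall>p\<in>W. M_argmin \<psi> u0 \<gamma> p = {\<theta> p}) \<and>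
        sum_lipschitz_on W \<theta> \<and> M_argmin \<psi> u0 \<gamma> (us0, e0) = {u0} \<and>
        ereal_lipschitz_on W (m_val \<psi> u0 \<gamma>))"

definition hoelder_fully_stable ::
    "('x::real_inner \<times> 'e::real_normed_vector \<Rightarrow> ereal) \<Rightarrow> 'x \<Rightarrow> 'x \<Rightarrow> 'e \<Rightarrow> bool" where
  "hoelder_fully_stable \<psi> u0 us0 e0 \<longleftrightarrow>
     (\<exists>\<gamma>>0. \<exists>\<kappa>>0. \<exists>U V \<theta>. open U \<and> us0 \<in> U \<and> open V \<and> e0 \<in> V \<and>
        (\<forall>p\<in>U \<times> V. M_argmin \<psi> u0 \<gamma> p = {\<theta> p}) \<and> M_argmin \<psi> u0 \<gamma> (us0, e0) = {u0} \<and>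
        (\<forall>us\<in>U. \<forall>us'\<in>U. \<forall>e\<in>V. \<forall>e'\<in>V.
           norm (\<theta> (us, e) - \<theta> (us', e')) \<le> \<kappa> * (norm (us - us') + sqrt (norm (e - e')))) \<and>
        ereal_lipschitz_on (U \<times> V) (m_val \<psi> u0 \<gamma>))"

end

theory Submission
  imports Defs
begin

text \<open>
  Let \<open>f\<close> be the finite part of \<open>\<phi>\<close> and \<open>g\<close> its partial gradient in \<open>u\<close>. Near the base point
  \<open>\<partial>\<^sub>u\<psi>(u, e) = g(u, e) + N\<^sub>K(u)\<close>, and (iii) is (iv) by the exact sum rule for the smooth part.

  (iv) implies (i). Fix \<open>\<lambda>\<close> larger than the Lipschitz constant of \<open>g\<close> and let \<open>T z\<close> be the point \<open>x\<close> with
  \<open>us + \<lambda>(z - x) \<in> \<partial>\<^sub>u\<psi>(x, e)\<close>. A regular subgradient \<open>p\<close> of \<open>\<langle>q, T\<rangle>\<close> is a coderivative element of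
  \<open>\<partial>\<^sub>u\<psi>\<close>, and (iv) turns into \<open>|p| \<le> |q| / (1 + \<delta>/\<lambda>)\<close>. By a mean value inequality for regular
  subgradients, \<open>T\<close> is a contraction. Its fixed point is stationary and Lipschitz in \<open>(us, e)\<close>, and since
  iterating \<open>T\<close> from any nearby point of \<open>K\<close> decreases the objective, it is the strict minimizer.

  (ii) implies (iv). For fixed \<open>e\<close> the minimizer \<open>\<theta>\<close> is a Lipschitz gradient of a convex function of
  \<open>us\<close>, hence cocoercive. A fixed point argument and the hypomonotonicity of \<open>\<partial>\<^sub>u\<psi>\<close> show that every
  graph point near the base point is \<open>(\<theta>(us), us)\<close>; testing a normal there in the direction
  \<open>vs - 2 c v\<close>, where \<open>c\<close> is the cocoercivity constant, gives \<open>\<langle>vs, v\<rangle> \<ge> c |v|\<^sup>2\<close>.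
\<close>

section \<open>Hilbert space preliminaries\<close>

text \<open>The obstacle between (iv) and (i) is that the inverse of the subdifferential is not
  known to be single-valued, and that little exact calculus holds for regular coderivatives. The
  proximal map \<open>T\<close> is single-valued and Lipschitz before (iv) is used, since the added
  \<open>4 * L\<close> outweighs the hypomonotonicity constant \<open>L\<close>. Its graph is that
  of the subdifferential after a linear change of variables, which carries regular normals exactly,
  and its fixed points are the stationary points whatever multiple is added. The bound is needed at
  all nearby graph points because the mean value inequality does not control where its subgradient
  is taken; in infinite dimension exact minimizers may be missing, hence the variational principle.
  From (ii) to (iv) the cocoercivity argument runs at a fixed \<open>e\<close>, and the exponent 1/2
  serves only to keep \<open>\<theta> (us, e)\<close> near \<open>u0\<close> as \<open>e\<close>
  varies. All statements meet in \<open>coderivative_bound\<close>, the slice condition (iv) in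
  terms of vectors and real numbers.\<close>

lemma Cauchy_geometric:
  fixes y :: "nat \<Rightarrow> 'a::real_normed_vector"
  assumes "\<And>n. norm (y (Suc n) - y n) \<le> c * (1/2)^n"
  shows "Cauchy y"
proof -
  have c: "c \<ge> 0" using order_trans[OF norm_ge_zero assms[of 0]] by simp
  have step: "norm (y (n + k) - y n) \<le> 2 * c * (1/2)^n * (1 - (1/2)^k)" for n k
  proof (induction k)
    case (Suc k)
    have "norm (y (n + Suc k) - y n) \<le> norm (y (Suc (n + k)) - y (n + k)) + norm (y (n + k) - y n)"
      using norm_triangle_ineq[of "y (Suc (n + k)) - y (n + k)" "y (n + k) - y n"] by simp
    also have "\<dots> \<le> c * (1/2)^(n + k) + 2 * c * (1/2)^n * (1 - (1/2)^k)"
      using assms[of "n + k"] Suc by linarith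
    also have "\<dots> = 2 * c * (1/2)^n * (1 - (1/2)^Suc k)"
      by (simp add: power_add field_simps)
    finally show ?case .
  qed simp
  have bound: "norm (y m - y n) \<le> 2 * c * (1/2)^n" if "m \<ge> n" for m n
  proof -
    have "norm (y m - y n) \<le> 2 * c * (1/2)^n * (1 - (1/2)^(m - n))"
      using step[of n "m - n"] that by simp
    also have "\<dots> \<le> 2 * c * (1/2)^n * 1"
      using c by (intro mult_left_mono) auto
    finally show ?thesis by simp
  qed
  show ?thesis
  proof (rule CauchyI')
    fix e :: real assume e: "e > 0"
    have "(\<lambda>n. 2 * c * (1/2)^n) \<longlonglongrightarrow> 2 * c * 0"
      by (intro tendsto_intros LIMSEQ_realpow_zero) auto
    hence "\<forall>\<^sub>F n in sequentially. 2 * c * (1/2)^n < e"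
      using e by (intro order_tendstoD) auto
    then obtain N where N: "\<And>n. n \<ge> N \<Longrightarrow> 2 * c * (1/2)^n < e"
      unfolding eventually_sequentially by blast
    show "\<exists>M. \<forall>m\<ge>M. \<forall>n>m. dist (y m) (y n) < e"
      using bound N by (metis dist_norm less_imp_le norm_minus_commute order_le_less_trans)
  qed
qed

text \<open>By the parallelogram law, points of \<open>C\<close> whose squared distances to
  \<open>z\<close> are nearly minimal are close to each other, so a minimizing sequence converges.
  Convexity enters through midpoints here and through short segments from \<open>p\<close> to
  \<open>k\<close> in the inequality.\<close>

lemma closed_convex_projection:
  fixes C :: "'x::{real_inner,complete_space} set"
  assumes "closed C" "convex C" "C \<noteq> {}"
  obtains p where "p \<in> C" "\<And>k. k \<in> C \<Longrightarrow> (z - p) \<bullet> (k - p) \<le> 0"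
proof -
  define d where "d = (INF x\<in>C. (norm (x - z))\<^sup>2)"
  have bdd: "bdd_below ((\<lambda>x. (norm (x - z))\<^sup>2) ` C)" by (rule bdd_belowI2[of _ 0]) simp
  have d: "d \<le> (norm (x - z))\<^sup>2" if "x \<in> C" for x
    unfolding d_def by (rule cINF_lower[OF bdd that])
  \<comment> \<open>The tolerances decay like \<open>(1/4)^n\<close>, so that after the square root
    the steps decay like \<open>(1/2)^n\<close>.\<close>
  have "\<exists>x\<in>C. (norm (x - z))\<^sup>2 < d + (1/4)^n" for n :: nat
  proof -
    have "(INF x\<in>C. (norm (x - z))\<^sup>2) < d + (1/4)^n" by (simp add: d_def)
    thus ?thesis using cINF_less_iff[OF assms(3) bdd] by blast
  qed
  then obtain y where yC: "\<And>n. y n \<in> C" and y: "\<And>n. (norm (y n - z))\<^sup>2 < d + (1/4)^n"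
    by metis
  have near: "(norm (a - b))\<^sup>2 \<le> 2 * (norm (a - z))\<^sup>2 + 2 * (norm (b - z))\<^sup>2 - 4 * d"
    if "a \<in> C" "b \<in> C" for a b
  proof -
    have "(1/2) *\<^sub>R a + (1/2) *\<^sub>R b \<in> C" using assms(2) that by (intro convexD) auto
    moreover have "(1/2) *\<^sub>R a + (1/2) *\<^sub>R b - z = (1/2) *\<^sub>R (a - z) + (1/2) *\<^sub>R (b - z)"
      using scaleR_left_distrib[of "1/2" "1/2" z] by (simp add: algebra_simps)
    ultimately have "d \<le> (norm ((1/2) *\<^sub>R (a - z) + (1/2) *\<^sub>R (b - z)))\<^sup>2"
      using d by metis
    thus ?thesis
      by (simp add: power2_norm_eq_inner algebra_simps inner_commute)
  qed
  have "norm (y (Suc n) - y n) \<le> 2 * (1/2)^n" for n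
  proof -
    have p4: "(1/4::real)^Suc n \<le> (1/4)^n" by simp
    have "(norm (y (Suc n) - y n))\<^sup>2 \<le> 4 * (1/4)^n"
      using near[OF yC[of "Suc n"] yC[of n]] y[of n] y[of "Suc n"] p4 by linarith
    also have "\<dots> = (2 * (1/2)^n)\<^sup>2" by (simp add: power2_eq_square flip: power_mult_distrib)
    finally show ?thesis by (rule power2_le_imp_le) simp
  qed
  hence "Cauchy y" by (rule Cauchy_geometric)
  then obtain p where lim: "y \<longlonglongrightarrow> p" using Cauchy_convergent convergent_def by blast
  have pC: "p \<in> C" by (rule closed_sequentially[OF assms(1) yC lim])
  have "(\<lambda>n. d + (1/4)^n) \<longlonglongrightarrow> d + 0"
    by (intro tendsto_intros LIMSEQ_realpow_zero) auto
  moreover have "(\<lambda>n. (norm (y n - z))\<^sup>2) \<longlonglongrightarrow> (norm (p - z))\<^sup>2"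
    by (intro tendsto_intros lim)
  ultimately have pd: "(norm (p - z))\<^sup>2 \<le> d"
    by (intro LIMSEQ_le[where X = "\<lambda>n. (norm (y n - z))\<^sup>2"]) (auto intro!: exI[of _ 0] less_imp_le y)
  have "(z - p) \<bullet> (k - p) \<le> 0" if k: "k \<in> C" for k
  proof (rule ccontr)
    assume neg: "\<not> ?thesis"
    define c where "c = (z - p) \<bullet> (k - p)"
    define N where "N = (norm (k - p))\<^sup>2"
    have c: "c > 0" using neg by (simp add: c_def)
    have N: "N \<ge> 0" by (simp add: N_def)
    \<comment> \<open>So short that the quadratic term \<open>t * t * N\<close> cannot offset the
      first-order decrease \<open>2 * t * c\<close>.\<close>
    define t where "t = min 1 (c / (N + 1))"
    have t: "0 < t" "t \<le> 1" using c N by (auto simp: t_def)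
    have "t * N \<le> c"
    proof -
      have "t * N \<le> c / (N + 1) * N" using N by (intro mult_right_mono) (auto simp: t_def)
      also have "\<dots> \<le> c" using N c by (simp add: field_simps)
      finally show ?thesis .
    qed
    have "(1 - t) *\<^sub>R p + t *\<^sub>R k \<in> C" using assms(2) pC k t by (intro convexD) auto
    moreover have "(1 - t) *\<^sub>R p + t *\<^sub>R k - z = (p - z) + t *\<^sub>R (k - p)"
      by (simp add: algebra_simps)
    ultimately have "(norm (p - z))\<^sup>2 \<le> (norm ((p - z) + t *\<^sub>R (k - p)))\<^sup>2"
      using d pd by (metis order_trans)
    hence "0 \<le> t * (t * N - 2 * c)"
      unfolding N_def c_def
      by (simp add: power2_norm_eq_inner algebra_simps inner_commute)
    hence "t * N - 2 * c \<ge> 0" using t by (simp add: zero_le_mult_iff)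
    thus False using \<open>t * N \<le> c\<close> c by linarith
  qed
  with pC show thesis using that by blast
qed

text \<open>The representer is a multiple of \<open>p\<close>, the point closest to the origin on
  the hyperplane where \<open>f\<close> is 1.\<close>

lemma riesz_representation:
  fixes f :: "'x::{real_inner,complete_space} \<Rightarrow>\<^sub>L real"
  obtains a where "\<And>x. blinfun_apply f x = a \<bullet> x"
proof (cases "f = 0")
  case True
  thus thesis using that[of 0] by simp
next
  case False
  then obtain x0 where x0: "blinfun_apply f x0 \<noteq> 0" by (metis blinfun_eqI zero_blinfun.rep_eq)
  define C where "C = {x. blinfun_apply f x = 1}"
  have "closed C" unfolding C_def by (intro closed_Collect_eq continuous_intros)
  moreover have "convex C" unfolding C_def convex_def by (auto simp: blinfun.add_right blinfun.scaleR_right)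
  moreover have "C \<noteq> {}"
  proof -
    have "(1 / blinfun_apply f x0) *\<^sub>R x0 \<in> C" using x0 by (simp add: C_def blinfun.scaleR_right)
    thus ?thesis by blast
  qed
  ultimately obtain p where p: "p \<in> C" "\<And>k. k \<in> C \<Longrightarrow> (0 - p) \<bullet> (k - p) \<le> 0"
    using closed_convex_projection by metis
  \<comment> \<open>\<open>p + h\<close> and \<open>p - h\<close> both lie in \<open>C\<close>, so
    the projection inequality holds with both signs.\<close>
  have ker: "p \<bullet> h = 0" if "blinfun_apply f h = 0" for h
    using p(2)[of "p + h"] p(2)[of "p - h"] p(1) that
    by (simp add: C_def blinfun.add_right blinfun.diff_right)
  have pp: "p \<bullet> p \<noteq> 0" using p(1) by (auto simp: C_def)
  have "blinfun_apply f x = (p /\<^sub>R (p \<bullet> p)) \<bullet> x" for x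
  proof -
    have "p \<bullet> (x - blinfun_apply f x *\<^sub>R p) = 0"
      using p(1) by (intro ker) (simp add: C_def blinfun.diff_right blinfun.scaleR_right)
    thus ?thesis using pp by (simp add: inner_diff_right field_simps)
  qed
  thus thesis using that by blast
qed

text \<open>Needed where weak* convergent subgradients are evaluated at moving points: convergence
  at each vector has to bound the norms. The proof is by Baire's theorem.\<close>

lemma uniform_boundedness:
  fixes f :: "nat \<Rightarrow> 'x::{real_normed_vector,complete_space} \<Rightarrow>\<^sub>L real"
  assumes "\<And>x. Bseq (\<lambda>n. blinfun_apply (f n) x)"
  obtains B where "B > 0" "\<And>n. norm (f n) \<le> B"
proof -
  define A where "A m = {x. \<forall>n. \<bar>blinfun_apply (f n) x\<bar> \<le> real m}" for m
  have clo: "closed (A m)" for m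
    unfolding A_def by (intro closed_Collect_all closed_Collect_le continuous_intros)
  have un: "(\<Union>m. A m) = UNIV"
  proof -
    have "x \<in> (\<Union>m. A m)" for x
    proof -
      from assms[of x] obtain b where "\<And>n. \<bar>blinfun_apply (f n) x\<bar> \<le> b"
        unfolding Bseq_def by auto
      moreover obtain m where "b \<le> real m" using real_arch_simple by blast
      ultimately show ?thesis unfolding A_def by (auto intro: order_trans)
    qed
    thus ?thesis by blast
  qed
  have "\<exists>m. interior (A m) \<noteq> {}"
  proof (rule ccontr)
    assume "\<not> ?thesis"
    hence "\<And>m. interior (A m) = {}" by blast
    hence "Met_TC.mtopology interior_of (\<Union>(range A)) = ({}::'x set)"
      using clo
      by (intro Met_TC.metric_Baire_category_alt) (auto simp: complete_UNIV)
    thus False using un by simp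
  qed
  then obtain m a where "a \<in> interior (A m)" by blast
  then obtain r where r: "r > 0" "cball a r \<subseteq> A m"
    by (meson interior_subset mem_interior_cball order_trans)
  have "norm (f n) \<le> 2 * real m / r" for n
  proof (rule norm_blinfun_bound)
    show "0 \<le> 2 * real m / r" using r by simp
    fix x :: 'x
    show "norm (blinfun_apply (f n) x) \<le> 2 * real m / r * norm x"
    proof (cases "x = 0")
      case False
      \<comment> \<open>\<open>h\<close> has length \<open>r\<close>, and \<open>f n\<close> at
        \<open>h\<close> is the difference of its values at two points of \<open>A m\<close>, whence
        the factor 2.\<close>
      define h where "h = (r / norm x) *\<^sub>R x"
      have "a \<in> A m" "a + h \<in> A m" using r False by (auto simp: h_def dist_norm intro!: subsetD[OF r(2)])
      hence "\<bar>blinfun_apply (f n) a\<bar> \<le> m" "\<bar>blinfun_apply (f n) a + blinfun_apply (f n) h\<bar> \<le> m"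
        by (auto simp: A_def blinfun.add_right)
      hence "\<bar>blinfun_apply (f n) h\<bar> \<le> 2 * real m" by linarith
      hence "r * \<bar>blinfun_apply (f n) x\<bar> / norm x \<le> 2 * real m"
        using r by (simp add: h_def blinfun.scaleR_right abs_mult)
      thus ?thesis using r False by (simp add: field_simps)
    qed simp
  qed
  thus thesis using that[of "2 * real m / r + 1"] r
    by (smt (verit) divide_nonneg_pos of_nat_0_le_iff)
qed

section \<open>A mean value inequality for regular subgradients\<close>

text \<open>
  The Borwein--Preiss principle. In a Hilbert space the weighted sum of the squared distances to the
  approximate minimizers \<open>y n\<close> is, up to a constant, one multiple of the squared distance to their
  weighted mean, so a single quadratic perturbation suffices.
\<close>

lemma smooth_variational_principle:
  fixes F :: "'x::{real_inner,complete_space} \<Rightarrow> real"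
  assumes T: "T > 0" and s: "s > 0"
    and cont: "continuous_on (cball b T) F"
    and low: "\<And>x. x \<in> cball b T \<Longrightarrow> m \<le> F x"
  obtains w y where "w \<in> cball b T" "y \<in> cball b T"
    "\<And>x. x \<in> cball b T \<Longrightarrow> F y + s * (norm (y - w))\<^sup>2 \<le> F x + s * (norm (x - w))\<^sup>2"
proof -
  let ?C = "cball b T"
  \<comment> \<open>The weights \<epsilon> sum to \<open>s\<close> and have partial sums \<sigma>.
    The tolerances \<delta> are small against the weights, which will make consecutive
    near-minimizers \<open>(1/2)^n\<close>-close.\<close>
  define \<epsilon> where "\<epsilon> n = s * (1/2)^Suc n" for n
  define \<delta> where "\<delta> n = \<epsilon> n * (1/4)^n / 2" for n
  define \<sigma> where "\<sigma> n = s * (1 - (1/2)^n)" for n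
  \<comment> \<open>For \<open>Y = Y n\<close> this is, up to a constant, \<open>F x\<close> plus
    the sum of \<open>\<epsilon> k * (norm (x - y k))\<^sup>2\<close> over \<open>k < n\<close>;
    only the weighted sum of the earlier points has to be remembered.\<close>
  define J where "J n Y x = F x + \<sigma> n * (norm x)\<^sup>2 - 2 * (x \<bullet> Y)" for n Y x
  have eps: "\<epsilon> n > 0" for n using s by (simp add: \<epsilon>_def)
  have del: "\<delta> n > 0" for n using eps by (simp add: \<delta>_def)
  have sig: "\<sigma> (Suc n) = \<sigma> n + \<epsilon> n" for n by (simp add: \<sigma>_def \<epsilon>_def field_simps)
  have sig0: "\<sigma> n \<ge> 0" for n using s by (auto simp: \<sigma>_def power_le_one)
  have near: "\<exists>y. y \<in> ?C \<and> (\<forall>x\<in>?C. J n Y y \<le> J n Y x + \<delta> n)" for n Y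
  proof -
    have "m - 2 * ((norm b + T) * norm Y) \<le> J n Y x" if "x \<in> ?C" for x
    proof -
      have "norm x \<le> norm b + T"
        using that norm_triangle_ineq[of b "x - b"] by (simp add: dist_norm norm_minus_commute)
      hence "x \<bullet> Y \<le> (norm b + T) * norm Y"
        by (intro order_trans[OF norm_cauchy_schwarz] mult_right_mono) auto
      thus ?thesis using low[OF that] sig0[of n] unfolding J_def
        by (smt (verit) mult_nonneg_nonneg zero_le_power2)
    qed
    hence bdd: "bdd_below (J n Y ` ?C)" by (rule bdd_belowI2)
    have ne: "?C \<noteq> {}" using T by simp
    have "(INF x\<in>?C. J n Y x) < (INF x\<in>?C. J n Y x) + \<delta> n" using del by simp
    then obtain y where "y \<in> ?C" "J n Y y < (INF x\<in>?C. J n Y x) + \<delta> n"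
      using cINF_less_iff[OF ne bdd] by blast
    moreover have "(INF x\<in>?C. J n Y x) \<le> J n Y x" if "x \<in> ?C" for x
      by (rule cINF_lower[OF bdd that])
    ultimately show ?thesis by force
  qed
  define sel where "sel n Y = (SOME y. y \<in> ?C \<and> (\<forall>x\<in>?C. J n Y y \<le> J n Y x + \<delta> n))" for n Y
  have sel: "sel n Y \<in> ?C" "x \<in> ?C \<Longrightarrow> J n Y (sel n Y) \<le> J n Y x + \<delta> n" for n Y x
    using someI_ex[OF near[of n Y]] unfolding sel_def by blast+
  define Y where "Y = rec_nat 0 (\<lambda>n Y. Y + \<epsilon> n *\<^sub>R sel n Y)"
  define y where "y n = sel n (Y n)" for n
  have Y0: "Y 0 = 0" and YS: "Y (Suc n) = Y n + \<epsilon> n *\<^sub>R y n" for n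
    by (simp_all add: Y_def y_def)
  have yC: "y n \<in> ?C" and ymin: "x \<in> ?C \<Longrightarrow> J n (Y n) (y n) \<le> J n (Y n) x + \<delta> n" for n x
    using sel by (simp_all add: y_def)
  have JS: "J (Suc n) (Y (Suc n)) x = J n (Y n) x + \<epsilon> n * (norm (x - y n))\<^sup>2 - \<epsilon> n * (norm (y n))\<^sup>2" for n x
    unfolding J_def YS sig by (simp add: power2_norm_eq_inner algebra_simps inner_commute)
  have "norm (y (Suc n) - y n) \<le> 1 * (1/2)^n" for n
  proof -
    \<comment> \<open>\<open>y n\<close> and \<open>y (Suc n)\<close> nearly minimize
      \<open>J\<close> at consecutive stages; comparing each with the other leaves only the newly
      added square.\<close>
    have "\<epsilon> n * (norm (y (Suc n) - y n))\<^sup>2 \<le> \<delta> n + \<delta> (Suc n)"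
      using ymin[OF yC[of n], of "Suc n"] ymin[OF yC[of "Suc n"], of n] unfolding JS by simp
    also have "\<dots> \<le> 2 * \<delta> n" using s by (simp add: \<delta>_def \<epsilon>_def)
    also have "\<dots> = \<epsilon> n * ((1/2)^n)\<^sup>2"
      by (simp add: \<delta>_def power2_eq_square flip: power_mult_distrib)
    finally have "(norm (y (Suc n) - y n))\<^sup>2 \<le> ((1/2)^n)\<^sup>2" using eps by simp
    thus ?thesis using power2_le_imp_le by fastforce
  qed
  hence "Cauchy y" by (rule Cauchy_geometric)
  then obtain yl where yl: "y \<longlonglongrightarrow> yl" using Cauchy_convergent convergent_def by blast
  have ylC: "yl \<in> ?C" by (rule closed_sequentially[OF closed_cball yC yl])
  have "norm (Y (Suc n) - Y n) \<le> (s * (norm b + T)) * (1/2)^n" for n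
  proof -
    have "norm (y n) \<le> norm b + T"
      using yC[of n] norm_triangle_ineq[of b "y n - b"] by (simp add: dist_norm norm_minus_commute)
    hence "\<epsilon> n * norm (y n) \<le> \<epsilon> n * (norm b + T)" using eps[of n] by simp
    also have "\<dots> \<le> (s * (1/2)^n) * (norm b + T)"
      using s T by (intro mult_right_mono) (auto simp: \<epsilon>_def)
    finally show ?thesis using eps[of n] by (simp add: YS mult_ac)
  qed
  hence "Cauchy Y" by (rule Cauchy_geometric)
  then obtain Yl where Yl: "Y \<longlonglongrightarrow> Yl" using Cauchy_convergent convergent_def by blast
  \<comment> \<open>\<open>Y n\<close> is \<sigma> n times a convex combination of points of the
    ball. Multiplied out, this avoids dividing by \<open>\<sigma> 0 = 0\<close>.\<close>
  have "norm (Y n - \<sigma> n *\<^sub>R b) \<le> \<sigma> n * T" for n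
  proof (induction n)
    case (Suc n)
    have "Y (Suc n) - \<sigma> (Suc n) *\<^sub>R b = (Y n - \<sigma> n *\<^sub>R b) + \<epsilon> n *\<^sub>R (y n - b)"
      by (simp add: YS sig algebra_simps)
    also have "norm \<dots> \<le> norm (Y n - \<sigma> n *\<^sub>R b) + \<epsilon> n * norm (y n - b)"
      using norm_triangle_ineq[of "Y n - \<sigma> n *\<^sub>R b" "\<epsilon> n *\<^sub>R (y n - b)"] eps[of n] by simp
    also have "\<dots> \<le> \<sigma> n * T + \<epsilon> n * T"
      using Suc yC[of n] eps[of n] by (intro add_mono mult_left_mono) (auto simp: dist_norm norm_minus_commute)
    finally show ?case by (simp add: sig algebra_simps)
  qed (simp add: Y0 \<sigma>_def)
  moreover have sigl: "\<sigma> \<longlonglongrightarrow> s"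
  proof -
    have "(\<lambda>n. s * (1 - (1/2)^n)) \<longlonglongrightarrow> s * (1 - 0)"
      by (intro tendsto_intros LIMSEQ_realpow_zero) auto
    thus ?thesis by (simp add: \<sigma>_def[abs_def])
  qed
  ultimately have "norm (Yl - s *\<^sub>R b) \<le> s * T"
    by (intro LIMSEQ_le[OF tendsto_norm[OF tendsto_diff[OF Yl tendsto_scaleR[OF sigl tendsto_const]]]
          tendsto_mult[OF sigl tendsto_const]]) auto
  hence "norm (s *\<^sub>R (Yl /\<^sub>R s - b)) \<le> s * T" using s by (simp add: scaleR_diff_right)
  hence w: "Yl /\<^sub>R s \<in> ?C" using s by (simp add: dist_norm norm_minus_commute)
  have dell: "\<delta> \<longlonglongrightarrow> 0"
  proof -
    have "(\<lambda>n. (s / 4) * (1/8)^n) \<longlonglongrightarrow> (s / 4) * 0"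
      by (intro tendsto_intros LIMSEQ_realpow_zero) auto
    moreover have "\<delta> n = (s / 4) * (1/8)^n" for n
      by (simp add: \<delta>_def \<epsilon>_def flip: power_mult_distrib)
    ultimately have "(\<lambda>n. \<delta> n) \<longlonglongrightarrow> s / 4 * 0" by presburger
    thus ?thesis by simp
  qed
  have Fl: "(\<lambda>n. F (y n)) \<longlonglongrightarrow> F yl"
    by (rule continuous_on_tendsto_compose[OF cont yl ylC]) (use yC in auto)
  have final: "F yl + s * (norm yl)\<^sup>2 - 2 * (yl \<bullet> Yl) \<le> F x + s * (norm x)\<^sup>2 - 2 * (x \<bullet> Yl) + 0" if "x \<in> ?C" for x
  proof (rule LIMSEQ_le)
    show "(\<lambda>n. J n (Y n) (y n)) \<longlonglongrightarrow> F yl + s * (norm yl)\<^sup>2 - 2 * (yl \<bullet> Yl)"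
      unfolding J_def by (intro tendsto_intros Fl sigl yl Yl)
    show "(\<lambda>n. J n (Y n) x + \<delta> n) \<longlonglongrightarrow> F x + s * (norm x)\<^sup>2 - 2 * (x \<bullet> Yl) + 0"
      unfolding J_def by (intro tendsto_intros sigl Yl dell)
    show "\<exists>N. \<forall>n\<ge>N. J n (Y n) (y n) \<le> J n (Y n) x + \<delta> n" using ymin[OF that] by blast
  qed
  \<comment> \<open>Completing the square: up to a constant, the limiting perturbation is
    \<open>s\<close> times the squared distance to \<open>Yl /\<^sub>R s\<close>.\<close>
  have sq: "s * (norm (x - Yl /\<^sub>R s))\<^sup>2 = s * (norm x)\<^sup>2 - 2 * (x \<bullet> Yl) + s * (norm (Yl /\<^sub>R s))\<^sup>2" for x
    using s by (simp add: power2_norm_eq_inner algebra_simps inner_commute) (simp add: field_simps power2_eq_square)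
  show thesis
  proof (rule that[OF w ylC])
    fix x assume "x \<in> ?C"
    from final[OF this] show "F yl + s * (norm (yl - Yl /\<^sub>R s))\<^sup>2 \<le> F x + s * (norm (x - Yl /\<^sub>R s))\<^sup>2"
      unfolding sq by simp
  qed
qed

text \<open>The Frechet subgradient of a real-valued function, represented by a vector. The quotient
  is cleared, so that \<open>z = y\<close> needs no exclusion.\<close>

definition is_regular_subgradient :: "('x::real_inner \<Rightarrow> real) \<Rightarrow> 'x \<Rightarrow> 'x \<Rightarrow> bool" where
  "is_regular_subgradient h y p \<longleftrightarrow>
     (\<forall>\<epsilon>>0. \<exists>d>0. \<forall>z. norm (z - y) < d \<longrightarrow> h z - h y - p \<bullet> (z - y) \<ge> - \<epsilon> * norm (z - y))"

text \<open>Fermat's rule with a differentiable perturbation. It is the only source of subgradients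
  in the mean value inequality.\<close>

lemma regular_subgradient_at_local_min:
  assumes G: "(G has_derivative (\<bullet>) q) (at y)" and r: "r > 0"
    and min: "\<And>z. norm (z - y) < r \<Longrightarrow> h y + G y \<le> h z + G z"
  shows "is_regular_subgradient h y (- q)"
  unfolding is_regular_subgradient_def
proof (intro allI impI)
  fix \<epsilon> :: real assume "\<epsilon> > 0"
  from G[unfolded has_derivative_at_alt] this obtain d where d: "d > 0"
    "\<And>z. norm (z - y) < d \<Longrightarrow> norm (G z - G y - q \<bullet> (z - y)) \<le> \<epsilon> * norm (z - y)"
    by blast
  show "\<exists>d>0. \<forall>z. norm (z - y) < d \<longrightarrow> h z - h y - (- q) \<bullet> (z - y) \<ge> - \<epsilon> * norm (z - y)"
  proof (intro exI[of _ "min d r"] conjI allI impI)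
    fix z assume z: "norm (z - y) < min d r"
    hence "\<bar>G z - G y - q \<bullet> (z - y)\<bar> \<le> \<epsilon> * norm (z - y)" "h y + G y \<le> h z + G z"
      using d(2)[of z] min[of z] by auto
    thus "h z - h y - (- q) \<bullet> (z - y) \<ge> - \<epsilon> * norm (z - y)" by (simp add: inner_minus_left)
  qed (use d r in auto)
qed

text \<open>If the inequality failed, then \<open>h\<close> plus \<open>c' > c\<close> times the
  distance to \<open>b\<close> plus a quadratic penalty would be smaller at \<open>a\<close> than at
  \<open>b\<close>, and a slight perturbation would attain its minimum at some \<open>y\<close>
  other than \<open>b\<close>. The subgradient found there would be longer than \<open>c\<close>.
  The penalty keeps \<open>y\<close> inside the open ball, where \<open>sub\<close> applies; its
  price is the last term, of second order in \<open>norm (a - b)\<close>.\<close>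

lemma regular_subgradient_mean_value:
  fixes h :: "'x::{real_inner,complete_space} \<Rightarrow> real"
  assumes T: "T > 0" and L: "L \<ge> 0" and c: "c \<ge> 0"
    and lip: "\<And>x y. x \<in> cball b T \<Longrightarrow> y \<in> cball b T \<Longrightarrow> \<bar>h x - h y\<bar> \<le> L * norm (x - y)"
    and sub: "\<And>y p. y \<in> ball b T \<Longrightarrow> is_regular_subgradient h y p \<Longrightarrow> norm p \<le> c"
    and a: "a \<in> cball b T"
  shows "h b - h a \<le> c * norm (a - b) + L / T * (norm (a - b))\<^sup>2"
proof (rule ccontr)
  assume neg: "\<not> ?thesis"
  \<comment> \<open>At distance \<open>T\<close> from \<open>b\<close> the penalty \<open>M T\<^sup>2 = L T\<close> outweighs the decrease of \<open>h\<close>.\<close>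
  define M where "M = L / T"
  have M: "M \<ge> 0" using T L by (simp add: M_def)
  define gap where "gap = h b - h a - c * norm (a - b) - M * (norm (a - b))\<^sup>2"
  have gap: "gap > 0" using neg by (simp add: gap_def M_def)
  define N where "N = norm (a - b)"
  have N: "0 \<le> N" "N \<le> T" using a by (auto simp: N_def dist_norm norm_minus_commute)
  \<comment> \<open>Raising \<open>c\<close> to \<open>c' = c + k\<close> makes the contradiction
    strict; over distances up to \<open>T\<close> it spends at most half of
    \<open>gap\<close>.\<close>
  define k where "k = gap / (2 * T)"
  have k: "k > 0" "k * N \<le> gap / 2"
  proof -
    show "k > 0" using gap T by (simp add: k_def)
    have "k * N \<le> k * T" using N \<open>k > 0\<close> by simp
    thus "k * N \<le> gap / 2" using T by (simp add: k_def)
  qed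
  define c' where "c' = c + k"
  \<comment> \<open>The first bound keeps the perturbation at \<open>a\<close> below a quarter of
    \<open>gap\<close>, the second keeps its gradient, at most \<open>4 * s * T\<close>, below
    \<open>k / 2\<close>.\<close>
  define s where "s = min (gap / (16 * T\<^sup>2)) (k / (8 * T))"
  have s: "s > 0" "4 * s * T\<^sup>2 \<le> gap / 4" "4 * s * T \<le> k / 2"
  proof -
    show "s > 0" using gap T k by (simp add: s_def)
    have "s \<le> gap / (16 * T\<^sup>2)" by (simp add: s_def)
    thus "4 * s * T\<^sup>2 \<le> gap / 4" using T by (simp add: field_simps)
    have "s \<le> k / (8 * T)" by (simp add: s_def)
    thus "4 * s * T \<le> k / 2" using T by (simp add: field_simps)
  qed
  define P where "P x = c' * norm (x - b) + M * (norm (x - b))\<^sup>2" for x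
  have conth: "continuous_on (cball b T) h"
    unfolding continuous_on_iff
  proof (intro ballI allI impI)
    fix x e assume x: "x \<in> cball b T" and e: "(0::real) < e"
    show "\<exists>d>0. \<forall>x'\<in>cball b T. dist x' x < d \<longrightarrow> dist (h x') (h x) < e"
    proof (intro exI[of _ "e / (L + 1)"] conjI ballI impI)
      fix x' assume x': "x' \<in> cball b T" and "dist x' x < e / (L + 1)"
      hence "(L + 1) * norm (x' - x) < e" using L by (simp add: dist_norm field_simps)
      moreover have "L * norm (x' - x) \<le> (L + 1) * norm (x' - x)" by (intro mult_right_mono) auto
      ultimately show "dist (h x') (h x) < e" using lip[OF x' x] by (simp add: dist_norm)
    qed (use e L in auto)
  qed
  have hlow: "h b - L * norm (x - b) \<le> h x" if "x \<in> cball b T" for x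
    using lip[OF that, of b] T by (simp add: abs_le_iff)
  have cont: "continuous_on (cball b T) (\<lambda>x. h x + P x)"
    unfolding P_def by (intro continuous_intros conth)
  have low: "h b - L * T \<le> h x + P x" if "x \<in> cball b T" for x
  proof -
    have "L * norm (x - b) \<le> L * T" using that L by (intro mult_left_mono) (auto simp: dist_norm norm_minus_commute)
    moreover have "P x \<ge> 0" using M c k by (simp add: P_def c'_def)
    ultimately show ?thesis using hlow[OF that] by linarith
  qed
  obtain w y where w: "w \<in> cball b T" and y: "y \<in> cball b T"
    and min: "\<And>x. x \<in> cball b T \<Longrightarrow> h y + P y + s * (norm (y - w))\<^sup>2 \<le> h x + P x + s * (norm (x - w))\<^sup>2"
    using smooth_variational_principle[OF T s(1) cont low] by metis
  have diam: "norm (x - w) \<le> 2 * T" if "x \<in> cball b T" for x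
  proof -
    have "norm (x - w) \<le> norm (x - b) + norm (w - b)" by (metis norm_triangle_ineq4 diff_diff_eq2 diff_add_cancel add_diff_eq)
    thus ?thesis using that w by (simp add: dist_norm norm_minus_commute)
  qed
  have "s * (norm (a - w))\<^sup>2 \<le> s * (2 * T)\<^sup>2"
    using diam[OF a] s by (intro mult_left_mono power_mono) auto
  hence "s * (norm (a - w))\<^sup>2 \<le> gap / 4" using s(2) by (simp add: power2_eq_square)
  moreover have "h a + P a = h b - gap + k * N"
    by (simp add: P_def gap_def c'_def N_def algebra_simps)
  ultimately have "h y + P y + s * (norm (y - w))\<^sup>2 < h b"
    using min[OF a] k(2) gap by linarith
  hence lt: "h y + P y < h b" using s(1) by (smt (verit) mult_nonneg_nonneg zero_le_power2)
  have yb: "y \<noteq> b" using lt by (auto simp: P_def)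
  have yin: "norm (y - b) < T"
  proof (rule ccontr)
    assume "\<not> ?thesis"
    hence eq: "norm (y - b) = T" using y by (simp add: dist_norm norm_minus_commute)
    have "M * T\<^sup>2 = L * T" using T by (simp add: M_def power2_eq_square)
    moreover have "c' * T \<ge> 0" using c k T by (simp add: c'_def)
    ultimately show False using lt hlow[OF y] by (simp add: P_def eq)
  qed
  define t where "t = norm (y - b)"
  have t: "t > 0" using yb by (simp add: t_def)
  \<comment> \<open>The gradient at \<open>y\<close> of \<open>P\<close> plus the perturbation;
    \<open>y \<noteq> b\<close> makes the norm differentiable there.\<close>
  define q where "q = (c' / t + 2 * M) *\<^sub>R (y - b) + (2 * s) *\<^sub>R (y - w)"
  have der: "((\<lambda>x. P x + s * (norm (x - w))\<^sup>2) has_derivative (\<bullet>) q) (at y)"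
  proof -
    have 1: "((\<lambda>x. norm (x - b)) has_derivative (\<lambda>h. h \<bullet> sgn (y - b))) (at y)"
      using has_derivative_compose[OF has_derivative_diff[OF has_derivative_ident has_derivative_const[of b]]
          has_derivative_norm, of y UNIV] yb by simp
    have 2: "((\<lambda>x. P x + s * ((x - w) \<bullet> (x - w))) has_derivative
       (\<lambda>h. c' * (h \<bullet> sgn (y - b)) + M * (2 * norm (y - b) * (h \<bullet> sgn (y - b))) + s * ((y - w) \<bullet> h + h \<bullet> (y - w)))) (at y)"
      unfolding P_def by (auto intro!: derivative_eq_intros 1)
    have "(\<lambda>h. c' * (h \<bullet> sgn (y - b)) + M * (2 * norm (y - b) * (h \<bullet> sgn (y - b))) + s * ((y - w) \<bullet> h + h \<bullet> (y - w))) = (\<bullet>) q"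
      unfolding q_def sgn_div_norm inner_add_left inner_scaleR_left inner_scaleR_right inner_commute[of _ "y - b"]
        inner_commute[of _ "y - w"] t_def[symmetric]
      using t by (intro ext) (simp add: field_simps)
    with 2 show ?thesis by (simp add: power2_norm_eq_inner)
  qed
  have "is_regular_subgradient h y (- q)"
  proof (rule regular_subgradient_at_local_min[OF der, of "T - norm (y - b)"])
    fix z assume "norm (z - y) < T - norm (y - b)"
    moreover have "norm (z - b) \<le> norm (z - y) + norm (y - b)"
      using norm_triangle_ineq[of "z - y" "y - b"] by simp
    ultimately have "z \<in> cball b T" by (simp add: dist_norm norm_minus_commute)
    from min[OF this] show "h y + (P y + s * (norm (y - w))\<^sup>2) \<le> h z + (P z + s * (norm (z - w))\<^sup>2)" by simp
  qed (use yin in simp)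
  hence "norm q \<le> c" using sub[of y "- q"] yin by (simp add: dist_norm norm_minus_commute)
  moreover have "norm q \<ge> norm ((c' / t + 2 * M) *\<^sub>R (y - b)) - norm ((2 * s) *\<^sub>R (y - w))"
    unfolding q_def using norm_diff_ineq by blast
  moreover have "norm ((c' / t + 2 * M) *\<^sub>R (y - b)) = c' + 2 * M * t"
    unfolding norm_scaleR t_def[symmetric] using t M c k by (simp add: c'_def field_simps)
  moreover have "norm ((2 * s) *\<^sub>R (y - w)) \<le> k / 2"
  proof -
    have "2 * s * norm (y - w) \<le> 2 * s * (2 * T)" using diam[OF y] s(1) by (intro mult_left_mono) auto
    moreover have "norm ((2 * s) *\<^sub>R (y - w)) = 2 * s * norm (y - w)" using s(1) by simp
    ultimately show ?thesis using s(3) by linarith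
  qed
  moreover have "2 * M * t \<ge> 0" using M t by simp
  ultimately show False using k(1) by (simp add: c'_def)
qed

section \<open>Proximal points of the parametric problem\<close>

text \<open>Stated with two variational inequalities in place of a projection map, so that it
  applies to \<open>u0\<close>, which is a projection by \<open>base\<close>.\<close>

lemma projection_nonexpansive:
  fixes p p' z z' :: "'x::real_inner"
  assumes "(z - p) \<bullet> (p' - p) \<le> 0" and "(z' - p') \<bullet> (p - p') \<le> 0"
  shows "norm (p - p') \<le> norm (z - z')"
proof -
  have "(norm (p - p'))\<^sup>2 \<le> (z - z') \<bullet> (p - p')"
    using assms by (simp add: power2_norm_eq_inner algebra_simps inner_commute)
  also have "\<dots> \<le> norm (z - z') * norm (p - p')" by (rule norm_cauchy_schwarz)
  finally show ?thesis by (cases "p = p'") (simp_all add: power2_eq_square)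
qed

text \<open>What the real-valued estimates use of the smooth part, with one constant and one radius.
  \<open>L \<ge> 1\<close> allows coefficients 1 to be absorbed into \<open>L\<close>;
  \<open>base\<close> says that \<open>u0\<close> is stationary for \<open>us0\<close> and
  \<open>e0\<close>.\<close>

locale parametric_problem =
  fixes f :: "'x::{real_inner,complete_space} \<times> 'e::real_normed_vector \<Rightarrow> real"
    and g :: "'x \<times> 'e \<Rightarrow> 'x" and K :: "'x set" and u0 us0 :: 'x and e0 :: 'e and r L :: real
  assumes r: "r > 0" and L: "L \<ge> 1"
    and K: "closed K" "convex K" "u0 \<in> K"
    and f_taylor: "\<lbrakk>norm (u - u0) \<le> r; norm (u' - u0) \<le> r; norm (e - e0) \<le> r\<rbrakk> \<Longrightarrow>
      \<bar>f (u', e) - f (u, e) - g (u, e) \<bullet> (u' - u)\<bar> \<le> L * (norm (u' - u))\<^sup>2"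
    and f_lip: "\<lbrakk>norm (u - u0) \<le> r; norm (u' - u0) \<le> r; norm (e - e0) \<le> r; norm (e' - e0) \<le> r\<rbrakk> \<Longrightarrow>
      \<bar>f (u, e) - f (u', e')\<bar> \<le> L * (norm (u - u') + norm (e - e'))"
    and g_lip: "\<lbrakk>norm (u - u0) \<le> r; norm (u' - u0) \<le> r; norm (e - e0) \<le> r; norm (e' - e0) \<le> r\<rbrakk> \<Longrightarrow>
      norm (g (u, e) - g (u', e')) \<le> L * (norm (u - u') + norm (e - e'))"
    and base: "k \<in> K \<Longrightarrow> (us0 - g (u0, e0)) \<bullet> (k - u0) \<le> 0"
begin

text \<open>\<open>us\<close> belongs to \<open>g (u, e)\<close> plus the normal cone of
  \<open>K\<close> at \<open>u\<close>, as a variational inequality. Near the base point this is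
  membership in the partial subdifferential.\<close>

definition stationary :: "'e \<Rightarrow> 'x \<Rightarrow> 'x \<Rightarrow> bool" where
  "stationary e u us \<longleftrightarrow> u \<in> K \<and> (\<forall>k\<in>K. (us - g (u, e)) \<bullet> (k - u) \<le> 0)"

text \<open>For a graph point \<open>(u, us)\<close> of \<open>stationary e\<close>, the pair
  \<open>(vs, - v)\<close> is a regular normal to that graph. Near the base point this says that
  \<open>vs\<close> is in the combined second-order subdifferential at \<open>v\<close>.\<close>

definition graph_normal :: "'e \<Rightarrow> 'x \<Rightarrow> 'x \<Rightarrow> 'x \<Rightarrow> 'x \<Rightarrow> bool" where
  "graph_normal e u us vs v \<longleftrightarrow> (\<forall>\<epsilon>>0. \<exists>d>0. \<forall>u' us'.
     stationary e u' us' \<and> norm (u' - u) < d \<and> norm (us' - us) < d \<longrightarrow>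
     vs \<bullet> (u' - u) - v \<bullet> (us' - us) \<le> \<epsilon> * (norm (u' - u) + norm (us' - us)))"

definition coderivative_bound :: "real \<Rightarrow> real \<Rightarrow> bool" where
  "coderivative_bound \<eta> \<delta> \<longleftrightarrow> (\<forall>u e us. stationary e u us \<and>
     norm (u - u0) + norm (e - e0) + norm (us - us0) \<le> \<eta> \<longrightarrow>
     (\<forall>v vs. graph_normal e u us vs v \<longrightarrow> vs \<bullet> v \<ge> \<delta> * (norm v)\<^sup>2))"

text \<open>\<open>x\<close> is a critical point over \<open>K\<close> of
  \<open>f (x, e) - us \<bullet> x + 2 * L * (norm (x - z))\<^sup>2\<close>. It is a relation and
  not a map because existence is shown only near the base point; with \<open>x = z\<close> it
  reduces to stationarity.\<close>

definition prox :: "'e \<Rightarrow> 'x \<Rightarrow> 'x \<Rightarrow> 'x \<Rightarrow> bool" where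
  "prox e us z x \<longleftrightarrow> norm (x - u0) \<le> r \<and> stationary e x (us + (4 * L) *\<^sub>R (z - x))"

text \<open>The normal cone of a convex set is monotone, so only \<open>g\<close> can violate
  monotonicity, and by no more than its Lipschitz constant allows.\<close>

lemma hypomonotone:
  assumes "stationary e u us" "stationary e' u' us'"
    and "norm (u - u0) \<le> r" "norm (u' - u0) \<le> r" "norm (e - e0) \<le> r" "norm (e' - e0) \<le> r"
  shows "(us - us') \<bullet> (u - u') \<ge> - L * (norm (u - u'))\<^sup>2 - L * norm (e - e') * norm (u - u')"
proof -
  have "(us - g (u, e)) \<bullet> (u' - u) \<le> 0" "(us' - g (u', e')) \<bullet> (u - u') \<le> 0"
    using assms(1,2) by (auto simp: stationary_def)
  hence "(us - us') \<bullet> (u - u') \<ge> (g (u, e) - g (u', e')) \<bullet> (u - u')"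
    by (simp add: algebra_simps)
  moreover have "\<bar>(g (u, e) - g (u', e')) \<bullet> (u - u')\<bar> \<le> norm (g (u, e) - g (u', e')) * norm (u - u')"
    by (rule Cauchy_Schwarz_ineq2)
  moreover have "norm (g (u, e) - g (u', e')) * norm (u - u') \<le> L * (norm (u - u') + norm (e - e')) * norm (u - u')"
    using g_lip[OF assms(3-6)] by (intro mult_right_mono) auto
  ultimately show ?thesis by (simp add: power2_eq_square algebra_simps abs_le_iff)
qed

text \<open>The added \<open>4 * L\<close> leaves \<open>3 * L\<close> after hypomonotonicity;
  dividing by it gives the factor 4/3, rounded up to 2. With equal data this is uniqueness of
  proximal points.\<close>

lemma prox_lipschitz:
  assumes "prox e us z x" "prox e' us' z' x'" "norm (e - e0) \<le> r" "norm (e' - e0) \<le> r"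
  shows "norm (x - x') \<le> 2 * (norm (z - z') + norm (e - e') + norm (us - us'))"
proof (cases "x = x'")
  case False
  define n where "n = norm (x - x')"
  have n: "n > 0" using False by (simp add: n_def)
  have "((us + (4 * L) *\<^sub>R (z - x)) - (us' + (4 * L) *\<^sub>R (z' - x'))) \<bullet> (x - x')
      \<ge> - L * n\<^sup>2 - L * norm (e - e') * n"
    unfolding n_def by (rule hypomonotone) (use assms in \<open>auto simp: prox_def\<close>)
  moreover have "((us + (4 * L) *\<^sub>R (z - x)) - (us' + (4 * L) *\<^sub>R (z' - x'))) \<bullet> (x - x')
      = ((us - us') + (4 * L) *\<^sub>R (z - z')) \<bullet> (x - x') - 4 * L * n\<^sup>2"
    unfolding n_def by (simp add: power2_norm_eq_inner algebra_simps)
  moreover have "((us - us') + (4 * L) *\<^sub>R (z - z')) \<bullet> (x - x') \<le> (norm (us - us') + 4 * L * norm (z - z')) * n"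
  proof -
    have "((us - us') + (4 * L) *\<^sub>R (z - z')) \<bullet> (x - x') \<le> norm ((us - us') + (4 * L) *\<^sub>R (z - z')) * n"
      unfolding n_def by (rule norm_cauchy_schwarz)
    also have "norm ((us - us') + (4 * L) *\<^sub>R (z - z')) \<le> norm (us - us') + 4 * L * norm (z - z')"
      using norm_triangle_ineq[of "us - us'" "(4 * L) *\<^sub>R (z - z')"] L by simp
    finally show ?thesis using n by simp
  qed
  ultimately have "3 * L * n\<^sup>2 \<le> (norm (us - us') + 4 * L * norm (z - z') + L * norm (e - e')) * n"
    by (simp add: algebra_simps)
  hence "(3 * L * n) * n \<le> (norm (us - us') + 4 * L * norm (z - z') + L * norm (e - e')) * n"
    by (simp add: power2_eq_square mult_ac)
  hence "3 * L * n \<le> norm (us - us') + 4 * L * norm (z - z') + L * norm (e - e')"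
    using n by simp
  moreover have "norm (us - us') \<le> L * norm (us - us')"
    using mult_right_mono[OF L norm_ge_zero] by simp
  ultimately have "L * (3 * n) \<le> L * (norm (us - us') + 4 * norm (z - z') + norm (e - e'))"
    by (simp add: algebra_simps)
  hence "3 * n \<le> norm (us - us') + 4 * norm (z - z') + norm (e - e')" using L by simp
  thus ?thesis unfolding n_def by (smt (verit) norm_ge_zero)
qed simp

lemma prox_base: "prox e0 us0 u0 u0"
  unfolding prox_def stationary_def
proof (intro conjI ballI)
  show "norm (u0 - u0) \<le> r" using r by simp
  fix k assume "k \<in> K"
  from base[OF this] show "(us0 + (4 * L) *\<^sub>R (u0 - u0) - g (u0, e0)) \<bullet> (k - u0) \<le> 0"
    by simp
qed (rule K)

text \<open>A proximal point is a fixed point of the map that projects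
  \<open>z - (g (x, e) - us) / (4 * L)\<close> on \<open>K\<close>. The division by
  \<open>4 * L\<close> makes it a contraction with factor 1/4.\<close>

lemma prox_exists:
  assumes z: "norm (z - u0) \<le> r / 4" and e: "norm (e - e0) \<le> r / 4" and us: "norm (us - us0) \<le> r / 4"
  shows "\<exists>x. prox e us z x"
proof -
  have "\<forall>z. \<exists>p. p \<in> K \<and> (\<forall>k\<in>K. (z - p) \<bullet> (k - p) \<le> 0)"
  proof
    fix z
    have "K \<noteq> {}" using K(3) by blast
    from closed_convex_projection[OF K(1,2) this, where z = z]
    obtain p where "p \<in> K" "\<And>k. k \<in> K \<Longrightarrow> (z - p) \<bullet> (k - p) \<le> 0" by blast
    thus "\<exists>p. p \<in> K \<and> (\<forall>k\<in>K. (z - p) \<bullet> (k - p) \<le> 0)" by blast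
  qed
  from choice[OF this] obtain P
    where P: "\<And>z. P z \<in> K" "\<And>z k. k \<in> K \<Longrightarrow> (z - P z) \<bullet> (k - P z) \<le> 0"
    by blast
  have norm_inv: "norm (d /\<^sub>R (4 * L)) = norm d / (4 * L)" for d :: 'x
    using L by (simp add: field_simps)
  have norm_div: "norm (a - d /\<^sub>R (4 * L)) \<le> norm a + norm d / (4 * L)" for a d :: 'x
    using norm_triangle_ineq4[of a "d /\<^sub>R (4 * L)"] unfolding norm_inv .
  define \<Phi> where "\<Phi> x = P (z - (g (x, e) - us) /\<^sub>R (4 * L))" for x
  have er: "norm (e - e0) \<le> r" using e r by linarith
  have "\<exists>!x\<in>cball u0 r. \<Phi> x = x"
  proof (rule Banach_fix[where c = "1/4"])
    show "\<Phi> ` cball u0 r \<subseteq> cball u0 r"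
    proof
      fix y assume "y \<in> \<Phi> ` cball u0 r"
      then obtain x where "x \<in> cball u0 r" "y = \<Phi> x" by blast
      hence x: "norm (x - u0) \<le> r" "y = \<Phi> x" by (auto simp: dist_norm norm_minus_commute)
      \<comment> \<open>\<open>u0\<close> is the projection of \<open>?b\<close> by
        \<open>base\<close>, so the distance from \<open>u0\<close> is controlled by
        \<open>?a - ?b\<close>.\<close>
      let ?a = "z - (g (x, e) - us) /\<^sub>R (4 * L)" and ?b = "u0 - (g (u0, e0) - us0) /\<^sub>R (4 * L)"
      have "norm (P ?a - u0) \<le> norm (?a - ?b)"
      proof (rule projection_nonexpansive)
        have "?b - u0 = (us0 - g (u0, e0)) /\<^sub>R (4 * L)" by (simp add: scaleR_right_diff_distrib)
        hence "(?b - u0) \<bullet> (P ?a - u0) = inverse (4 * L) * ((us0 - g (u0, e0)) \<bullet> (P ?a - u0))"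
          by (simp only: inner_scaleR_left)
        also have "\<dots> \<le> 0" using base[OF P(1)[of ?a]] L by (intro mult_nonneg_nonpos) auto
        finally show "(?b - u0) \<bullet> (P ?a - u0) \<le> 0" .
      qed (use P K in auto)
      also have "?a - ?b = (z - u0) - ((g (x, e) - g (u0, e0)) - (us - us0)) /\<^sub>R (4 * L)"
        by (simp add: scaleR_right_diff_distrib)
      also have "norm \<dots> \<le> norm (z - u0) + norm ((g (x, e) - g (u0, e0)) - (us - us0)) / (4 * L)"
        by (rule norm_div)
      \<comment> \<open>The right-hand side equals \<open>5 * r / 8\<close>, which is why data
        within \<open>r / 4\<close> suffice.\<close>
      also have "\<dots> \<le> r / 4 + (L * (r + r / 4) + L * (r / 4)) / (4 * L)"
      proof -
        have "norm (g (x, e) - g (u0, e0)) \<le> L * (norm (x - u0) + norm (e - e0))"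
          by (rule g_lip) (use x er r in auto)
        also have "\<dots> \<le> L * (r + r / 4)" using x e L by (intro mult_left_mono) auto
        finally have "norm (g (x, e) - g (u0, e0)) \<le> L * (r + r / 4)" .
        moreover have "norm (us - us0) \<le> L * (r / 4)"
          using us mult_right_mono[OF L, of "r / 4"] r by linarith
        ultimately have "norm ((g (x, e) - g (u0, e0)) - (us - us0)) \<le> L * (r + r / 4) + L * (r / 4)"
          using norm_triangle_ineq4[of "g (x, e) - g (u0, e0)" "us - us0"] by linarith
        thus ?thesis using z L by (intro add_mono divide_right_mono) linarith+
      qed
      also have "\<dots> \<le> r" using L r by (simp add: field_simps)
      finally show "y \<in> cball u0 r" using x by (simp add: \<Phi>_def dist_norm norm_minus_commute)
    qed
    fix x y assume xy: "x \<in> cball u0 r" "y \<in> cball u0 r"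
    let ?a = "\<lambda>x. z - (g (x, e) - us) /\<^sub>R (4 * L)"
    have "norm (\<Phi> x - \<Phi> y) \<le> norm (?a x - ?a y)"
      unfolding \<Phi>_def by (rule projection_nonexpansive) (use P in auto)
    also have "?a x - ?a y = (g (y, e) - g (x, e)) /\<^sub>R (4 * L)" by (simp add: scaleR_right_diff_distrib)
    also have "norm \<dots> = norm (g (y, e) - g (x, e)) / (4 * L)" by (rule norm_inv)
    also have "\<dots> \<le> (L * (norm (y - x) + norm (e - e))) / (4 * L)"
      using xy er L by (intro divide_right_mono g_lip) (auto simp: dist_norm norm_minus_commute)
    also have "\<dots> = 1/4 * norm (x - y)" using L by (simp add: norm_minus_commute)
    finally show "dist (\<Phi> x) (\<Phi> y) \<le> 1/4 * dist x y" by (simp add: dist_norm)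
  qed (use r in \<open>auto simp: complete_eq_closed\<close>)
  then obtain x where "x \<in> cball u0 r" "\<Phi> x = x" by blast
  hence x: "norm (x - u0) \<le> r" "\<Phi> x = x" by (auto simp: dist_norm norm_minus_commute)
  have "(us + (4 * L) *\<^sub>R (z - x) - g (x, e)) \<bullet> (k - x) \<le> 0" if k: "k \<in> K" for k
  proof -
    let ?a = "z - (g (x, e) - us) /\<^sub>R (4 * L)"
    have "(?a - x) \<bullet> (k - x) \<le> 0" using P(2)[OF k, of ?a] x(2) by (simp add: \<Phi>_def)
    hence "(4 * L) * ((?a - x) \<bullet> (k - x)) \<le> 0" using L by (intro mult_nonneg_nonpos) auto
    moreover have "us + (4 * L) *\<^sub>R (z - x) - g (x, e) = (4 * L) *\<^sub>R (?a - x)"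
      using L by (simp add: scaleR_right_diff_distrib scaleR_right_distrib)
    ultimately show ?thesis by simp
  qed
  moreover have "x \<in> K" using x(2) P(1) by (metis \<Phi>_def)
  ultimately show ?thesis using x(1) unfolding prox_def stationary_def by blast
qed

text \<open>The proximal inequality tested at \<open>z\<close> gains \<open>4 * L\<close> times the
  square, of which the Taylor error takes \<open>L\<close>.\<close>

lemma prox_descent:
  assumes "prox e us z x" "z \<in> K" "norm (z - u0) \<le> r" "norm (e - e0) \<le> r"
  shows "f (x, e) - us \<bullet> x + 3 * L * (norm (z - x))\<^sup>2 \<le> f (z, e) - us \<bullet> z"
proof -
  have "(us + (4 * L) *\<^sub>R (z - x) - g (x, e)) \<bullet> (z - x) \<le> 0"
    using assms by (simp add: prox_def stationary_def)
  hence "us \<bullet> (z - x) + 4 * L * (norm (z - x))\<^sup>2 \<le> g (x, e) \<bullet> (z - x)"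
    by (simp add: power2_norm_eq_inner inner_diff_left inner_add_left)
  moreover have "\<bar>f (z, e) - f (x, e) - g (x, e) \<bullet> (z - x)\<bar> \<le> L * (norm (z - x))\<^sup>2"
    using assms by (intro f_taylor) (auto simp: prox_def)
  ultimately show ?thesis by (simp add: inner_diff_right abs_le_iff)
qed

text \<open>Since \<open>x\<close> is strictly inside the ball, short steps towards any
  \<open>k\<close> in \<open>K\<close> are admissible. The Taylor error along them is quadratic and
  vanishes after division by the step.\<close>

lemma stationary_of_minimizer:
  assumes x: "x \<in> K" "norm (x - u0) < \<rho>" "\<rho> \<le> r" and e: "norm (e - e0) \<le> r"
    and min: "\<And>k. k \<in> K \<Longrightarrow> norm (k - u0) \<le> \<rho> \<Longrightarrow> f (x, e) - us \<bullet> x \<le> f (k, e) - us \<bullet> k"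
  shows "stationary e x us"
  unfolding stationary_def
proof (intro conjI ballI)
  fix k assume k: "k \<in> K"
  define N where "N = norm (k - x)"
  have small: "(us - g (x, e)) \<bullet> (k - x) \<le> t * (L * N\<^sup>2)"
    if t: "0 < t" "t \<le> 1" "t * N \<le> \<rho> - norm (x - u0)" for t
  proof -
    define y where "y = x + t *\<^sub>R (k - x)"
    have yx: "y - x = t *\<^sub>R (k - x)" by (simp add: y_def)
    have "y = (1 - t) *\<^sub>R x + t *\<^sub>R k" by (simp add: y_def algebra_simps)
    hence yK: "y \<in> K" using convexD[OF K(2) x(1) k, of "1 - t" t] t by simp
    have "norm (y - u0) \<le> norm (x - u0) + norm (y - x)"
      using norm_triangle_ineq[of "x - u0" "y - x"] by simp
    also have "\<dots> \<le> \<rho>" using t by (simp add: yx N_def)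
    finally have y\<rho>: "norm (y - u0) \<le> \<rho>" .
    have "\<bar>f (y, e) - f (x, e) - g (x, e) \<bullet> (y - x)\<bar> \<le> L * (norm (y - x))\<^sup>2"
      using x e y\<rho> by (intro f_taylor) auto
    hence "(us - g (x, e)) \<bullet> (y - x) \<le> L * (norm (y - x))\<^sup>2"
      using min[OF yK y\<rho>] by (simp add: inner_diff_left inner_diff_right abs_le_iff)
    hence "t * ((us - g (x, e)) \<bullet> (k - x)) \<le> t * (t * (L * N\<^sup>2))"
      using t by (simp add: yx N_def power_mult_distrib power2_eq_square mult_ac)
    thus ?thesis using t by simp
  qed
  show "(us - g (x, e)) \<bullet> (k - x) \<le> 0"
  proof (rule tendsto_lowerbound)
    show "((\<lambda>t. t * (L * N\<^sup>2)) \<longlongrightarrow> 0) (at_right 0)" by (auto intro!: tendsto_eq_intros)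
    define b where "b = min 1 ((\<rho> - norm (x - u0)) / (N + 1))"
    have N: "N \<ge> 0" by (simp add: N_def)
    have "b > 0" using x N by (simp add: b_def)
    hence "\<forall>\<^sub>F t in at_right 0. 0 < t \<and> t < b"
      by (auto simp: eventually_at_right_less intro!: eventually_conj eventually_at_rightI[of 0 b])
    thus "\<forall>\<^sub>F t in at_right 0. (us - g (x, e)) \<bullet> (k - x) \<le> t * (L * N\<^sup>2)"
    proof eventually_elim
      case (elim t)
      have "t * N \<le> t * (N + 1)" using elim by simp
      also have "\<dots> \<le> (\<rho> - norm (x - u0)) / (N + 1) * (N + 1)"
        using elim N by (intro mult_right_mono) (auto simp: b_def)
      also have "\<dots> = \<rho> - norm (x - u0)" using N by simp
      finally show ?case using elim by (intro small) (auto simp: b_def)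
    qed
  qed simp
qed (rule x)

text \<open>Near \<open>y\<close> the graph of \<open>stationary e\<close> is parametrized by
  \<open>T\<close> through \<open>z = u' + (us' - us) / (4 * L)\<close>. In these coordinates the
  subgradient inequality for \<open>q \<bullet> T z\<close> says that \<open>p - q\<close> and
  \<open>v\<close> form a coderivative pair, and \<open>coderivative_bound\<close> for it becomes
  \<open>(1 + \<delta> / (4 * L)) * (norm p)\<^sup>2 \<le> q \<bullet> p\<close>.\<close>

lemma prox_subgradient_bound:
  assumes cod: "coderivative_bound \<eta> \<delta>" and \<delta>: "\<delta> > 0"
    and e: "norm (e - e0) \<le> r" and R: "R > 0"
    and T: "\<And>z. norm (z - y) < R \<Longrightarrow> prox e us z (T z)"
    and int: "norm (T y - u0) < r"
    and near: "norm (T y - u0) + norm (e - e0) + norm (us + (4 * L) *\<^sub>R (y - T y) - us0) \<le> \<eta>"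
    and sub: "is_regular_subgradient (\<lambda>z. q \<bullet> T z) y p"
  shows "norm p \<le> norm q / (1 + \<delta> / (4 * L))"
proof -
  define x where "x = T y"
  define xs where "xs = us + (4 * L) *\<^sub>R (y - x)"
  define v where "v = (- (1 / (4 * L))) *\<^sub>R p"
  have st: "stationary e x xs" using T[of y] R by (simp add: prox_def x_def xs_def)
  have "graph_normal e x xs (p - q) v"
    unfolding graph_normal_def
  proof (intro allI impI)
    fix \<epsilon> :: real assume \<epsilon>: "\<epsilon> > 0"
    with sub obtain d where d: "d > 0" and
      dsub: "\<And>z. norm (z - y) < d \<Longrightarrow> q \<bullet> T z - q \<bullet> T y - p \<bullet> (z - y) \<ge> - \<epsilon> * norm (z - y)"
      unfolding is_regular_subgradient_def by blast
    \<comment> \<open>The distance of \<open>z\<close> to \<open>y\<close> is at most the sum of two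
      distances below \<open>d'\<close>, hence the half; the other bound keeps \<open>u'\<close> in
      the ball that \<open>prox\<close> requires.\<close>
    define d' where "d' = min (min d R / 2) (r - norm (x - u0))"
    have d': "d' > 0" using d R int by (simp add: d'_def x_def)
    show "\<exists>d>0. \<forall>u' us'. stationary e u' us' \<and> norm (u' - x) < d \<and> norm (us' - xs) < d \<longrightarrow>
       (p - q) \<bullet> (u' - x) - v \<bullet> (us' - xs) \<le> \<epsilon> * (norm (u' - x) + norm (us' - xs))"
    proof (intro exI[of _ d'] conjI allI impI d')
      fix u' us' assume A: "stationary e u' us' \<and> norm (u' - x) < d' \<and> norm (us' - xs) < d'"
      define z where "z = u' + (1 / (4 * L)) *\<^sub>R (us' - us)"
      have zy: "z - y = (u' - x) + (1 / (4 * L)) *\<^sub>R (us' - xs)"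
        using L by (simp add: z_def xs_def algebra_simps)
      have "norm (z - y) \<le> norm (u' - x) + (1 / (4 * L)) * norm (us' - xs)"
        unfolding zy using norm_triangle_ineq[of "u' - x" "(1 / (4 * L)) *\<^sub>R (us' - xs)"] L by simp
      also have "\<dots> \<le> norm (u' - x) + 1 * norm (us' - xs)"
        using L by (intro add_left_mono mult_right_mono) auto
      finally have nz: "norm (z - y) \<le> norm (u' - x) + norm (us' - xs)" by simp
      hence "norm (z - y) < d" "norm (z - y) < R" using A by (auto simp: d'_def)
      have "norm (u' - u0) \<le> norm (u' - x) + norm (x - u0)"
        using norm_triangle_ineq[of "u' - x" "x - u0"] by simp
      hence "norm (u' - u0) \<le> r" using A by (auto simp: d'_def)
      moreover have "us + (4 * L) *\<^sub>R (z - u') = us'" using L by (simp add: z_def)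
      ultimately have "prox e us z u'" using A by (simp add: prox_def)
      hence "T z = u'"
        using prox_lipschitz[OF T[OF \<open>norm (z - y) < R\<close>] _ e e, of us z u'] by simp
      with dsub[OF \<open>norm (z - y) < d\<close>] have "q \<bullet> (u' - x) - p \<bullet> (z - y) \<ge> - \<epsilon> * norm (z - y)"
        by (simp add: x_def inner_diff_right)
      moreover have "(p - q) \<bullet> (u' - x) - v \<bullet> (us' - xs) = p \<bullet> (z - y) - q \<bullet> (u' - x)"
        unfolding zy v_def by (simp add: inner_diff_left inner_add_right)
      moreover have "\<epsilon> * norm (z - y) \<le> \<epsilon> * (norm (u' - x) + norm (us' - xs))"
        using nz \<epsilon> by simp
      ultimately show "(p - q) \<bullet> (u' - x) - v \<bullet> (us' - xs) \<le> \<epsilon> * (norm (u' - x) + norm (us' - xs))"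
        by simp
    qed
  qed
  hence "(p - q) \<bullet> v \<ge> \<delta> * (norm v)\<^sup>2"
    using cod near st unfolding coderivative_bound_def x_def xs_def by blast
  moreover have "(norm v)\<^sup>2 = (norm p)\<^sup>2 / (4 * L)\<^sup>2"
    using L by (simp add: v_def power_divide)
  moreover have "(p - q) \<bullet> v = (q \<bullet> p - (norm p)\<^sup>2) / (4 * L)"
    using L by (simp add: v_def power2_norm_eq_inner inner_diff_left field_simps)
  ultimately have "\<delta> * ((norm p)\<^sup>2 / (4 * L)\<^sup>2) \<le> (q \<bullet> p - (norm p)\<^sup>2) / (4 * L)" by simp
  hence "(1 + \<delta> / (4 * L)) * (norm p)\<^sup>2 \<le> q \<bullet> p"
    using L by (simp add: field_simps power2_eq_square)
  also have "\<dots> \<le> norm q * norm p" by (rule norm_cauchy_schwarz)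
  finally have "(1 + \<delta> / (4 * L)) * norm p * norm p \<le> norm q * norm p"
    by (simp add: power2_eq_square mult_ac)
  hence "(1 + \<delta> / (4 * L)) * norm p \<le> norm q" by (cases "p = 0") auto
  moreover have "1 + \<delta> / (4 * L) > 0" using \<delta> L by (simp add: add_pos_pos)
  ultimately show ?thesis by (simp add: pos_le_divide_eq mult.commute)
qed

text \<open>The subgradient bound brings the Lipschitz constant below 1 to first order. The mean
  value inequality, applied to \<open>q \<bullet> T z\<close> with Lipschitz constant
  \<open>2 * norm q\<close>, adds a second-order error, so \<rho> has to be small against the radius
  \<open>R\<close> of its balls.\<close>

lemma prox_contraction:
  assumes cod: "coderivative_bound \<eta> \<delta>" and \<delta>: "\<delta> > 0" and \<eta>: "0 < \<eta>" "\<eta> \<le> r"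
  obtains \<rho> c where "0 < \<rho>" "\<rho> \<le> r / 4" "0 \<le> c" "c < 1"
    "\<And>e us a b x y. norm (e - e0) \<le> \<rho> \<Longrightarrow> norm (us - us0) \<le> \<rho> \<Longrightarrow> norm (a - u0) \<le> \<rho> \<Longrightarrow> norm (b - u0) \<le> \<rho>
       \<Longrightarrow> prox e us a x \<Longrightarrow> prox e us b y \<Longrightarrow> norm (x - y) \<le> c * norm (a - b)"
proof -
  \<comment> \<open>All graph points met below are within
    \<open>8 * R + R + (R + 40 * L * R)\<close> of the base point, and this is at most
    \<open>50 * L * R = \<eta>\<close>.\<close>
  define R where "R = \<eta> / (50 * L)"
  define \<beta> where "\<beta> = 1 + \<delta> / (4 * L)"
  \<comment> \<open>Halfway between the first-order factor \<open>1 / \<beta>\<close> and 1; the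
    other half of the margin, \<open>(1 - 1 / \<beta>) / 2\<close>, bounds the second-order error by
    the choice of \<rho>.\<close>
  define c where "c = (1 + 1 / \<beta>) / 2"
  define \<rho> where "\<rho> = min (R / 4) (R * (1 - 1 / \<beta>) / 8)"
  have \<beta>: "\<beta> > 1" using \<delta> L by (simp add: \<beta>_def)
  have i\<beta>: "0 < 1 / \<beta>" "1 / \<beta> < 1" using \<beta> by auto
  have R: "R > 0" using \<eta> L by (simp add: R_def)
  have RL: "50 * L * R = \<eta>" using L by (simp add: R_def)
  have LR: "R \<le> L * R" using mult_right_mono[OF L, of R] R by simp
  have \<rho>: "\<rho> > 0" using R i\<beta> by (simp add: \<rho>_def)
  have \<rho>R: "\<rho> \<le> R / 4" by (simp add: \<rho>_def)
  have R8: "16 * R < r" using RL LR \<eta> R by linarith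
  have main: "norm (x - y) \<le> c * norm (a - b)"
    if e: "norm (e - e0) \<le> \<rho>" and us: "norm (us - us0) \<le> \<rho>" and a: "norm (a - u0) \<le> \<rho>" and b: "norm (b - u0) \<le> \<rho>"
      and x: "prox e us a x" and y: "prox e us b y" for e us a b x y
  proof (cases "x = y")
    case False
    have eR: "norm (e - e0) \<le> R" and usR: "norm (us - us0) \<le> R" using e us \<rho>R R by linarith+
    have er: "norm (e - e0) \<le> r" using eR R8 R by linarith
    define T where "T z = (SOME x. prox e us z x)" for z
    have T: "prox e us z (T z)" if "norm (z - u0) \<le> 2 * R" for z
      unfolding T_def by (rule someI_ex, rule prox_exists) (use that eR usR R8 R in linarith)+
    have ab: "norm (a - b) \<le> 2 * \<rho>"
      using norm_triangle_ineq4[of "a - u0" "b - u0"] a b by simp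
    have "norm (a - u0) \<le> 2 * R" "norm (b - u0) \<le> 2 * R" using a b \<rho>R R by linarith+
    hence x': "T a = x" and y': "T b = y"
      using prox_lipschitz[OF T[of a] x er er] prox_lipschitz[OF T[of b] y er er] by simp_all
    have dom: "norm (z - u0) \<le> 2 * R" if "z \<in> cball b R" for z
    proof -
      have "norm (z - u0) \<le> norm (z - b) + norm (b - u0)"
        using norm_triangle_ineq[of "z - b" "b - u0"] by simp
      thus ?thesis using that b \<rho>R R by (simp add: dist_norm norm_minus_commute)
    qed
    \<comment> \<open>Tests the displacement against itself: \<open>q \<bullet> (T b - T a)\<close>
      is the square of its norm.\<close>
    define q where "q = y - x"
    have qn: "norm q > 0" using False by (simp add: q_def)
    have "q \<bullet> T b - q \<bullet> T a \<le> (norm q / \<beta>) * norm (a - b) + (2 * norm q) / R * (norm (a - b))\<^sup>2"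
    proof (rule regular_subgradient_mean_value[where h = "\<lambda>z. q \<bullet> T z"])
      fix s t assume "s \<in> cball b R" "t \<in> cball b R"
      hence "norm (T s - T t) \<le> 2 * norm (s - t)"
        using prox_lipschitz[OF T[OF dom] T[OF dom] er er, of s t] by simp
      hence "norm q * norm (T s - T t) \<le> norm q * (2 * norm (s - t))" by (intro mult_left_mono) auto
      moreover have "\<bar>q \<bullet> (T s - T t)\<bar> \<le> norm q * norm (T s - T t)" by (rule Cauchy_Schwarz_ineq2)
      ultimately show "\<bar>q \<bullet> T s - q \<bullet> T t\<bar> \<le> 2 * norm q * norm (s - t)" by (simp add: inner_diff_right)
    next
      fix z p assume z: "z \<in> ball b R" and p: "is_regular_subgradient (\<lambda>z. q \<bullet> T z) z p"
      have zR: "norm (z - u0) \<le> 2 * R" using dom[of z] z by simp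
      have "norm (T z - u0) \<le> 2 * (norm (z - u0) + norm (e - e0) + norm (us - us0))"
        by (rule prox_lipschitz[OF T[OF zR] prox_base er]) (use r in simp)
      also have "\<dots> \<le> 2 * (2 * R + R + R)"
        by (intro mult_left_mono add_mono zR eR usR) simp
      finally have Tz: "norm (T z - u0) \<le> 8 * R" by simp
      have "us + (4 * L) *\<^sub>R (z - T z) - us0 = (us - us0) + (4 * L) *\<^sub>R ((z - u0) - (T z - u0))"
        by (simp add: algebra_simps)
      also have "norm \<dots> \<le> norm (us - us0) + 4 * L * norm ((z - u0) - (T z - u0))"
        using norm_triangle_ineq[of "us - us0" "(4 * L) *\<^sub>R ((z - u0) - (T z - u0))"] L by simp
      also have "\<dots> \<le> R + 4 * L * (2 * R + 8 * R)"
        using norm_triangle_ineq4[of "z - u0" "T z - u0"] zR Tz usR L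
        by (intro add_mono mult_left_mono) linarith+
      finally have "norm (us + (4 * L) *\<^sub>R (z - T z) - us0) \<le> R + 40 * L * R" by simp
      hence near: "norm (T z - u0) + norm (e - e0) + norm (us + (4 * L) *\<^sub>R (z - T z) - us0) \<le> \<eta>"
        using Tz eR LR RL by linarith
      show "norm p \<le> norm q / \<beta>"
        unfolding \<beta>_def
      proof (rule prox_subgradient_bound[OF cod \<delta> er _ _ _ near p])
        show "R - dist b z > 0" using z by simp
        fix w assume "norm (w - z) < R - dist b z"
        hence "w \<in> cball b R" using dist_triangle[of b w z] by (simp add: dist_norm norm_minus_commute)
        thus "prox e us w (T w)" by (intro T dom)
      qed (use Tz R8 R in linarith)
    next
      show "a \<in> cball b R" using ab \<rho>R R by (simp add: dist_norm norm_minus_commute)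
    qed (use R qn \<beta> in auto)
    moreover have "q \<bullet> T b - q \<bullet> T a = norm q * norm q"
      unfolding x' y' by (simp add: q_def inner_diff_right power2_norm_eq_inner flip: power2_eq_square)
    ultimately have "norm q * norm q \<le> norm q * (norm (a - b) / \<beta> + 2 / R * (norm (a - b))\<^sup>2)"
      by (simp add: algebra_simps)
    hence "norm q \<le> norm (a - b) / \<beta> + 2 / R * (norm (a - b))\<^sup>2" using qn by simp
    also have "\<dots> = (1 / \<beta> + 2 / R * norm (a - b)) * norm (a - b)"
      by (simp add: power2_eq_square algebra_simps)
    also have "\<dots> \<le> c * norm (a - b)"
    proof (rule mult_right_mono)
      have "2 / R * norm (a - b) \<le> 2 / R * (2 * (R * (1 - 1 / \<beta>) / 8))"
      proof (rule mult_left_mono)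
        have "\<rho> \<le> R * (1 - 1 / \<beta>) / 8" unfolding \<rho>_def by (rule min.cobounded2)
        thus "norm (a - b) \<le> 2 * (R * (1 - 1 / \<beta>) / 8)" using ab by linarith
      qed (use R in simp)
      also have "\<dots> = (1 - 1 / \<beta>) / 2" using R by simp
      finally show "1 / \<beta> + 2 / R * norm (a - b) \<le> c" by (simp add: c_def field_simps)
    qed simp
    finally show ?thesis by (simp add: q_def norm_minus_commute)
  qed (use i\<beta> in \<open>simp add: c_def\<close>)
  show thesis
    by (rule that[OF \<rho> _ _ _ main]) (use \<rho>R R8 R i\<beta> in \<open>auto simp: c_def\<close>)
qed

lemma strict_minimizer_selection:
  assumes cod: "coderivative_bound \<eta> \<delta>" and \<delta>: "\<delta> > 0" and \<eta>: "0 < \<eta>" "\<eta> \<le> r"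
  obtains \<rho> \<tau> \<kappa> \<theta> where "0 < \<rho>" "\<rho> \<le> r" "0 < \<tau>" "\<tau> \<le> r" "0 \<le> \<kappa>" "\<theta> (us0, e0) = u0"
    "\<And>us e. norm (us - us0) \<le> \<tau> \<Longrightarrow> norm (e - e0) \<le> \<tau> \<Longrightarrow>
       \<theta> (us, e) \<in> K \<and> norm (\<theta> (us, e) - u0) \<le> \<rho> \<and>
       (\<forall>k\<in>K. norm (k - u0) \<le> \<rho> \<longrightarrow> k \<noteq> \<theta> (us, e) \<longrightarrow>
          f (\<theta> (us, e), e) - us \<bullet> \<theta> (us, e) < f (k, e) - us \<bullet> k)"
    "\<And>us e us' e'. norm (us - us0) \<le> \<tau> \<Longrightarrow> norm (e - e0) \<le> \<tau> \<Longrightarrow>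
       norm (us' - us0) \<le> \<tau> \<Longrightarrow> norm (e' - e0) \<le> \<tau> \<Longrightarrow>
       norm (\<theta> (us, e) - \<theta> (us', e')) \<le> \<kappa> * (norm (us - us') + norm (e - e'))"
proof -
  obtain \<rho> c where \<rho>: "0 < \<rho>" "\<rho> \<le> r / 4" and c: "0 \<le> c" "c < 1" and
    contr: "\<And>e us a b x y. norm (e - e0) \<le> \<rho> \<Longrightarrow> norm (us - us0) \<le> \<rho> \<Longrightarrow> norm (a - u0) \<le> \<rho> \<Longrightarrow> norm (b - u0) \<le> \<rho>
       \<Longrightarrow> prox e us a x \<Longrightarrow> prox e us b y \<Longrightarrow> norm (x - y) \<le> c * norm (a - b)"
    using prox_contraction[OF cod \<delta> \<eta>] by metis
  \<comment> \<open>\<open>T\<close> moves \<open>u0\<close> by at most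
    \<open>4 * \<tau> = (1 - c) * \<rho>\<close>, just what a contraction with factor
    \<open>c\<close> may do and still map the \<rho>-ball into itself.\<close>
  define \<tau> where "\<tau> = (1 - c) * \<rho> / 4"
  have \<tau>: "\<tau> > 0" using \<rho> c by (simp add: \<tau>_def)
  have \<tau>\<rho>: "\<tau> \<le> \<rho>"
  proof -
    have "(1 - c) * \<rho> \<le> 1 * \<rho>" using c \<rho> by (intro mult_right_mono) auto
    thus ?thesis using \<rho> by (simp add: \<tau>_def)
  qed
  define T where "T us e z = (SOME x. prox e us z x)" for us e z
  have T: "prox e us z (T us e z)"
    if "norm (us - us0) \<le> \<tau>" "norm (e - e0) \<le> \<tau>" "norm (z - u0) \<le> \<rho>" for us e z
    unfolding T_def by (rule someI_ex, rule prox_exists) (use that \<tau>\<rho> \<rho> in linarith)+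
  have fix_ex: "\<exists>x. norm (x - u0) \<le> \<rho> \<and> T us e x = x" and T_self: "norm (z - u0) \<le> \<rho> \<Longrightarrow> norm (T us e z - u0) \<le> \<rho>"
    if us: "norm (us - us0) \<le> \<tau>" and e: "norm (e - e0) \<le> \<tau>" for us e z
  proof -
    have er: "norm (e - e0) \<le> r" using e \<tau>\<rho> \<rho> by linarith
    have le: "norm (T us e x - T us e y) \<le> c * norm (x - y)"
      if "norm (x - u0) \<le> \<rho>" "norm (y - u0) \<le> \<rho>" for x y
      by (rule contr[OF _ _ that T[OF us e that(1)] T[OF us e that(2)]]) (use us e \<tau>\<rho> in linarith)+
    have u0: "norm (T us e u0 - u0) \<le> 2 * (norm (u0 - u0) + norm (e - e0) + norm (us - us0))"
      by (rule prox_lipschitz[OF T[OF us e] prox_base er]) (use \<rho> r in simp_all)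
    have self: "norm (T us e z - u0) \<le> \<rho>" if z: "norm (z - u0) \<le> \<rho>" for z
    proof -
      have "norm (T us e z - u0) \<le> norm (T us e z - T us e u0) + norm (T us e u0 - u0)"
        using norm_triangle_ineq[of "T us e z - T us e u0" "T us e u0 - u0"] by simp
      also have "norm (T us e z - T us e u0) \<le> c * \<rho>"
        using le[of z u0] z \<rho> mult_left_mono[OF z c(1)] by simp
      also have "norm (T us e u0 - u0) \<le> (1 - c) * \<rho>" using u0 us e by (simp add: \<tau>_def)
      finally show ?thesis by (simp add: algebra_simps)
    qed
    show "norm (z - u0) \<le> \<rho> \<Longrightarrow> norm (T us e z - u0) \<le> \<rho>" by (rule self)
    have "\<exists>!x\<in>cball u0 \<rho>. T us e x = x"
    proof (rule Banach_fix[OF _ _ c])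
      show "T us e ` cball u0 \<rho> \<subseteq> cball u0 \<rho>"
        using self by (auto simp: dist_norm norm_minus_commute)
      show "dist (T us e x) (T us e y) \<le> c * dist x y" if "x \<in> cball u0 \<rho>" "y \<in> cball u0 \<rho>" for x y
        using le[of x y] that by (simp add: dist_norm norm_minus_commute)
    qed (use \<rho> in \<open>auto simp: complete_eq_closed\<close>)
    thus "\<exists>x. norm (x - u0) \<le> \<rho> \<and> T us e x = x"
      by (auto simp: dist_norm norm_minus_commute)
  qed
  define \<theta> where "\<theta> = (\<lambda>(us, e). SOME x. norm (x - u0) \<le> \<rho> \<and> T us e x = x)"
  have \<theta>: "norm (\<theta> (us, e) - u0) \<le> \<rho>" "T us e (\<theta> (us, e)) = \<theta> (us, e)"
    if "norm (us - us0) \<le> \<tau>" "norm (e - e0) \<le> \<tau>" for us e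
    using someI_ex[OF fix_ex[OF that]] by (simp_all add: \<theta>_def)
  have p\<theta>: "prox e us (\<theta> (us, e)) (\<theta> (us, e))"
    if "norm (us - us0) \<le> \<tau>" "norm (e - e0) \<le> \<tau>" for us e
    using T[OF that \<theta>(1)[OF that]] \<theta>(2)[OF that] by simp
  have uniq: "z = \<theta> (us, e)"
    if us: "norm (us - us0) \<le> \<tau>" and e: "norm (e - e0) \<le> \<tau>" and z: "norm (z - u0) \<le> \<rho>" "prox e us z z" for us e z
  proof (rule ccontr)
    assume "z \<noteq> \<theta> (us, e)"
    moreover have "norm (z - \<theta> (us, e)) \<le> c * norm (z - \<theta> (us, e))"
      by (rule contr[OF _ _ z(1) \<theta>(1)[OF us e] z(2) p\<theta>[OF us e]]) (use us e \<tau>\<rho> in linarith)+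
    ultimately show False using c by simp
  qed
  \<comment> \<open>The stability estimate for fixed points of contractions: the map for
    \<open>(us, e)\<close> moves the fixed point for \<open>(us', e')\<close> by at most twice the
    change of the data.\<close>
  have lip: "norm (\<theta> (us, e) - \<theta> (us', e')) \<le> 2 / (1 - c) * (norm (us - us') + norm (e - e'))"
    if us: "norm (us - us0) \<le> \<tau>" and e: "norm (e - e0) \<le> \<tau>"
      and us': "norm (us' - us0) \<le> \<tau>" and e': "norm (e' - e0) \<le> \<tau>" for us e us' e'
  proof -
    let ?a = "\<theta> (us, e)" and ?b = "\<theta> (us', e')"
    have "norm (?a - T us e ?b) \<le> c * norm (?a - ?b)"
      by (rule contr[OF _ _ \<theta>(1)[OF us e] \<theta>(1)[OF us' e'] p\<theta>[OF us e] T[OF us e \<theta>(1)[OF us' e']]])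
        (use us e \<tau>\<rho> in linarith)+
    moreover have "norm (T us e ?b - ?b) \<le> 2 * (norm (?b - ?b) + norm (e - e') + norm (us - us'))"
      by (rule prox_lipschitz[OF T[OF us e \<theta>(1)[OF us' e']] p\<theta>[OF us' e']]) (use e e' \<tau>\<rho> \<rho> in linarith)+
    ultimately have "(1 - c) * norm (?a - ?b) \<le> 2 * (norm (us - us') + norm (e - e'))"
      using norm_triangle_ineq[of "?a - T us e ?b" "T us e ?b - ?b"] by (simp add: algebra_simps)
    thus ?thesis using c by (simp add: field_simps)
  qed
  have min: "f (\<theta> (us, e), e) - us \<bullet> \<theta> (us, e) < f (k, e) - us \<bullet> k"
    if us: "norm (us - us0) \<le> \<tau>" and e: "norm (e - e0) \<le> \<tau>"
      and k: "k \<in> K" "norm (k - u0) \<le> \<rho>" "k \<noteq> \<theta> (us, e)" for us e k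
  proof -
    let ?t = "\<theta> (us, e)"
    define F where "F x = f (x, e) - us \<bullet> x" for x
    \<comment> \<open>Iterates starting at the competitor \<open>k\<close>. The first step lowers
      the value strictly, since \<open>\<theta> (us, e)\<close> is the only fixed point; later steps
      do not raise it, and the iterates converge to \<open>\<theta> (us, e)\<close>.\<close>
    define z where "z n = (T us e ^^ n) k" for n
    have er: "norm (e - e0) \<le> r" using e \<tau>\<rho> \<rho> by linarith
    have z0: "z 0 = k" and zS: "z (Suc n) = T us e (z n)" for n by (simp_all add: z_def)
    have zb: "norm (z n - u0) \<le> \<rho>" for n
      by (induction n) (use k T_self[OF us e] in \<open>auto simp: z0 zS\<close>)
    have zp: "prox e us (z n) (z (Suc n))" for n unfolding zS by (rule T[OF us e zb])
    have zK: "z n \<in> K" for n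
      by (cases n) (use k zp in \<open>auto simp: z0 prox_def stationary_def\<close>)
    have dec: "F (z (Suc n)) + 3 * L * (norm (z n - z (Suc n)))\<^sup>2 \<le> F (z n)" for n
      unfolding F_def by (rule prox_descent[OF zp zK _ er]) (use zb[of n] \<rho> r in linarith)
    have dec': "F (z (Suc n)) \<le> F (z n)" for n
      using dec[of n] L by (smt (verit) mult_nonneg_nonneg zero_le_power2)
    have le1: "F (z (Suc n)) \<le> F (z 1)" for n
      by (induction n) (use dec' in \<open>auto intro: order_trans\<close>)
    have conv: "norm (z n - ?t) \<le> c ^ n * norm (k - ?t)" for n
    proof (induction n)
      case (Suc n)
      have "norm (z (Suc n) - ?t) \<le> c * norm (z n - ?t)"
        by (rule contr[OF _ _ zb \<theta>(1)[OF us e] zp p\<theta>[OF us e]]) (use us e \<tau>\<rho> in linarith)+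
      also have "\<dots> \<le> c * (c ^ n * norm (k - ?t))" using Suc c by (intro mult_left_mono) auto
      finally show ?case by simp
    qed (simp add: z0)
    have Flip: "\<bar>F x - F ?t\<bar> \<le> (L + norm us) * norm (x - ?t)" if "norm (x - u0) \<le> \<rho>" for x
    proof -
      have "\<bar>f (x, e) - f (?t, e)\<bar> \<le> L * (norm (x - ?t) + norm (e - e))"
        by (rule f_lip) (use that \<theta>(1)[OF us e] \<rho> r er in linarith)+
      moreover have "\<bar>us \<bullet> (x - ?t)\<bar> \<le> norm us * norm (x - ?t)" by (rule Cauchy_Schwarz_ineq2)
      ultimately show ?thesis by (simp add: F_def inner_diff_right algebra_simps abs_le_iff)
    qed
    have "F ?t \<le> F (z 1) + 0"
    proof (rule LIMSEQ_le_const)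
      have "(\<lambda>n. F (z 1) + (L + norm us) * (c ^ Suc n * norm (k - ?t))) \<longlonglongrightarrow> F (z 1) + (L + norm us) * (0 * norm (k - ?t))"
        by (intro tendsto_add tendsto_mult tendsto_const LIMSEQ_Suc[OF LIMSEQ_realpow_zero[OF c]])
      thus "(\<lambda>n. F (z 1) + (L + norm us) * (c ^ Suc n * norm (k - ?t))) \<longlonglongrightarrow> F (z 1) + 0" by simp
      have "F ?t \<le> F (z 1) + (L + norm us) * (c ^ Suc n * norm (k - ?t))" for n
      proof -
        have "(L + norm us) * norm (z (Suc n) - ?t) \<le> (L + norm us) * (c ^ Suc n * norm (k - ?t))"
          using conv[of "Suc n"] L by (intro mult_left_mono add_nonneg_nonneg) auto
        thus ?thesis using Flip[OF zb[of "Suc n"]] le1[of n] by linarith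
      qed
      thus "\<exists>N. \<forall>n\<ge>N. F ?t \<le> F (z 1) + (L + norm us) * (c ^ Suc n * norm (k - ?t))" by blast
    qed
    moreover have "F (z 1) < F k"
    proof -
      have "z 1 \<noteq> k"
      proof
        assume "z 1 = k"
        hence "prox e us k k" using zp[of 0] by (simp add: z0)
        thus False using uniq[OF us e k(2)] k(3) by blast
      qed
      hence "3 * L * (norm (k - z 1))\<^sup>2 > 0" using L by (intro mult_pos_pos) auto
      thus ?thesis using dec[of 0] by (simp add: z0)
    qed
    ultimately show ?thesis by (simp add: F_def)
  qed
  show thesis
  proof (rule that)
    show "\<theta> (us0, e0) = u0"
      using uniq[OF _ _ _ prox_base] \<tau> \<rho> by simp
    show "\<theta> (us, e) \<in> K \<and> norm (\<theta> (us, e) - u0) \<le> \<rho> \<and>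
       (\<forall>k\<in>K. norm (k - u0) \<le> \<rho> \<longrightarrow> k \<noteq> \<theta> (us, e) \<longrightarrow>
          f (\<theta> (us, e), e) - us \<bullet> \<theta> (us, e) < f (k, e) - us \<bullet> k)"
      if "norm (us - us0) \<le> \<tau>" "norm (e - e0) \<le> \<tau>" for us e
      using \<theta>(1)[OF that] p\<theta>[OF that] min[OF that] by (auto simp: prox_def stationary_def)
    show "0 \<le> 2 / (1 - c)" using c by simp
  qed (use \<rho> \<tau> \<tau>\<rho> r lip in auto)
qed

section \<open>Hoelder stability and cocoercivity\<close>

text \<open>A local Baillon-Haddad argument. \<open>G\<close> is the conjugate of the objective
  restricted to \<open>K\<close> and the \<rho>-ball, and minimality says that \<open>x t\<close> is
  a subgradient of \<open>G\<close> at \<open>t\<close>. The upper bound for \<open>G\<close> comes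
  from the subgradient inequality with its two points exchanged, whence \<open>\<kappa>\<close> in
  place of \<open>\<kappa> / 2\<close> and the final constant
  \<open>1 / (2 * \<kappa>)\<close>.\<close>

lemma minimizer_cocoercive:
  fixes x :: "'x \<Rightarrow> 'x"
  assumes s: "norm (s - us0) \<le> \<tau> / 2" and s': "norm (s' - us0) \<le> \<tau> / 2" and \<kappa>: "\<kappa> > 0" and \<tau>: "\<tau> > 0"
    and K: "\<And>t. norm (t - us0) < 2 * \<tau> \<Longrightarrow> x t \<in> K \<and> norm (x t - u0) \<le> \<rho>"
    and min: "\<And>t k. norm (t - us0) < 2 * \<tau> \<Longrightarrow> k \<in> K \<Longrightarrow> norm (k - u0) \<le> \<rho> \<Longrightarrow>
      f (x t, e) - t \<bullet> x t \<le> f (k, e) - t \<bullet> k"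
    and lip: "\<And>t t'. norm (t - us0) < 2 * \<tau> \<Longrightarrow> norm (t' - us0) < 2 * \<tau> \<Longrightarrow> norm (x t - x t') \<le> \<kappa> * norm (t - t')"
  shows "(x s - x s') \<bullet> (s - s') \<ge> 1 / (2 * \<kappa>) * (norm (x s - x s'))\<^sup>2"
proof -
  define G where "G t = t \<bullet> x t - f (x t, e)" for t
  have convex: "G t + x t \<bullet> (t' - t) \<le> G t'" if "norm (t - us0) < 2 * \<tau>" "norm (t' - us0) < 2 * \<tau>" for t t'
  proof -
    have "f (x t', e) - t' \<bullet> x t' \<le> f (x t, e) - t' \<bullet> x t"
      using min[OF that(2)] K[OF that(1)] by blast
    thus ?thesis by (simp add: G_def inner_diff_right inner_commute)
  qed
  have half: "G t + x t \<bullet> (t' - t) + 1 / (4 * \<kappa>) * (norm (x t' - x t))\<^sup>2 \<le> G t'"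
    if t: "norm (t - us0) \<le> \<tau> / 2" and t': "norm (t' - us0) \<le> \<tau> / 2" for t t'
  proof -
    define D where "D = x t' - x t"
    \<comment> \<open>A gradient step at \<open>t'\<close> for \<open>G\<close> minus its
      linearization at \<open>t\<close>. It may leave the half-size ball, which is why the
      hypotheses are made on a larger one.\<close>
    define y where "y = t' - (1 / (2 * \<kappa>)) *\<^sub>R D"
    have t2: "norm (t - us0) < 2 * \<tau>" "norm (t' - us0) < 2 * \<tau>" using t t' \<tau> by linarith+
    have "norm D \<le> \<kappa> * norm (t' - t)" unfolding D_def by (rule lip[OF t2(2,1)])
    moreover have "norm (t' - t) \<le> \<tau>"
      using norm_triangle_ineq4[of "t' - us0" "t - us0"] t t' by simp
    ultimately have "norm D \<le> \<kappa> * \<tau>" using \<kappa> by (meson mult_left_mono less_imp_le order_trans)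
    hence "norm ((1 / (2 * \<kappa>)) *\<^sub>R D) \<le> \<tau> / 2" using \<kappa> by (simp add: field_simps)
    hence y: "norm (y - us0) < 2 * \<tau>"
      using norm_triangle_ineq4[of "t' - us0" "(1 / (2 * \<kappa>)) *\<^sub>R D"] t' \<tau> by (simp add: y_def algebra_simps)
    have "G t + x t \<bullet> (y - t) \<le> G y" by (rule convex[OF t2(1) y])
    moreover have "G y \<le> G t' + x t' \<bullet> (y - t') + \<kappa> * (norm (y - t'))\<^sup>2"
    proof -
      have "(x y - x t') \<bullet> (y - t') \<le> norm (x y - x t') * norm (y - t')" by (rule norm_cauchy_schwarz)
      also have "\<dots> \<le> \<kappa> * norm (y - t') * norm (y - t')"
        using lip[OF y t2(2)] by (intro mult_right_mono) auto
      finally have "(x y - x t') \<bullet> (y - t') \<le> \<kappa> * (norm (y - t'))\<^sup>2" by (simp add: power2_eq_square)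
      moreover have "x y \<bullet> (t' - y) = - (x y \<bullet> (y - t'))" by (simp add: inner_diff_right)
      ultimately show ?thesis using convex[OF y t2(2)] by (simp add: inner_diff_left)
    qed
    ultimately have "G t + x t \<bullet> (t' - t) + (- (D \<bullet> (y - t'))) - \<kappa> * (norm (y - t'))\<^sup>2 \<le> G t'"
      by (simp add: D_def inner_diff_left inner_diff_right)
    moreover have "- (D \<bullet> (y - t')) = 1 / (2 * \<kappa>) * (norm D)\<^sup>2"
      by (simp add: y_def power2_norm_eq_inner)
    moreover have "\<kappa> * (norm (y - t'))\<^sup>2 = 1 / (4 * \<kappa>) * (norm D)\<^sup>2"
      using \<kappa> by (simp add: y_def power_mult_distrib power2_eq_square field_simps)
    moreover have "1 / (2 * \<kappa>) * (norm D)\<^sup>2 = 2 * (1 / (4 * \<kappa>) * (norm D)\<^sup>2)" by simp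
    ultimately show ?thesis unfolding D_def by linarith
  qed
  have "(x s - x s') \<bullet> (s - s') = - (x s \<bullet> (s' - s)) - x s' \<bullet> (s - s')"
    by (simp add: inner_diff_left inner_diff_right)
  moreover have "1 / (2 * \<kappa>) * (norm (x s - x s'))\<^sup>2 = 2 * (1 / (4 * \<kappa>) * (norm (x s - x s'))\<^sup>2)" by simp
  ultimately show ?thesis
    using half[OF s s'] half[OF s' s] norm_minus_commute[of "x s" "x s'"] by simp
qed

text \<open>Stationarity alone does not make a graph point \<open>(u, us)\<close> a minimizer.
  Solving \<open>s = us + \<mu> *\<^sub>R (u - \<theta> (s, e))\<close> near \<open>us0\<close>
  yields a second graph point \<open>(\<theta> (s, e), s)\<close>, and since
  \<open>\<mu> > L\<close> hypomonotonicity forces the two to coincide. Cocoercivity makes the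
  iteration for \<open>s\<close> contract, and later replaces a derivative of \<theta>, which need
  not exist.\<close>

lemma coderivative_bound_of_hoelder:
  assumes \<kappa>: "\<kappa> > 0" and \<rho>: "0 < \<rho>" "\<rho> \<le> r" and \<tau>: "0 < \<tau>" "\<tau> \<le> r" and \<theta>0: "\<theta> (us0, e0) = u0"
    and K': "\<And>us e. norm (us - us0) < \<tau> \<Longrightarrow> norm (e - e0) < \<tau> \<Longrightarrow> \<theta> (us, e) \<in> K \<and> norm (\<theta> (us, e) - u0) < \<rho>"
    and min: "\<And>us e k. norm (us - us0) < \<tau> \<Longrightarrow> norm (e - e0) < \<tau> \<Longrightarrow> k \<in> K \<Longrightarrow> norm (k - u0) \<le> \<rho> \<Longrightarrow>
      f (\<theta> (us, e), e) - us \<bullet> \<theta> (us, e) \<le> f (k, e) - us \<bullet> k"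
    and hoelder: "\<And>us e us' e'. norm (us - us0) < \<tau> \<Longrightarrow> norm (e - e0) < \<tau> \<Longrightarrow>
       norm (us' - us0) < \<tau> \<Longrightarrow> norm (e' - e0) < \<tau> \<Longrightarrow>
       norm (\<theta> (us, e) - \<theta> (us', e')) \<le> \<kappa> * (norm (us - us') + sqrt (norm (e - e')))"
  obtains \<eta> \<delta> where "0 < \<eta>" "\<eta> \<le> r" "0 < \<delta>" "coderivative_bound \<eta> \<delta>"
proof -
  define c where "c = 1 / (2 * \<kappa>)"
  have c: "c > 0" using \<kappa> by (simp add: c_def)
  have st: "stationary e (\<theta> (us, e)) us" if "norm (us - us0) < \<tau>" "norm (e - e0) < \<tau>" for us e
    using K'[OF that] min[OF that] \<rho> \<tau> that by (intro stationary_of_minimizer[of _ \<rho>]) auto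
  have lip: "norm (\<theta> (us, e) - \<theta> (us', e)) \<le> \<kappa> * norm (us - us')"
    if "norm (us - us0) < \<tau>" "norm (us' - us0) < \<tau>" "norm (e - e0) < \<tau>" for us us' e
    using hoelder[of us e us' e] that by simp
  have coco: "(\<theta> (s, e) - \<theta> (s', e)) \<bullet> (s - s') \<ge> c * (norm (\<theta> (s, e) - \<theta> (s', e)))\<^sup>2"
    if s: "norm (s - us0) \<le> \<tau> / 4" and s': "norm (s' - us0) \<le> \<tau> / 4" and e: "norm (e - e0) < \<tau>" for s s' e
    unfolding c_def
  proof (rule minimizer_cocoercive[where \<tau> = "\<tau> / 2" and \<rho> = \<rho> and e = e and x = "\<lambda>s. \<theta> (s, e)"])
    show "\<theta> (t, e) \<in> K \<and> norm (\<theta> (t, e) - u0) \<le> \<rho>" if "norm (t - us0) < 2 * (\<tau> / 2)" for t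
      using K'[of t e] that e by simp
    show "f (\<theta> (t, e), e) - t \<bullet> \<theta> (t, e) \<le> f (k, e) - t \<bullet> k"
      if "norm (t - us0) < 2 * (\<tau> / 2)" "k \<in> K" "norm (k - u0) \<le> \<rho>" for t k
      using min[of t e k] that e by simp
    show "norm (\<theta> (t, e) - \<theta> (t', e)) \<le> \<kappa> * norm (t - t')"
      if "norm (t - us0) < 2 * (\<tau> / 2)" "norm (t' - us0) < 2 * (\<tau> / 2)" for t t'
      using lip[of t t' e] that e by simp
  qed (use s s' \<kappa> \<tau> in simp_all)
  define \<mu> where "\<mu> = 4 * L"
  have \<mu>: "\<mu> > 0" using L by (simp add: \<mu>_def)
  \<comment> \<open>Chosen so that \<open>(1 - \<alpha>) * c = \<alpha> * \<mu>\<close>: when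
    \<open>norm (\<Phi> s - \<Phi> s')\<close> is squared, cocoercivity makes the cross term
    outweigh the square of \<open>D\<close>.\<close>
  define \<alpha> where "\<alpha> = c / (c + \<mu>)"
  have \<alpha>: "0 < \<alpha>" "\<alpha> < 1" and \<alpha>': "1 - \<alpha> = \<mu> / (c + \<mu>)" using c \<mu> by (auto simp: \<alpha>_def field_simps)
  define m where "m = 1 + \<mu> + \<mu> * \<kappa>"
  \<comment> \<open>\<open>w\<close> will bound the distances of \<open>u\<close> and
    \<open>us\<close> from the base point and the square root of that of \<open>e\<close>; then
    \<open>\<Phi>\<close> moves \<open>us0\<close> by at most
    \<open>\<alpha> * (w * m)\<close>.\<close>
  define w where "w = min 1 (\<tau> / 4 / m)"
  have dpos: "m > 0" using \<mu> \<kappa> by (simp add: m_def add_pos_pos)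
  have w: "0 < w" "w \<le> 1" "w * m \<le> \<tau> / 4"
  proof -
    show "0 < w" "w \<le> 1" using \<tau> dpos by (auto simp: w_def)
    have "w * m \<le> \<tau> / 4 / m * m"
      using dpos by (intro mult_right_mono) (auto simp: w_def)
    thus "w * m \<le> \<tau> / 4" using dpos by simp
  qed
  define \<eta> where "\<eta> = min (w\<^sup>2) (\<tau> / 5)"
  have ww: "w\<^sup>2 \<le> w" using w by (simp add: power2_eq_square mult_left_le)
  have \<eta>: "0 < \<eta>" "\<eta> \<le> w" "\<eta> < \<tau> / 4" "\<eta> \<le> r"
    using w \<tau> ww by (auto simp: \<eta>_def)
  have coincide: "u = \<theta> (us, e)"
    if st0: "stationary e u us" and near: "norm (u - u0) + norm (e - e0) + norm (us - us0) \<le> \<eta>" for u e us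
  proof -
    have ne: "norm (u - u0) \<le> \<eta>" "norm (e - e0) \<le> \<eta>" "norm (us - us0) \<le> \<eta>"
      using near norm_ge_zero[of "u - u0"] norm_ge_zero[of "e - e0"] norm_ge_zero[of "us - us0"] by linarith+
    have e\<tau>: "norm (e - e0) < \<tau>" using ne \<eta> \<tau> by linarith
    have er: "norm (e - e0) \<le> r" using ne \<eta> by linarith
    \<comment> \<open>A damped form of the equation for \<open>s\<close>, with the same fixed points
      because \<open>\<alpha> > 0\<close>.\<close>
    define \<Phi> where "\<Phi> s = (1 - \<alpha>) *\<^sub>R s + \<alpha> *\<^sub>R (us + \<mu> *\<^sub>R (u - \<theta> (s, e)))" for s
    have contr: "norm (\<Phi> s - \<Phi> s') \<le> (1 - \<alpha>) * norm (s - s')"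
      if s: "norm (s - us0) \<le> \<tau> / 4" and s': "norm (s' - us0) \<le> \<tau> / 4" for s s'
    proof -
      define D where "D = \<theta> (s, e) - \<theta> (s', e)"
      have "\<Phi> s - \<Phi> s' = (1 - \<alpha>) *\<^sub>R (s - s') - (\<alpha> * \<mu>) *\<^sub>R D"
        by (simp add: \<Phi>_def D_def algebra_simps)
      moreover have "(norm (a *\<^sub>R x - b *\<^sub>R y))\<^sup>2 = a\<^sup>2 * (norm x)\<^sup>2 - 2 * (a * b) * (y \<bullet> x) + b\<^sup>2 * (norm y)\<^sup>2"
        for a b :: real and x y :: 'x
        unfolding power2_norm_eq_inner
        by (simp add: inner_diff_left inner_diff_right inner_commute power2_eq_square algebra_simps)
      ultimately have "(norm (\<Phi> s - \<Phi> s'))\<^sup>2 = (1 - \<alpha>)\<^sup>2 * (norm (s - s'))\<^sup>2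
          - 2 * ((1 - \<alpha>) * (\<alpha> * \<mu>)) * (D \<bullet> (s - s')) + (\<alpha> * \<mu>)\<^sup>2 * (norm D)\<^sup>2"
        by presburger
      also have "\<dots> \<le> (1 - \<alpha>)\<^sup>2 * (norm (s - s'))\<^sup>2"
      proof -
        have "((1 - \<alpha>) * (\<alpha> * \<mu>)) * (D \<bullet> (s - s')) \<ge> ((1 - \<alpha>) * (\<alpha> * \<mu>)) * (c * (norm D)\<^sup>2)"
          using coco[OF s s' e\<tau>] \<alpha> \<mu> unfolding D_def by (intro mult_left_mono) auto
        moreover have "((1 - \<alpha>) * (\<alpha> * \<mu>)) * (c * (norm D)\<^sup>2) = (\<alpha> * \<mu>)\<^sup>2 * (norm D)\<^sup>2"
        proof -
          have "(1 - \<alpha>) * c = \<alpha> * \<mu>" using \<alpha>' by (simp add: \<alpha>_def)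
          thus ?thesis by (simp add: power2_eq_square mult_ac)
        qed
        moreover have "(\<alpha> * \<mu>)\<^sup>2 * (norm D)\<^sup>2 \<ge> 0" by simp
        ultimately show ?thesis by linarith
      qed
      also have "\<dots> = ((1 - \<alpha>) * norm (s - s'))\<^sup>2" by (simp add: power_mult_distrib)
      finally show ?thesis by (rule power2_le_imp_le) (use \<alpha> in simp)
    qed
    have start: "norm (\<Phi> us0 - us0) \<le> \<alpha> * (\<tau> / 4)"
    proof -
      have "norm (u0 - \<theta> (us0, e)) \<le> \<kappa> * sqrt (norm (e - e0))"
        using hoelder[of us0 e0 us0 e] \<tau> e\<tau> \<theta>0 by (simp add: norm_minus_commute)
      also have "\<dots> \<le> \<kappa> * w"
      proof -
        have "sqrt (norm (e - e0)) \<le> sqrt (w\<^sup>2)" using ne by (intro real_sqrt_le_mono) (simp add: \<eta>_def)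
        thus ?thesis using \<kappa> w by (intro mult_left_mono) auto
      qed
      finally have th: "norm (u0 - \<theta> (us0, e)) \<le> \<kappa> * w" .
      have "\<Phi> us0 - us0 = \<alpha> *\<^sub>R ((us - us0) + \<mu> *\<^sub>R ((u - u0) + (u0 - \<theta> (us0, e))))"
        by (simp add: \<Phi>_def algebra_simps)
      also have "norm \<dots> = \<alpha> * norm ((us - us0) + \<mu> *\<^sub>R ((u - u0) + (u0 - \<theta> (us0, e))))"
        using \<alpha> by simp
      also have "\<dots> \<le> \<alpha> * (norm (us - us0) + \<mu> * (norm (u - u0) + norm (u0 - \<theta> (us0, e))))"
      proof (rule mult_left_mono)
        have "norm ((us - us0) + \<mu> *\<^sub>R ((u - u0) + (u0 - \<theta> (us0, e))))
            \<le> norm (us - us0) + \<mu> * norm ((u - u0) + (u0 - \<theta> (us0, e)))"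
          using norm_triangle_ineq[of "us - us0" "\<mu> *\<^sub>R ((u - u0) + (u0 - \<theta> (us0, e)))"] \<mu> by simp
        also have "\<dots> \<le> norm (us - us0) + \<mu> * (norm (u - u0) + norm (u0 - \<theta> (us0, e)))"
          using \<mu> by (intro add_left_mono mult_left_mono norm_triangle_ineq) auto
        finally show "norm ((us - us0) + \<mu> *\<^sub>R ((u - u0) + (u0 - \<theta> (us0, e)))) \<le> \<dots>" .
      qed (use \<alpha> in simp)
      also have "\<dots> \<le> \<alpha> * (w + \<mu> * (w + \<kappa> * w))"
        using ne \<eta> th \<alpha> \<mu> by (intro mult_left_mono add_mono) auto
      also have "\<dots> = \<alpha> * (w * m)" by (simp add: m_def algebra_simps)
      also have "\<dots> \<le> \<alpha> * (\<tau> / 4)" using w \<alpha> by (intro mult_left_mono) auto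
      finally show ?thesis .
    qed
    have "\<exists>!s\<in>cball us0 (\<tau> / 4). \<Phi> s = s"
    proof (rule Banach_fix[where c = "1 - \<alpha>"])
      show "\<Phi> ` cball us0 (\<tau> / 4) \<subseteq> cball us0 (\<tau> / 4)"
      proof
        fix y assume "y \<in> \<Phi> ` cball us0 (\<tau> / 4)"
        then obtain s where "s \<in> cball us0 (\<tau> / 4)" and y: "y = \<Phi> s" by blast
        hence s: "norm (s - us0) \<le> \<tau> / 4" by (simp add: dist_norm norm_minus_commute)
        have "norm (\<Phi> s - us0) \<le> norm (\<Phi> s - \<Phi> us0) + norm (\<Phi> us0 - us0)"
          using norm_triangle_ineq[of "\<Phi> s - \<Phi> us0" "\<Phi> us0 - us0"] by simp
        also have "\<dots> \<le> (1 - \<alpha>) * (\<tau> / 4) + \<alpha> * (\<tau> / 4)"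
        proof (rule add_mono[OF _ start])
          have "norm (\<Phi> s - \<Phi> us0) \<le> (1 - \<alpha>) * norm (s - us0)" using contr[OF s, of us0] \<tau> by simp
          also have "\<dots> \<le> (1 - \<alpha>) * (\<tau> / 4)" using s \<alpha> by (intro mult_left_mono) auto
          finally show "norm (\<Phi> s - \<Phi> us0) \<le> (1 - \<alpha>) * (\<tau> / 4)" .
        qed
        also have "\<dots> = \<tau> / 4" by (simp add: field_simps)
        finally show "y \<in> cball us0 (\<tau> / 4)"
          unfolding y by (simp add: dist_norm norm_minus_commute)
      qed
      show "dist (\<Phi> s) (\<Phi> s') \<le> (1 - \<alpha>) * dist s s'" if "s \<in> cball us0 (\<tau> / 4)" "s' \<in> cball us0 (\<tau> / 4)" for s s'
        using contr[of s s'] that by (simp add: dist_norm norm_minus_commute)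
    qed (use \<tau> \<alpha> in \<open>auto simp: complete_eq_closed\<close>)
    then obtain s where "s \<in> cball us0 (\<tau> / 4)" and fixs: "\<Phi> s = s" by blast
    hence s: "norm (s - us0) < \<tau>" using \<tau> by (simp add: dist_norm norm_minus_commute)
    have "\<alpha> *\<^sub>R (us + \<mu> *\<^sub>R (u - \<theta> (s, e)) - s) = 0"
      using fixs by (simp add: \<Phi>_def algebra_simps)
    hence eq: "s = us + \<mu> *\<^sub>R (u - \<theta> (s, e))" using \<alpha> by simp
    \<comment> \<open>By the fixed point equation the left side is \<open>- \<mu>\<close> times the
      squared distance, with \<open>\<mu> = 4 * L\<close>; this leaves room only for distance
      0.\<close>
    have "(us - s) \<bullet> (u - \<theta> (s, e)) \<ge> - L * (norm (u - \<theta> (s, e)))\<^sup>2 - L * norm (e - e) * norm (u - \<theta> (s, e))"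
      using K'[OF s e\<tau>] ne \<eta> \<rho> er
      by (intro hypomonotone[OF st0 st[OF s e\<tau>]]) auto
    moreover have "(us - s) \<bullet> (u - \<theta> (s, e)) = - \<mu> * (norm (u - \<theta> (s, e)))\<^sup>2"
      by (subst eq) (simp add: power2_norm_eq_inner)
    ultimately have "L * (norm (u - \<theta> (s, e)))\<^sup>2 \<le> 0" by (simp add: \<mu>_def)
    hence "u = \<theta> (s, e)" using L by (simp add: mult_le_0_iff)
    thus ?thesis using eq by simp
  qed
  have "coderivative_bound \<eta> c"
    unfolding coderivative_bound_def
  proof (intro allI impI)
    fix u e us v vs
    assume A: "stationary e u us \<and> norm (u - u0) + norm (e - e0) + norm (us - us0) \<le> \<eta>"
      and normal: "graph_normal e u us vs v"
    have u: "u = \<theta> (us, e)" using coincide A by blast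
    have ne: "norm (e - e0) \<le> \<eta>" "norm (us - us0) \<le> \<eta>"
      using A norm_ge_zero[of "u - u0"] norm_ge_zero[of "e - e0"] norm_ge_zero[of "us - us0"] by linarith+
    have e\<tau>: "norm (e - e0) < \<tau>" using ne \<eta> \<tau> by linarith
    define w where "w = vs - (2 * c) *\<^sub>R v"
    have main: "c * (norm v)\<^sup>2 \<le> vs \<bullet> v + \<epsilon> * ((\<kappa> + 1) * norm w)" if \<epsilon>: "\<epsilon> > 0" for \<epsilon>
    proof -
      obtain d where d: "d > 0" and nd: "\<And>u' us'. stationary e u' us' \<Longrightarrow> norm (u' - u) < d \<Longrightarrow> norm (us' - us) < d \<Longrightarrow>
         vs \<bullet> (u' - u) - v \<bullet> (us' - us) \<le> \<epsilon> * (norm (u' - u) + norm (us' - us))"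
        using normal \<epsilon> unfolding graph_normal_def by blast
      \<comment> \<open>Small enough for \<open>s\<close> to stay where cocoercivity holds and for
        the graph point \<open>(\<theta> (s, e), s)\<close> to stay where the normal inequality
        holds.\<close>
      define t where "t = min d (\<tau> / 4 - \<eta>) / (2 * (\<kappa> + 1) * (norm w + 1))"
      have dp: "2 * (\<kappa> + 1) * (norm w + 1) > 0" using \<kappa> by (simp add: add_nonneg_pos)
      have t: "t > 0" using d \<eta> dp by (simp add: t_def)
      have tw: "(\<kappa> + 1) * (t * norm w) < min d (\<tau> / 4 - \<eta>)"
      proof -
        have "t * (2 * (\<kappa> + 1) * (norm w + 1)) = min d (\<tau> / 4 - \<eta>)"
          using dp t_def by (metis less_irrefl nonzero_eq_divide_eq)
        moreover have "2 * ((\<kappa> + 1) * (t * norm w)) \<le> t * (2 * (\<kappa> + 1) * (norm w + 1))"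
          using t \<kappa> by (simp add: algebra_simps)
        moreover have "min d (\<tau> / 4 - \<eta>) > 0" using d \<eta> by simp
        ultimately show ?thesis by linarith
      qed
      have tw': "t * norm w \<le> (\<kappa> + 1) * (t * norm w)" "\<kappa> * (t * norm w) \<le> (\<kappa> + 1) * (t * norm w)"
        using t \<kappa> by (simp_all add: algebra_simps)
      define s where "s = us + t *\<^sub>R w"
      define D where "D = \<theta> (s, e) - u"
      have ns: "norm (s - us) = t * norm w" using t by (simp add: s_def)
      have "norm (s - us0) \<le> norm (s - us) + norm (us - us0)"
        using norm_triangle_ineq[of "s - us" "us - us0"] by simp
      hence s4: "norm (s - us0) \<le> \<tau> / 4" using ns tw tw' ne by linarith
      have us4: "norm (us - us0) \<le> \<tau> / 4" using ne \<eta> by linarith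
      have s\<tau>: "norm (s - us0) < \<tau>" "norm (us - us0) < \<tau>" using s4 us4 \<tau> by linarith+
      have nD: "norm D \<le> \<kappa> * (t * norm w)" using lip[OF s\<tau> e\<tau>] by (simp add: D_def u ns)
      have "vs \<bullet> D - v \<bullet> (s - us) \<le> \<epsilon> * (norm D + norm (s - us))"
        unfolding D_def by (rule nd[OF st[OF s\<tau>(1) e\<tau>]]) (use nD ns tw tw' in \<open>simp_all add: D_def\<close>)
      also have "\<dots> \<le> \<epsilon> * ((\<kappa> + 1) * (t * norm w))"
        using nD \<epsilon> by (intro mult_left_mono) (auto simp: ns algebra_simps)
      finally have 1: "vs \<bullet> D - t * (v \<bullet> w) \<le> t * (\<epsilon> * ((\<kappa> + 1) * norm w))"
        by (simp add: s_def mult_ac)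
      have "c * (norm D)\<^sup>2 \<le> D \<bullet> (s - us)"
        using coco[OF s4 us4 e\<tau>] by (simp add: D_def u)
      hence 2: "c * (norm D)\<^sup>2 \<le> t * (vs \<bullet> D) - 2 * c * t * (v \<bullet> D)"
        by (simp add: s_def w_def inner_diff_right inner_commute algebra_simps)
      \<comment> \<open>The factor \<open>2 * c\<close> in \<open>w\<close> makes
        \<open>2 * c * t * (v \<bullet> D)\<close> the cross term of this square. The unknown
        \<open>D\<close> then survives only in \<open>vs \<bullet> D\<close>, which the normal
        inequality bounds from above.\<close>
      have "0 \<le> c * (norm (D + t *\<^sub>R v))\<^sup>2" using c by simp
      hence "0 \<le> c * (norm D)\<^sup>2 + 2 * c * t * (v \<bullet> D) + c * t\<^sup>2 * (norm v)\<^sup>2"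
        unfolding power2_norm_eq_inner by (simp add: inner_commute power2_eq_square algebra_simps)
      with 2 have "0 \<le> t * (vs \<bullet> D) + c * t\<^sup>2 * (norm v)\<^sup>2" by linarith
      hence "0 \<le> t * (vs \<bullet> D + c * t * (norm v)\<^sup>2)" by (simp add: power2_eq_square algebra_simps)
      hence 3: "0 \<le> vs \<bullet> D + t * (c * (norm v)\<^sup>2)" using t by (simp add: zero_le_mult_iff mult_ac)
      have "v \<bullet> w = vs \<bullet> v - 2 * (c * (norm v)\<^sup>2)"
        by (simp add: w_def inner_diff_right inner_commute power2_norm_eq_inner)
      with 1 3 have "0 \<le> t * (vs \<bullet> v + \<epsilon> * ((\<kappa> + 1) * norm w) - c * (norm v)\<^sup>2)"
        by (simp add: algebra_simps)
      thus ?thesis using t by (simp add: zero_le_mult_iff)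
    qed
    show "vs \<bullet> v \<ge> c * (norm v)\<^sup>2"
    proof (rule field_le_epsilon)
      fix \<epsilon> :: real assume \<epsilon>: "\<epsilon> > 0"
      have p: "(\<kappa> + 1) * norm w + 1 > 0" using \<kappa> by (simp add: add_nonneg_pos)
      have "c * (norm v)\<^sup>2 \<le> vs \<bullet> v + \<epsilon> / ((\<kappa> + 1) * norm w + 1) * ((\<kappa> + 1) * norm w)"
        by (rule main) (use \<epsilon> p in simp)
      also have "\<epsilon> / ((\<kappa> + 1) * norm w + 1) * ((\<kappa> + 1) * norm w) \<le> \<epsilon>"
        using \<epsilon> p by (simp add: pos_divide_le_eq)
      finally show "c * (norm v)\<^sup>2 \<le> vs \<bullet> v + \<epsilon>" by simp
    qed
  qed
  thus thesis using that \<eta> c by blast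
qed

end

section \<open>Subdifferentials and coderivatives\<close>

lemma regular_subdifferential_iff:
  "zs \<in> regular_subdifferential \<phi> z \<longleftrightarrow> \<bar>\<phi> z\<bar> \<noteq> \<infinity> \<and>
     (\<forall>\<epsilon>>0. \<forall>\<^sub>F x in at z. \<phi> z + ereal (blinfun_apply zs (x - z) - \<epsilon> * norm (x - z)) \<le> \<phi> x)"
proof (cases "\<bar>\<phi> z\<bar> = \<infinity>")
  case False
  then obtain c where c: "\<phi> z = ereal c" by auto
  let ?Q = "\<lambda>x. (\<phi> x - \<phi> z - ereal (blinfun_apply zs (x - z))) / ereal (norm (x - z))"
  have ev: "\<forall>\<^sub>F x in at z. x \<noteq> z" by (simp add: eventually_at_filter)
  have pt: "ereal (- \<epsilon>) \<le> ?Q x \<longleftrightarrow> \<phi> z + ereal (blinfun_apply zs (x - z) - \<epsilon> * norm (x - z)) \<le> \<phi> x"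
    if "x \<noteq> z" for x \<epsilon>
  proof -
    have n: "norm (x - z) > 0" using that by simp
    show ?thesis
      by (cases "\<phi> x") (use n c in \<open>auto simp: field_simps\<close>)
  qed
  have "0 \<le> Liminf (at z) ?Q \<longleftrightarrow>
      (\<forall>\<epsilon>>0. \<forall>\<^sub>F x in at z. \<phi> z + ereal (blinfun_apply zs (x - z) - \<epsilon> * norm (x - z)) \<le> \<phi> x)"
  proof
    assume A: "0 \<le> Liminf (at z) ?Q"
    show "\<forall>\<epsilon>>0. \<forall>\<^sub>F x in at z. \<phi> z + ereal (blinfun_apply zs (x - z) - \<epsilon> * norm (x - z)) \<le> \<phi> x"
    proof (intro allI impI)
      fix \<epsilon> :: real assume "\<epsilon> > 0"
      hence "ereal (- \<epsilon>) < 0" by simp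
      hence "\<forall>\<^sub>F x in at z. ereal (- \<epsilon>) < ?Q x" using A unfolding le_Liminf_iff by blast
      with ev show "\<forall>\<^sub>F x in at z. \<phi> z + ereal (blinfun_apply zs (x - z) - \<epsilon> * norm (x - z)) \<le> \<phi> x"
        by eventually_elim (use pt in \<open>blast intro: less_imp_le\<close>)
    qed
  next
    assume A: "\<forall>\<epsilon>>0. \<forall>\<^sub>F x in at z. \<phi> z + ereal (blinfun_apply zs (x - z) - \<epsilon> * norm (x - z)) \<le> \<phi> x"
    show "0 \<le> Liminf (at z) ?Q" unfolding le_Liminf_iff
    proof (intro allI impI)
      fix y :: ereal assume "y < 0"
      then obtain a where "y < ereal a" "ereal a < 0" using ereal_dense2 by blast
      hence a: "y < ereal a" "a < 0" by simp_all
      have "\<forall>\<^sub>F x in at z. \<phi> z + ereal (blinfun_apply zs (x - z) - (- a) * norm (x - z)) \<le> \<phi> x"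
        using A a(2) by (metis neg_0_less_iff_less)
      with ev show "\<forall>\<^sub>F x in at z. y < ?Q x"
      proof eventually_elim
        case (elim x)
        hence "ereal (- (- a)) \<le> ?Q x" using pt[OF elim(1), of "- a"] by blast
        thus ?case using a(1) by simp
      qed
    qed
  qed
  thus ?thesis using False by (simp add: regular_subdifferential_def)
qed (simp add: regular_subdifferential_def)

lemma regular_normal_cone_iff:
  "zs \<in> regular_normal_cone z \<Theta> \<longleftrightarrow> z \<in> \<Theta> \<and>
     (\<forall>\<epsilon>>0. \<exists>d>0. \<forall>x\<in>\<Theta>. norm (x - z) < d \<longrightarrow> blinfun_apply zs (x - z) \<le> \<epsilon> * norm (x - z))"
proof (cases "z \<in> \<Theta>")
  case True
  have "(\<forall>\<^sub>F x in at z. set_delta \<Theta> z + ereal (blinfun_apply zs (x - z) - \<epsilon> * norm (x - z)) \<le> set_delta \<Theta> x)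
     \<longleftrightarrow> (\<exists>d>0. \<forall>x\<in>\<Theta>. norm (x - z) < d \<longrightarrow> blinfun_apply zs (x - z) \<le> \<epsilon> * norm (x - z))" for \<epsilon>
  proof -
    have "(\<forall>\<^sub>F x in at z. set_delta \<Theta> z + ereal (blinfun_apply zs (x - z) - \<epsilon> * norm (x - z)) \<le> set_delta \<Theta> x)
       \<longleftrightarrow> (\<exists>d>0. \<forall>x. x \<noteq> z \<and> norm (x - z) < d \<longrightarrow> (x \<in> \<Theta> \<longrightarrow> blinfun_apply zs (x - z) \<le> \<epsilon> * norm (x - z)))"
      using True by (auto simp: eventually_at dist_norm set_delta_def zero_ereal_def)
    also have "\<dots> \<longleftrightarrow> (\<exists>d>0. \<forall>x\<in>\<Theta>. norm (x - z) < d \<longrightarrow> blinfun_apply zs (x - z) \<le> \<epsilon> * norm (x - z))"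
      by (intro ex_cong1 conj_cong refl) (force simp: blinfun.zero_right)
    finally show ?thesis .
  qed
  thus ?thesis
    unfolding regular_normal_cone_def regular_subdifferential_iff using True by (simp add: set_delta_def)
qed (simp add: regular_normal_cone_def regular_subdifferential_def set_delta_def)

text \<open>A regular subgradient gives local information, which the segments to the points of the
  convex set turn into the global inequality \<open>reg\<close>. That inequality survives limits, so
  passing to limiting subgradients adds nothing.\<close>

lemma limiting_subgradients_smooth_plus_indicator:
  fixes h :: "'x::{real_inner,complete_space} \<Rightarrow> ereal"
  assumes K: "closed K" "convex K" and S: "open S" "u \<in> S"
    and h: "\<And>x. x \<in> S \<Longrightarrow> h x = (if x \<in> K then ereal (F x) else \<infinity>)"
    and der: "\<And>x. x \<in> S \<Longrightarrow> (F has_derivative (\<bullet>) (G x)) (at x)"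
    and cont: "continuous_on S G"
  shows "us \<in> limiting_subgradients h u \<longleftrightarrow> u \<in> K \<and> (\<forall>k\<in>K. (us - G u) \<bullet> (k - u) \<le> 0)"
proof
  have bound: "\<forall>\<^sub>F y in at x. y \<in> S \<and> \<bar>F y - F x - G x \<bullet> (y - x)\<bar> \<le> \<epsilon> * norm (y - x)"
    if x: "x \<in> S" and \<epsilon>: "\<epsilon> > 0" for x \<epsilon>
  proof -
    from der[OF x, unfolded has_derivative_at_alt] \<epsilon> obtain d where d: "d > 0"
      "\<And>y. norm (y - x) < d \<Longrightarrow> norm (F y - F x - G x \<bullet> (y - x)) \<le> \<epsilon> * norm (y - x)" by blast
    have "\<forall>\<^sub>F y in at x. norm (y - x) < d"
      unfolding eventually_at using d(1) by (auto simp: dist_norm)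
    moreover have "\<forall>\<^sub>F y in at x. y \<in> S" using S(1) x by (rule eventually_at_in_open')
    ultimately show ?thesis by eventually_elim (use d(2) in auto)
  qed
  have reg: "blinfun_apply zs (k - x) \<le> G x \<bullet> (k - x)"
    if x: "x \<in> S" "x \<in> K" and zs: "zs \<in> regular_subdifferential h x" and k: "k \<in> K" for x zs k
  proof (cases "k = x")
    case False
    define N where "N = norm (k - x)"
    have N: "N > 0" using False by (simp add: N_def)
    have "blinfun_apply zs (k - x) \<le> G x \<bullet> (k - x) + \<epsilon>" if \<epsilon>: "\<epsilon> > 0" for \<epsilon>
    proof -
      \<comment> \<open>One \<open>\<epsilon>'\<close> pays for the subgradient inequality and one
        for the linearization of \<open>F\<close>.\<close>
      define \<epsilon>' where "\<epsilon>' = \<epsilon> / (2 * N)"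
      have \<epsilon>': "\<epsilon>' > 0" using \<epsilon> N by (simp add: \<epsilon>'_def)
      have "\<forall>\<^sub>F y in at x. h x + ereal (blinfun_apply zs (y - x) - \<epsilon>' * norm (y - x)) \<le> h y"
        using zs \<epsilon>' unfolding regular_subdifferential_iff by blast
      with bound[OF x(1) \<epsilon>']
      have ev: "\<forall>\<^sub>F y in at x. y \<in> K \<longrightarrow> blinfun_apply zs (y - x) \<le> G x \<bullet> (y - x) + 2 * \<epsilon>' * norm (y - x)"
      proof eventually_elim
        case (elim y)
        show ?case
        proof
          assume "y \<in> K"
          hence "F x + (blinfun_apply zs (y - x) - \<epsilon>' * norm (y - x)) \<le> F y"
            using elim h[of x] h[of y] x by simp
          thus "blinfun_apply zs (y - x) \<le> G x \<bullet> (y - x) + 2 * \<epsilon>' * norm (y - x)" using elim by linarith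
        qed
      qed
      have "((\<lambda>t. x + t *\<^sub>R (k - x)) \<longlongrightarrow> x + 0 *\<^sub>R (k - x)) (at_right 0)" by (intro tendsto_intros)
      moreover have "\<forall>\<^sub>F t in at_right 0. x + t *\<^sub>R (k - x) \<noteq> x"
        using eventually_at_right_less[of 0] by eventually_elim (use False in simp)
      ultimately have "filterlim (\<lambda>t. x + t *\<^sub>R (k - x)) (at x) (at_right 0)"
        by (simp add: filterlim_at)
      hence "\<forall>\<^sub>F t in at_right 0. x + t *\<^sub>R (k - x) \<in> K \<longrightarrow> blinfun_apply zs (t *\<^sub>R (k - x)) \<le> G x \<bullet> (t *\<^sub>R (k - x)) + 2 * \<epsilon>' * norm (t *\<^sub>R (k - x))"
        using ev by (auto simp: filterlim_iff dest!: spec)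
      moreover have "\<forall>\<^sub>F t in at_right (0::real). 0 < t \<and> t < 1"
        using eventually_at_right_real[of 0 1] by simp
      ultimately have "\<forall>\<^sub>F t in at_right (0::real). blinfun_apply zs (k - x) \<le> G x \<bullet> (k - x) + \<epsilon>"
      proof eventually_elim
        case (elim t)
        have "x + t *\<^sub>R (k - x) = (1 - t) *\<^sub>R x + t *\<^sub>R k" by (simp add: algebra_simps)
        hence "x + t *\<^sub>R (k - x) \<in> K" using convexD[OF K(2) x(2) k, of "1 - t" t] elim by simp
        hence "t * blinfun_apply zs (k - x) \<le> t * (G x \<bullet> (k - x) + 2 * \<epsilon>' * N)"
          using elim by (simp add: blinfun.scaleR_right N_def distrib_left mult_ac)
        hence "blinfun_apply zs (k - x) \<le> G x \<bullet> (k - x) + 2 * \<epsilon>' * N" using elim by simp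
        thus ?case using N by (simp add: \<epsilon>'_def)
      qed
      thus ?thesis by simp
    qed
    thus ?thesis by (rule field_le_epsilon)
  qed (simp add: blinfun.zero_right)
  assume "us \<in> limiting_subgradients h u"
  then obtain x xs where x: "x \<longlonglongrightarrow> u" and xs: "\<And>n. xs n \<in> regular_subdifferential h (x n)"
    and lim: "\<And>v. (\<lambda>n. blinfun_apply (xs n) v) \<longlonglongrightarrow> us \<bullet> v"
    unfolding limiting_subgradients_def limiting_subdifferential_def by auto
  have "\<forall>\<^sub>F n in sequentially. x n \<in> S" using x S by (rule topological_tendstoD)
  \<comment> \<open>Regular subgradients exist only where \<open>h\<close> is finite, which within
    \<open>S\<close> means in \<open>K\<close>.\<close>
  hence evK: "\<forall>\<^sub>F n in sequentially. x n \<in> S \<and> x n \<in> K"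
  proof eventually_elim
    case (elim n)
    thus ?case using xs[of n] h[OF elim] by (auto simp: regular_subdifferential_def split: if_splits)
  qed
  have u: "u \<in> K"
    by (rule Lim_in_closed_set[OF K(1) _ _ x]) (use evK in \<open>auto elim: eventually_mono\<close>)
  \<comment> \<open>Pointwise convergence of \<open>xs\<close> says nothing at the moving vectors
    \<open>x n - u\<close>; bounded norms make these values vanish.\<close>
  obtain B where B: "B > 0" "\<And>n. norm (xs n) \<le> B"
    using uniform_boundedness[of xs] lim convergent_imp_Bseq convergentI by metis
  have "us \<bullet> (k - u) \<le> G u \<bullet> (k - u)" if k: "k \<in> K" for k
  proof (rule tendsto_le)
    have "(\<lambda>n. blinfun_apply (xs n) (x n - u)) \<longlonglongrightarrow> 0"
    proof (rule Lim_null_comparison)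
      show "\<forall>\<^sub>F n in sequentially. norm (blinfun_apply (xs n) (x n - u)) \<le> B * norm (x n - u)"
        by (intro always_eventually allI order_trans[OF norm_blinfun] mult_right_mono B) simp
      have "(\<lambda>n. B * norm (x n - u)) \<longlonglongrightarrow> B * norm (u - u)" by (intro tendsto_intros x)
      thus "(\<lambda>n. B * norm (x n - u)) \<longlonglongrightarrow> 0" by simp
    qed
    from tendsto_diff[OF lim[of "k - u"] this]
    show "(\<lambda>n. blinfun_apply (xs n) (k - x n)) \<longlonglongrightarrow> us \<bullet> (k - u)"
      by (simp add: blinfun.diff_right algebra_simps)
    have "isCont G u" using cont S by (simp add: continuous_on_eq_continuous_at)
    hence "(\<lambda>n. G (x n)) \<longlonglongrightarrow> G u" using x by (rule isCont_tendsto_compose)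
    thus "(\<lambda>n. G (x n) \<bullet> (k - x n)) \<longlonglongrightarrow> G u \<bullet> (k - u)" by (intro tendsto_intros x)
    show "\<forall>\<^sub>F n in sequentially. blinfun_apply (xs n) (k - x n) \<le> G (x n) \<bullet> (k - x n)"
      using evK by eventually_elim (use reg xs k in blast)
  qed simp
  thus "u \<in> K \<and> (\<forall>k\<in>K. (us - G u) \<bullet> (k - u) \<le> 0)" using u by (simp add: inner_diff_left)
next
  assume A: "u \<in> K \<and> (\<forall>k\<in>K. (us - G u) \<bullet> (k - u) \<le> 0)"
  have hu: "h u = ereal (F u)" using h S A by simp
  have "blinfun_inner_right us \<in> regular_subdifferential h u"
    unfolding regular_subdifferential_iff
  proof (intro conjI allI impI)
    fix \<epsilon> :: real assume \<epsilon>: "\<epsilon> > 0"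
    from der[OF S(2), unfolded has_derivative_at_alt] \<epsilon> obtain d where d: "d > 0"
      "\<And>y. norm (y - u) < d \<Longrightarrow> norm (F y - F u - G u \<bullet> (y - u)) \<le> \<epsilon> * norm (y - u)" by blast
    have "\<forall>\<^sub>F y in at u. norm (y - u) < d"
      unfolding eventually_at using d(1) by (auto simp: dist_norm)
    moreover have "\<forall>\<^sub>F y in at u. y \<in> S" using S by (rule eventually_at_in_open')
    ultimately show "\<forall>\<^sub>F y in at u. h u + ereal (blinfun_apply (blinfun_inner_right us) (y - u) - \<epsilon> * norm (y - u)) \<le> h y"
    proof eventually_elim
      case (elim y)
      show ?case
      proof (cases "y \<in> K")
        case True
        hence "us \<bullet> (y - u) \<le> G u \<bullet> (y - u)" using A by (simp add: inner_diff_left)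
        moreover have "\<bar>F y - F u - G u \<bullet> (y - u)\<bar> \<le> \<epsilon> * norm (y - u)" using d(2)[OF elim(1)] by simp
        ultimately have "F u + (us \<bullet> (y - u) - \<epsilon> * norm (y - u)) \<le> F y" by linarith
        thus ?thesis using h[OF elim(2)] True hu by simp
      qed (use h[OF elim(2)] in simp)
    qed
  qed (use hu in simp)
  thus "us \<in> limiting_subgradients h u"
    unfolding limiting_subgradients_def limiting_subdifferential_def using hu
    by (auto intro!: exI[of _ "\<lambda>_::nat. u"] exI[of _ "\<lambda>_::nat. blinfun_inner_right us"])
qed

text \<open>The linearization error is estimated by a mean value bound and not by an integral, hence
  \<open>L\<close> and not \<open>L / 2\<close>.\<close>

lemma lipschitz_gradient_taylor:
  fixes F :: "'x::real_inner \<Rightarrow> real"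
  assumes C: "convex C" and xy: "x \<in> C" "y \<in> C"
    and der: "\<And>x. x \<in> C \<Longrightarrow> (F has_derivative (\<bullet>) (G x)) (at x)"
    and lip: "\<And>x y. x \<in> C \<Longrightarrow> y \<in> C \<Longrightarrow> norm (G x - G y) \<le> L * norm (x - y)" and L: "L \<ge> 0"
  shows "\<bar>F y - F x - G x \<bullet> (y - x)\<bar> \<le> L * (norm (y - x))\<^sup>2"
proof -
  let ?S = "closed_segment x y"
  have sub: "?S \<subseteq> C" using C xy by (rule closed_segment_subset[rotated 2])
  have "norm (F y - F x - G x \<bullet> (y - x)) \<le> norm (y - x) * (L * norm (y - x))"
  proof (rule differentiable_bound_linearization[where S = ?S and f' = "\<lambda>z. (\<bullet>) (G z)"])
    fix t :: real assume "t \<in> {0..1}"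
    thus "x + t *\<^sub>R (y - x) \<in> ?S"
      unfolding closed_segment_def by (auto intro!: exI[of _ t] simp: algebra_simps)
  next
    fix z assume "z \<in> ?S"
    thus "(F has_derivative (\<bullet>) (G z)) (at z within ?S)"
      using der sub by (meson has_derivative_at_withinI subsetD)
  next
    fix z assume z: "z \<in> ?S"
    have "norm (z - x) \<le> norm (y - x)" using z segment_bound(1) by blast
    hence zx: "norm (G z - G x) \<le> L * norm (y - x)"
      using lip[of z x] z sub xy L by (meson mult_left_mono order_trans subsetD)
    show "onorm ((\<bullet>) (G z) - (\<bullet>) (G x)) \<le> L * norm (y - x)"
    proof (rule onorm_bound)
      show "0 \<le> L * norm (y - x)" using L by simp
      fix w
      have "\<bar>(G z - G x) \<bullet> w\<bar> \<le> norm (G z - G x) * norm w" by (rule Cauchy_Schwarz_ineq2)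
      also have "\<dots> \<le> L * norm (y - x) * norm w" using zx by (intro mult_right_mono) auto
      finally show "norm (((\<bullet>) (G z) - (\<bullet>) (G x)) w) \<le> L * norm (y - x) * norm w"
        by (simp add: inner_diff_left)
    qed
  qed simp
  thus ?thesis by (simp add: power2_eq_square mult_ac)
qed

text \<open>Separates the product norm into the two distances; the equivalence of the norms costs
  the factors 2 in \<open>d / 2\<close> and \<open>\<epsilon> / 2\<close>.\<close>

lemma regular_coderivative_iff:
  "zs \<in> regular_coderivative F z w ws \<longleftrightarrow> w \<in> F z \<and>
     (\<forall>\<epsilon>>0. \<exists>d>0. \<forall>z' w'. w' \<in> F z' \<longrightarrow> norm (z' - z) < d \<longrightarrow> norm (w' - w) < d \<longrightarrow>
        blinfun_apply zs (z' - z) - blinfun_apply ws (w' - w) \<le> \<epsilon> * (norm (z' - z) + norm (w' - w)))"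
proof -
  have app: "blinfun_apply (pair_functional zs (- ws)) ((z', w') - (z, w)) = blinfun_apply zs (z' - z) - blinfun_apply ws (w' - w)"
    for z' w' by (simp add: pair_functional_apply blinfun.minus_left)
  have le: "norm ((z', w') - (z, w)) \<le> norm (z' - z) + norm (w' - w)"
    and ge: "norm (z' - z) \<le> norm ((z', w') - (z, w))" "norm (w' - w) \<le> norm ((z', w') - (z, w))" for z' w'
    using norm_Pair_le[of "z' - z" "w' - w"] norm_fst_le[where x = "z' - z" and y = "w' - w"]
      norm_snd_le[where x = "z' - z" and y = "w' - w"]
    by simp_all
  have "(\<forall>\<epsilon>>0. \<exists>d>0. \<forall>p\<in>mgraph F. norm (p - (z, w)) < d \<longrightarrow>
          blinfun_apply (pair_functional zs (- ws)) (p - (z, w)) \<le> \<epsilon> * norm (p - (z, w))) \<longleftrightarrow>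
     (\<forall>\<epsilon>>0. \<exists>d>0. \<forall>z' w'. w' \<in> F z' \<longrightarrow> norm (z' - z) < d \<longrightarrow> norm (w' - w) < d \<longrightarrow>
        blinfun_apply zs (z' - z) - blinfun_apply ws (w' - w) \<le> \<epsilon> * (norm (z' - z) + norm (w' - w)))"
    (is "?L \<longleftrightarrow> ?R")
  proof
    assume ?L
    show ?R
    proof (intro allI impI)
      fix \<epsilon> :: real assume \<epsilon>: "\<epsilon> > 0"
      with \<open>?L\<close> obtain d where d: "d > 0" "\<And>p. p \<in> mgraph F \<Longrightarrow> norm (p - (z, w)) < d \<Longrightarrow>
          blinfun_apply (pair_functional zs (- ws)) (p - (z, w)) \<le> \<epsilon> * norm (p - (z, w))" by blast
      show "\<exists>d>0. \<forall>z' w'. w' \<in> F z' \<longrightarrow> norm (z' - z) < d \<longrightarrow> norm (w' - w) < d \<longrightarrow>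
        blinfun_apply zs (z' - z) - blinfun_apply ws (w' - w) \<le> \<epsilon> * (norm (z' - z) + norm (w' - w))"
      proof (intro exI[of _ "d / 2"] conjI allI impI)
        fix z' w' assume A: "w' \<in> F z'" "norm (z' - z) < d / 2" "norm (w' - w) < d / 2"
        hence "norm ((z', w') - (z, w)) < d" using le[of z' w'] by linarith
        hence "blinfun_apply zs (z' - z) - blinfun_apply ws (w' - w) \<le> \<epsilon> * norm ((z', w') - (z, w))"
          using d(2)[of "(z', w')"] A(1) by (simp add: app mgraph_def del: diff_Pair)
        also have "\<dots> \<le> \<epsilon> * (norm (z' - z) + norm (w' - w))" using le \<epsilon> by (intro mult_left_mono) auto
        finally show "blinfun_apply zs (z' - z) - blinfun_apply ws (w' - w) \<le> \<epsilon> * (norm (z' - z) + norm (w' - w))" .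
      qed (use d in simp)
    qed
  next
    assume ?R
    show ?L
    proof (intro allI impI)
      fix \<epsilon> :: real assume \<epsilon>: "\<epsilon> > 0"
      hence "\<epsilon> / 2 > 0" by simp
      with \<open>?R\<close> obtain d where d: "d > 0" "\<And>z' w'. w' \<in> F z' \<Longrightarrow> norm (z' - z) < d \<Longrightarrow> norm (w' - w) < d \<Longrightarrow>
        blinfun_apply zs (z' - z) - blinfun_apply ws (w' - w) \<le> \<epsilon> / 2 * (norm (z' - z) + norm (w' - w))" by blast
      show "\<exists>d>0. \<forall>p\<in>mgraph F. norm (p - (z, w)) < d \<longrightarrow>
          blinfun_apply (pair_functional zs (- ws)) (p - (z, w)) \<le> \<epsilon> * norm (p - (z, w))"
      proof (intro exI[of _ d] conjI ballI impI)
        fix p assume p: "p \<in> mgraph F" "norm (p - (z, w)) < d"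
        obtain z' w' where zw: "p = (z', w')" by (cases p)
        have "blinfun_apply zs (z' - z) - blinfun_apply ws (w' - w) \<le> \<epsilon> / 2 * (norm (z' - z) + norm (w' - w))"
          using p ge[where z' = z' and w' = w'] unfolding zw by (intro d(2)) (auto simp: mgraph_def)
        also have "\<dots> \<le> \<epsilon> / 2 * (2 * norm (p - (z, w)))"
          using ge[where z' = z' and w' = w'] \<epsilon> unfolding zw by (intro mult_left_mono) linarith+
        finally show "blinfun_apply (pair_functional zs (- ws)) (p - (z, w)) \<le> \<epsilon> * norm (p - (z, w))"
          unfolding zw app by simp
      qed (rule d)
    qed
  qed
  thus ?thesis
    unfolding regular_coderivative_def mem_Collect_eq regular_normal_cone_iff by (simp add: mgraph_def)
qed

section \<open>Comparison of the two notions of full stability\<close>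

lemma sum_lipschitz_on_iff:
  "sum_lipschitz_on W f \<longleftrightarrow> (\<exists>\<kappa>\<ge>0. \<forall>a b a' b'. (a, b) \<in> W \<longrightarrow> (a', b') \<in> W \<longrightarrow>
     norm (f (a, b) - f (a', b')) \<le> \<kappa> * (norm (a - a') + norm (b - b')))"
  unfolding sum_lipschitz_on_def by (intro ex_cong1 conj_cong refl) blast

lemma ereal_lipschitz_on_subset:
  assumes "ereal_lipschitz_on W f" and "W' \<subseteq> W"
  shows "ereal_lipschitz_on W' f"
  using assms unfolding ereal_lipschitz_on_def sum_lipschitz_on_iff by (meson subsetD)

lemma lipschitz_imp_hoelder_fully_stable:
  assumes "lipschitz_fully_stable \<psi> u0 us0 e0"
  shows "hoelder_fully_stable \<psi> u0 us0 e0"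
proof -
  from assms obtain \<gamma> W \<theta> where \<gamma>: "\<gamma> > 0" and W: "open W" "(us0, e0) \<in> W"
    and M: "\<forall>p\<in>W. M_argmin \<psi> u0 \<gamma> p = {\<theta> p}" and lip: "sum_lipschitz_on W \<theta>"
    and M0: "M_argmin \<psi> u0 \<gamma> (us0, e0) = {u0}" and m: "ereal_lipschitz_on W (m_val \<psi> u0 \<gamma>)"
    unfolding lipschitz_fully_stable_def by blast
  from lip obtain \<kappa> where \<kappa>: "\<kappa> \<ge> 0" and lip': "\<And>a b a' b'. (a, b) \<in> W \<Longrightarrow> (a', b') \<in> W \<Longrightarrow>
      norm (\<theta> (a, b) - \<theta> (a', b')) \<le> \<kappa> * (norm (a - a') + norm (b - b'))"
    unfolding sum_lipschitz_on_iff by blast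
  obtain U V0 where "open U" "open V0" "(us0, e0) \<in> U \<times> V0" "U \<times> V0 \<subseteq> W"
    using open_prod_elim[OF W] by blast
  hence UV0: "open U" "open V0" "us0 \<in> U" "e0 \<in> V0" "U \<times> V0 \<subseteq> W" by auto
  \<comment> \<open>Radius 1/2 gives \<open>norm (e - e') \<le> 1\<close>, where a number is at most
    its square root.\<close>
  define V where "V = V0 \<inter> ball e0 (1/2)"
  have V: "open V" "e0 \<in> V" and sub: "U \<times> V \<subseteq> W" using UV0 by (auto simp: V_def)
  \<comment> \<open>The Lipschitz constant may be 0 while the Hoelder constant must be positive,
    hence \<open>\<kappa> + 1\<close>.\<close>
  have hoelder: "norm (\<theta> (us, e) - \<theta> (us', e')) \<le> (\<kappa> + 1) * (norm (us - us') + sqrt (norm (e - e')))"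
    if us: "us \<in> U" "us' \<in> U" and e: "e \<in> V" "e' \<in> V" for us us' e e'
  proof -
    have "norm (e - e') \<le> 1"
      using e dist_triangle_half_l[of e e0 1 e'] by (auto simp: V_def dist_commute dist_norm[symmetric])
    hence "norm (e - e') * norm (e - e') \<le> norm (e - e')" by (simp add: mult_left_le)
    hence le: "norm (e - e') \<le> sqrt (norm (e - e'))" by (intro real_le_rsqrt) (simp add: power2_eq_square)
    have "norm (\<theta> (us, e) - \<theta> (us', e')) \<le> \<kappa> * (norm (us - us') + norm (e - e'))"
      using us e sub by (intro lip') auto
    also have "\<dots> \<le> (\<kappa> + 1) * (norm (us - us') + sqrt (norm (e - e')))"
      using \<kappa> le by (intro mult_mono add_mono) auto
    finally show ?thesis .
  qed
  have "ereal_lipschitz_on (U \<times> V) (m_val \<psi> u0 \<gamma>)"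
    using m sub by (rule ereal_lipschitz_on_subset)
  hence "\<exists>U V \<theta>. open U \<and> us0 \<in> U \<and> open V \<and> e0 \<in> V \<and>
        (\<forall>p\<in>U \<times> V. M_argmin \<psi> u0 \<gamma> p = {\<theta> p}) \<and> M_argmin \<psi> u0 \<gamma> (us0, e0) = {u0} \<and>
        (\<forall>us\<in>U. \<forall>us'\<in>U. \<forall>e\<in>V. \<forall>e'\<in>V.
           norm (\<theta> (us, e) - \<theta> (us', e')) \<le> (\<kappa> + 1) * (norm (us - us') + sqrt (norm (e - e')))) \<and>
        ereal_lipschitz_on (U \<times> V) (m_val \<psi> u0 \<gamma>)"
    using hoelder M sub M0 UV0(1,3) V
    by (intro exI[of _ U] exI[of _ V] exI[of _ \<theta>] conjI ballI) auto
  moreover have "\<kappa> + 1 > 0" using \<kappa> by simp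
  ultimately show ?thesis unfolding hoelder_fully_stable_def using \<gamma> by blast
qed

text \<open>Kept outside the locales because the theorem needs it at the base point to obtain the
  assumption \<open>base\<close>.\<close>

lemma partial_subdifferential_smooth_plus_indicator:
  fixes f :: "'x::{real_inner,complete_space} \<times> 'e::real_normed_vector \<Rightarrow> real"
  assumes K: "closed K" "convex K"
    and psi: "\<And>u e. norm (u - u0) \<le> r \<Longrightarrow> norm (e - e0) \<le> r \<Longrightarrow>
      \<psi> (u, e) = (if u \<in> K then ereal (f (u, e)) else \<infinity>)"
    and f_der: "\<And>u e. norm (u - u0) \<le> r \<Longrightarrow> norm (e - e0) \<le> r \<Longrightarrow>
      ((\<lambda>x. f (x, e)) has_derivative (\<bullet>) (g (u, e))) (at u)"
    and g_lip: "\<And>u u' e e'. norm (u - u0) \<le> r \<Longrightarrow> norm (u' - u0) \<le> r \<Longrightarrow> norm (e - e0) \<le> r \<Longrightarrow> norm (e' - e0) \<le> r \<Longrightarrow>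
      norm (g (u, e) - g (u', e')) \<le> L * (norm (u - u') + norm (e - e'))"
    and L: "L \<ge> 0" and u: "norm (u - u0) < r" and e: "norm (e - e0) < r"
  shows "us \<in> partial_subdifferential \<psi> (u, e) \<longleftrightarrow> u \<in> K \<and> (\<forall>k\<in>K. (us - g (u, e)) \<bullet> (k - u) \<le> 0)"
proof -
  have "us \<in> limiting_subgradients (\<lambda>x. \<psi> (x, e)) u \<longleftrightarrow> u \<in> K \<and> (\<forall>k\<in>K. (us - g (u, e)) \<bullet> (k - u) \<le> 0)"
  proof (rule limiting_subgradients_smooth_plus_indicator[OF K, where S = "ball u0 r"])
    show "\<psi> (x, e) = (if x \<in> K then ereal (f (x, e)) else \<infinity>)" if "x \<in> ball u0 r" for x
      using that e by (intro psi) (auto simp: dist_norm norm_minus_commute)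
    show "((\<lambda>x. f (x, e)) has_derivative (\<bullet>) (g (x, e))) (at x)" if "x \<in> ball u0 r" for x
      using that e by (intro f_der) (auto simp: dist_norm norm_minus_commute)
    have "L-lipschitz_on (ball u0 r) (\<lambda>x. g (x, e))"
    proof (rule lipschitz_onI)
      fix x y assume "x \<in> ball u0 r" "y \<in> ball u0 r"
      thus "dist (g (x, e)) (g (y, e)) \<le> L * dist x y"
        using g_lip[of x y e e] e by (simp add: dist_norm norm_minus_commute)
    qed (rule L)
    thus "continuous_on (ball u0 r) (\<lambda>x. g (x, e))" by (rule lipschitz_on_continuous_on)
  qed (use u in \<open>simp_all add: dist_norm norm_minus_commute\<close>)
  thus ?thesis by (simp add: partial_subdifferential_def)
qed

text \<open>\<open>g_der\<close> linearizes \<open>v \<bullet> g\<close> in \<open>e\<close> alone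
  while \<open>u'\<close> moves as well, with an error measured by both distances: the form in which
  the coderivative sum rule uses the mixed second derivative.\<close>

locale parametric_objective = parametric_problem f g K u0 us0 e0 r L
  for f :: "'x::{real_inner,complete_space} \<times> 'e::real_normed_vector \<Rightarrow> real" and g K u0 us0 e0 r L +
  fixes \<psi> :: "'x \<times> 'e \<Rightarrow> ereal"
  assumes psi: "norm (u - u0) \<le> r \<Longrightarrow> norm (e - e0) \<le> r \<Longrightarrow> \<psi> (u, e) = (if u \<in> K then ereal (f (u, e)) else \<infinity>)"
    and psi_out: "u \<notin> K \<Longrightarrow> \<psi> (u, e) = \<infinity>"
    and f_der: "norm (u - u0) \<le> r \<Longrightarrow> norm (e - e0) \<le> r \<Longrightarrow> ((\<lambda>x. f (x, e)) has_derivative (\<bullet>) (g (u, e))) (at u)"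
    and g_der: "norm (u - u0) < r \<Longrightarrow> norm (e - e0) < r \<Longrightarrow> \<exists>es :: 'e \<Rightarrow>\<^sub>L real. \<forall>\<epsilon>>0. \<exists>d>0. \<forall>u' e'.
        norm (u' - u) < d \<longrightarrow> norm (e' - e) < d \<longrightarrow>
        \<bar>v \<bullet> (g (u', e') - g (u', e)) - blinfun_apply es (e' - e)\<bar> \<le> \<epsilon> * (norm (u' - u) + norm (e' - e))"
begin

lemma partial_subdifferential_iff:
  assumes "norm (u - u0) < r" and "norm (e - e0) < r"
  shows "us \<in> partial_subdifferential \<psi> (u, e) \<longleftrightarrow> stationary e u us"
  unfolding stationary_def
  by (rule partial_subdifferential_smooth_plus_indicator[OF K(1,2) psi f_der g_lip]) (use assms L in auto)

text \<open>Both sides depend only on the graph near \<open>(u, us)\<close>, and there the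
  subdifferential is \<open>stationary e\<close>.\<close>

lemma combined_second_subdifferential_iff:
  assumes u: "norm (u - u0) < r" and e: "norm (e - e0) < r" and st: "stationary e u us"
  shows "vs \<in> combined_second_subdifferential (\<lambda>x. \<psi> (x, e)) u us v \<longleftrightarrow> graph_normal e u us vs v"
proof -
  let ?F = "limiting_subgradients (\<lambda>x. \<psi> (x, e))"
  have F: "us' \<in> ?F u' \<longleftrightarrow> stationary e u' us'" if "norm (u' - u) < r - norm (u - u0)" for u' us'
  proof -
    have "norm (u' - u0) < r" using that norm_triangle_ineq[of "u' - u" "u - u0"] by simp
    from partial_subdifferential_iff[OF this e] show ?thesis by (simp add: partial_subdifferential_def)
  qed
  have us: "us \<in> ?F u" using F[of u us] st u by simp
  have "(\<exists>d>0. \<forall>u' us'. us' \<in> ?F u' \<longrightarrow> norm (u' - u) < d \<longrightarrow> norm (us' - us) < d \<longrightarrow> Q u' us') \<longleftrightarrow>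
    (\<exists>d>0. \<forall>u' us'. stationary e u' us' \<and> norm (u' - u) < d \<and> norm (us' - us) < d \<longrightarrow> Q u' us')" (is "?L \<longleftrightarrow> ?R") for Q
  proof
    assume ?L
    then obtain d where "d > 0" "\<And>u' us'. us' \<in> ?F u' \<Longrightarrow> norm (u' - u) < d \<Longrightarrow> norm (us' - us) < d \<Longrightarrow> Q u' us'" by blast
    thus ?R using F u by (intro exI[of _ "min d (r - norm (u - u0))"]) auto
  next
    assume ?R
    then obtain d where "d > 0" "\<And>u' us'. stationary e u' us' \<Longrightarrow> norm (u' - u) < d \<Longrightarrow> norm (us' - us) < d \<Longrightarrow> Q u' us'" by blast
    thus ?L using F u by (intro exI[of _ "min d (r - norm (u - u0))"]) auto
  qed
  thus ?thesis
    unfolding combined_second_subdifferential_def mem_Collect_eq regular_coderivative_iff graph_normal_def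
    using us by simp
qed

text \<open>
  The exact sum rule: moving a graph point \<open>((u', e'), us')\<close> to the slice \<open>e' = e\<close> costs only the
  smooth term \<open>g (u', e') - g (u', e)\<close>, whose derivative in \<open>e\<close> supplies the component \<open>es\<close>.
\<close>

lemma full_coderivative_iff:
  assumes u: "norm (u - u0) < r" and e: "norm (e - e0) < r" and st: "stationary e u us"
  shows "(\<exists>es. pair_functional (blinfun_inner_right vs) es
            \<in> regular_coderivative (partial_subdifferential \<psi>) (u, e) us (blinfun_inner_right v))
     \<longleftrightarrow> graph_normal e u us vs v"
proof
  assume "\<exists>es. pair_functional (blinfun_inner_right vs) es
            \<in> regular_coderivative (partial_subdifferential \<psi>) (u, e) us (blinfun_inner_right v)"
  then obtain es where A: "\<And>\<epsilon>. \<epsilon> > 0 \<Longrightarrow> \<exists>d>0. \<forall>z' us'. us' \<in> partial_subdifferential \<psi> z' \<longrightarrow>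
      norm (z' - (u, e)) < d \<longrightarrow> norm (us' - us) < d \<longrightarrow>
      blinfun_apply (pair_functional (blinfun_inner_right vs) es) (z' - (u, e)) - v \<bullet> (us' - us)
        \<le> \<epsilon> * (norm (z' - (u, e)) + norm (us' - us))"
    unfolding regular_coderivative_iff by auto
  show "graph_normal e u us vs v"
    unfolding graph_normal_def
  proof (intro allI impI)
    fix \<epsilon> :: real assume "\<epsilon> > 0"
    from A[OF this] obtain d where d: "d > 0" "\<And>z' us'. us' \<in> partial_subdifferential \<psi> z' \<Longrightarrow>
      norm (z' - (u, e)) < d \<Longrightarrow> norm (us' - us) < d \<Longrightarrow>
      blinfun_apply (pair_functional (blinfun_inner_right vs) es) (z' - (u, e)) - v \<bullet> (us' - us)
        \<le> \<epsilon> * (norm (z' - (u, e)) + norm (us' - us))" by blast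
    show "\<exists>d>0. \<forall>u' us'. stationary e u' us' \<and> norm (u' - u) < d \<and> norm (us' - us) < d \<longrightarrow>
       vs \<bullet> (u' - u) - v \<bullet> (us' - us) \<le> \<epsilon> * (norm (u' - u) + norm (us' - us))"
    proof (intro exI[of _ "min d (r - norm (u - u0))"] conjI allI impI)
      fix u' us' assume B: "stationary e u' us' \<and> norm (u' - u) < min d (r - norm (u - u0)) \<and> norm (us' - us) < min d (r - norm (u - u0))"
      hence "norm (u' - u0) < r" using norm_triangle_ineq[of "u' - u" "u - u0"] by simp
      hence "us' \<in> partial_subdifferential \<psi> (u', e)" using partial_subdifferential_iff e B by blast
      moreover have "norm ((u', e) - (u, e)) = norm (u' - u)" by (simp add: norm_Pair)
      ultimately show "vs \<bullet> (u' - u) - v \<bullet> (us' - us) \<le> \<epsilon> * (norm (u' - u) + norm (us' - us))"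
        using d(2)[of us' "(u', e)"] B by (simp add: pair_functional_apply blinfun.zero_right)
    qed (use d u in simp)
  qed
next
  assume gn: "graph_normal e u us vs v"
  obtain es :: "'e \<Rightarrow>\<^sub>L real" where es: "\<And>\<epsilon>. \<epsilon> > 0 \<Longrightarrow> \<exists>d>0. \<forall>u' e'. norm (u' - u) < d \<longrightarrow> norm (e' - e) < d \<longrightarrow>
        \<bar>v \<bullet> (g (u', e') - g (u', e)) - blinfun_apply es (e' - e)\<bar> \<le> \<epsilon> * (norm (u' - u) + norm (e' - e))"
    using g_der[OF u e, of v] by blast
  have "pair_functional (blinfun_inner_right vs) es
      \<in> regular_coderivative (partial_subdifferential \<psi>) (u, e) us (blinfun_inner_right v)"
    unfolding regular_coderivative_iff
  proof (intro conjI allI impI)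
    show "us \<in> partial_subdifferential \<psi> (u, e)" using partial_subdifferential_iff[OF u e] st by blast
    fix \<epsilon> :: real assume \<epsilon>: "\<epsilon> > 0"
    \<comment> \<open>Allows for the factor \<open>2 * (L + 2)\<close> by which the errors below
      exceed the total distance.\<close>
    define \<epsilon>' where "\<epsilon>' = \<epsilon> / (2 * (L + 2))"
    have \<epsilon>': "\<epsilon>' > 0" using \<epsilon> L by (simp add: \<epsilon>'_def)
    from es[OF \<epsilon>'] obtain d1 where d1: "d1 > 0" "\<And>u' e'. norm (u' - u) < d1 \<Longrightarrow> norm (e' - e) < d1 \<Longrightarrow>
        \<bar>v \<bullet> (g (u', e') - g (u', e)) - blinfun_apply es (e' - e)\<bar> \<le> \<epsilon>' * (norm (u' - u) + norm (e' - e))" by blast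
    from gn \<epsilon>' obtain d2 where d2: "d2 > 0" "\<And>u' us'. stationary e u' us' \<Longrightarrow> norm (u' - u) < d2 \<Longrightarrow> norm (us' - us) < d2 \<Longrightarrow>
        vs \<bullet> (u' - u) - v \<bullet> (us' - us) \<le> \<epsilon>' * (norm (u' - u) + norm (us' - us))"
      unfolding graph_normal_def by blast
    \<comment> \<open>Subtracting \<open>D\<close> moves \<open>us'\<close> by up to
      \<open>L * norm (e' - e)\<close>, hence \<open>d2 / (L + 1)\<close>.\<close>
    define d where "d = min (min d1 (d2 / (L + 1))) (min (r - norm (u - u0)) (r - norm (e - e0)))"
    have d: "d > 0" using d1 d2 u e L by (simp add: d_def)
    have dL: "(L + 1) * d \<le> d2"
    proof -
      have "(L + 1) * d \<le> (L + 1) * (d2 / (L + 1))" using L by (intro mult_left_mono) (auto simp: d_def)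
      thus ?thesis using L by simp
    qed
    have d_d2: "d \<le> d2" using dL L d by (smt (verit) mult_less_cancel_right2)
    show "\<exists>d>0. \<forall>z' us'. us' \<in> partial_subdifferential \<psi> z' \<longrightarrow> norm (z' - (u, e)) < d \<longrightarrow> norm (us' - us) < d \<longrightarrow>
        blinfun_apply (pair_functional (blinfun_inner_right vs) es) (z' - (u, e)) - blinfun_apply (blinfun_inner_right v) (us' - us)
        \<le> \<epsilon> * (norm (z' - (u, e)) + norm (us' - us))"
    proof (intro exI[of _ d] conjI allI impI d)
      fix z' us' assume B: "us' \<in> partial_subdifferential \<psi> z'" "norm (z' - (u, e)) < d" "norm (us' - us) < d"
      obtain u' e' where z': "z' = (u', e')" by (cases z')
      define n where "n = norm (z' - (u, e))"
      have nu: "norm (u' - u) \<le> n" and ne: "norm (e' - e) \<le> n"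
        using norm_fst_le[where x = "u' - u" and y = "e' - e"] norm_snd_le[where x = "u' - u" and y = "e' - e"] by (simp_all add: n_def z')
      have nd: "n < d" using B by (simp add: n_def)
      have u': "norm (u' - u0) < r"
        using nu nd norm_triangle_ineq[of "u' - u" "u - u0"] by (simp add: d_def)
      have e': "norm (e' - e0) < r"
        using ne nd norm_triangle_ineq[of "e' - e" "e - e0"] by (simp add: d_def)
      have st': "stationary e' u' us'" using B(1) partial_subdifferential_iff[OF u' e'] by (simp add: z')
      define D where "D = g (u', e') - g (u', e)"
      have "norm D \<le> L * (norm (u' - u') + norm (e' - e))"
        unfolding D_def using u' e' e by (intro g_lip) auto
      hence ND: "norm D \<le> L * norm (e' - e)" by simp
      \<comment> \<open>The normal cone depends on \<open>u'\<close> only, so subtracting the change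
        of \<open>g\<close> turns a graph point at \<open>e'\<close> into one at
        \<open>e\<close>.\<close>
      have stD: "stationary e u' (us' - D)" using st' by (simp add: stationary_def D_def)
      have nus: "norm (us' - D - us) \<le> norm (us' - us) + L * norm (e' - e)"
        using norm_triangle_ineq4[of "us' - us" D] ND by (simp add: algebra_simps)
      have "L * norm (e' - e) \<le> L * n" using ne L by (intro mult_left_mono) auto
      moreover have "L * n \<le> L * d" using nd L by simp
      moreover have "norm (us' - us) + L * d < (L + 1) * d" using B by (simp add: algebra_simps)
      ultimately have "norm (us' - D - us) < d2" using nus dL by linarith
      hence 1: "vs \<bullet> (u' - u) - v \<bullet> (us' - D - us) \<le> \<epsilon>' * (norm (u' - u) + norm (us' - D - us))"
        using nu nd d_d2 by (intro d2(2)[OF stD]) auto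
      have 2: "\<bar>v \<bullet> D - blinfun_apply es (e' - e)\<bar> \<le> \<epsilon>' * (norm (u' - u) + norm (e' - e))"
        unfolding D_def using nu ne nd by (intro d1(2)) (auto simp: d_def)
      have "vs \<bullet> (u' - u) + blinfun_apply es (e' - e) - v \<bullet> (us' - us)
          \<le> \<epsilon>' * (norm (u' - u) + norm (us' - D - us)) + \<epsilon>' * (norm (u' - u) + norm (e' - e))"
        using 1 2 by (simp add: inner_diff_right)
      also have "\<dots> = \<epsilon>' * (2 * norm (u' - u) + norm (us' - D - us) + norm (e' - e))"
        by (simp add: algebra_simps)
      also have "\<dots> \<le> \<epsilon>' * (2 * (L + 2) * (n + norm (us' - us)))"
      proof (rule mult_left_mono)
        have "2 * norm (u' - u) + norm (us' - D - us) + norm (e' - e) \<le> 2 * n + (norm (us' - us) + L * n) + n"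
          using nu ne nus \<open>L * norm (e' - e) \<le> L * n\<close> by linarith
        also have "\<dots> \<le> 2 * (L + 2) * (n + norm (us' - us))"
        proof -
          have "0 \<le> L * n" "0 \<le> L * norm (us' - us)" "0 \<le> n" using L by (simp_all add: n_def)
          thus ?thesis by (simp add: algebra_simps)
        qed
        finally show "2 * norm (u' - u) + norm (us' - D - us) + norm (e' - e) \<le> 2 * (L + 2) * (n + norm (us' - us))" .
      qed (use \<epsilon>' in simp)
      also have "\<dots> = \<epsilon> * (n + norm (us' - us))" using L by (simp add: \<epsilon>'_def)
      finally show "blinfun_apply (pair_functional (blinfun_inner_right vs) es) (z' - (u, e)) - blinfun_apply (blinfun_inner_right v) (us' - us)
        \<le> \<epsilon> * (norm (z' - (u, e)) + norm (us' - us))"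
        unfolding n_def by (simp add: z' pair_functional_apply)
    qed
  qed
  thus "\<exists>es. pair_functional (blinfun_inner_right vs) es
      \<in> regular_coderivative (partial_subdifferential \<psi>) (u, e) us (blinfun_inner_right v)" by blast
qed

text \<open>\<open>N\<close> stands for the coderivative relation of (iii) or of (iv), so that one
  lemma serves both. Cutting \<eta> down to at most \<open>r / 2\<close> keeps everything inside the
  radius \<open>r\<close>.\<close>

lemma coderivative_condition_iff:
  assumes N: "\<And>u e us vs v. norm (u - u0) < r \<Longrightarrow> norm (e - e0) < r \<Longrightarrow> stationary e u us \<Longrightarrow>
      N u e us vs v \<longleftrightarrow> graph_normal e u us vs v"
  shows "(\<exists>\<eta>>0. \<exists>\<delta>>0. \<forall>u e us. ((u, e), us) \<in> mgraph (partial_subdifferential \<psi>) \<and>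
         norm (u - u0) + norm (e - e0) + norm (us - us0) \<le> \<eta> \<longrightarrow>
         (\<forall>v vs. N u e us vs v \<longrightarrow> vs \<bullet> v \<ge> \<delta> * (norm v)\<^sup>2))
     \<longleftrightarrow> (\<exists>\<eta> \<delta>. 0 < \<eta> \<and> \<eta> \<le> r \<and> 0 < \<delta> \<and> coderivative_bound \<eta> \<delta>)" (is "?L \<longleftrightarrow> ?R")
proof -
  have key: "((u, e), us) \<in> mgraph (partial_subdifferential \<psi>) \<longleftrightarrow> stationary e u us"
    "stationary e u us \<Longrightarrow> N u e us vs v \<longleftrightarrow> graph_normal e u us vs v"
    if "norm (u - u0) + norm (e - e0) + norm (us - us0) \<le> min \<eta> (r / 2)" for u e us vs v \<eta>
  proof -
    have "norm (u - u0) + norm (e - e0) + norm (us - us0) < r" using that r by simp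
    hence "norm (u - u0) < r" "norm (e - e0) < r"
      using norm_ge_zero[of "u - u0"] norm_ge_zero[of "e - e0"] norm_ge_zero[of "us - us0"] by linarith+
    thus "((u, e), us) \<in> mgraph (partial_subdifferential \<psi>) \<longleftrightarrow> stationary e u us"
      "stationary e u us \<Longrightarrow> N u e us vs v \<longleftrightarrow> graph_normal e u us vs v"
      using partial_subdifferential_iff N by (auto simp: mgraph_def)
  qed
  show ?thesis
  proof
    assume ?L
    then obtain \<eta> \<delta> where \<eta>: "\<eta> > 0" "\<delta> > 0" and A: "\<And>u e us v vs. ((u, e), us) \<in> mgraph (partial_subdifferential \<psi>) \<Longrightarrow>
         norm (u - u0) + norm (e - e0) + norm (us - us0) \<le> \<eta> \<Longrightarrow> N u e us vs v \<Longrightarrow> vs \<bullet> v \<ge> \<delta> * (norm v)\<^sup>2" by blast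
    have "coderivative_bound (min \<eta> (r / 2)) \<delta>"
      unfolding coderivative_bound_def
    proof (intro allI impI)
      fix u e us v vs
      assume B: "stationary e u us \<and> norm (u - u0) + norm (e - e0) + norm (us - us0) \<le> min \<eta> (r / 2)"
        and gn: "graph_normal e u us vs v"
      show "\<delta> * (norm v)\<^sup>2 \<le> vs \<bullet> v"
        by (rule A[of u e us]) (use B gn key[of u e us \<eta>] in auto)
    qed
    moreover have "0 < min \<eta> (r / 2)" "min \<eta> (r / 2) \<le> r" using \<eta> r by auto
    ultimately show ?R using \<eta>(2) by blast
  next
    assume ?R
    then obtain \<eta> \<delta> where \<eta>: "0 < \<eta>" "0 < \<delta>" and cod: "coderivative_bound \<eta> \<delta>" by blast
    have "\<forall>u e us. ((u, e), us) \<in> mgraph (partial_subdifferential \<psi>) \<and>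
         norm (u - u0) + norm (e - e0) + norm (us - us0) \<le> min \<eta> (r / 2) \<longrightarrow>
         (\<forall>v vs. N u e us vs v \<longrightarrow> vs \<bullet> v \<ge> \<delta> * (norm v)\<^sup>2)"
    proof (intro allI impI)
      fix u e us v vs
      assume B: "((u, e), us) \<in> mgraph (partial_subdifferential \<psi>) \<and>
         norm (u - u0) + norm (e - e0) + norm (us - us0) \<le> min \<eta> (r / 2)" and "N u e us vs v"
      hence "stationary e u us" "graph_normal e u us vs v" using key[of u e us \<eta>] by blast+
      thus "\<delta> * (norm v)\<^sup>2 \<le> vs \<bullet> v" using cod B unfolding coderivative_bound_def by auto
    qed
    moreover have "min \<eta> (r / 2) > 0" using \<eta> r by simp
    ultimately show ?L using \<eta>(2) by blast
  qed
qed

lemma perturbed_objective_near: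
  assumes "norm (u - u0) \<le> r" "norm (e - e0) \<le> r"
  shows "perturbed_objective \<psi> (us, e) u = (if u \<in> K then ereal (f (u, e) - us \<bullet> u) else \<infinity>)"
  using psi[OF assms] by (cases "u \<in> K") (simp_all add: perturbed_objective_def)

lemma lipschitz_fully_stable_of_coderivative_bound:
  assumes cod: "coderivative_bound \<eta> \<delta>" and \<delta>: "\<delta> > 0" and \<eta>: "0 < \<eta>" "\<eta> \<le> r"
  shows "lipschitz_fully_stable \<psi> u0 us0 e0"
proof -
  obtain \<rho> \<tau> \<kappa> \<theta> where \<rho>: "0 < \<rho>" "\<rho> \<le> r" and \<tau>: "0 < \<tau>" "\<tau> \<le> r" and \<kappa>: "0 \<le> \<kappa>" and \<theta>0: "\<theta> (us0, e0) = u0"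
    and \<theta>: "\<And>us e. norm (us - us0) \<le> \<tau> \<Longrightarrow> norm (e - e0) \<le> \<tau> \<Longrightarrow>
       \<theta> (us, e) \<in> K \<and> norm (\<theta> (us, e) - u0) \<le> \<rho> \<and>
       (\<forall>k\<in>K. norm (k - u0) \<le> \<rho> \<longrightarrow> k \<noteq> \<theta> (us, e) \<longrightarrow>
          f (\<theta> (us, e), e) - us \<bullet> \<theta> (us, e) < f (k, e) - us \<bullet> k)"
    and lip: "\<And>us e us' e'. norm (us - us0) \<le> \<tau> \<Longrightarrow> norm (e - e0) \<le> \<tau> \<Longrightarrow>
       norm (us' - us0) \<le> \<tau> \<Longrightarrow> norm (e' - e0) \<le> \<tau> \<Longrightarrow>
       norm (\<theta> (us, e) - \<theta> (us', e')) \<le> \<kappa> * (norm (us - us') + norm (e - e'))"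
    using that by (rule strict_minimizer_selection[OF cod \<delta> \<eta>])
  define W where "W = ball us0 \<tau> \<times> ball e0 \<tau>"
  have W: "norm (us - us0) \<le> \<tau>" "norm (e - e0) \<le> \<tau>" if "(us, e) \<in> W" for us e
    using that by (auto simp: W_def dist_norm norm_minus_commute)
  have obj: "perturbed_objective \<psi> (us, e) u = (if u \<in> K then ereal (f (u, e) - us \<bullet> u) else \<infinity>)"
    if "(us, e) \<in> W" "u \<in> cball u0 \<rho>" for us e u
    using that W[OF that(1)] \<rho> \<tau> by (intro perturbed_objective_near) (auto simp: dist_norm norm_minus_commute)
  have \<theta>b: "\<theta> (us, e) \<in> cball u0 \<rho>" if "(us, e) \<in> W" for us e
    using \<theta>[OF W[OF that]] by (simp add: dist_norm norm_minus_commute)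
  have less: "perturbed_objective \<psi> (us, e) (\<theta> (us, e)) < perturbed_objective \<psi> (us, e) u"
    if p: "(us, e) \<in> W" and u: "u \<in> cball u0 \<rho>" "u \<noteq> \<theta> (us, e)" for us e u
    using \<theta>[OF W[OF p]] u obj[OF p u(1)] obj[OF p \<theta>b[OF p]] by (auto simp: dist_norm norm_minus_commute)
  have le: "perturbed_objective \<psi> (us, e) (\<theta> (us, e)) \<le> perturbed_objective \<psi> (us, e) u"
    if p: "(us, e) \<in> W" and u: "u \<in> cball u0 \<rho>" for us e u
    using less[OF p u] by (cases "u = \<theta> (us, e)") auto
  have argmin: "M_argmin \<psi> u0 \<rho> (us, e) = {\<theta> (us, e)}" if p: "(us, e) \<in> W" for us e
  proof (intro equalityI subsetI)
    fix u assume "u \<in> M_argmin \<psi> u0 \<rho> (us, e)"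
    hence "u \<in> cball u0 \<rho>" "\<not> perturbed_objective \<psi> (us, e) (\<theta> (us, e)) < perturbed_objective \<psi> (us, e) u"
      using \<theta>b[OF p] unfolding M_argmin_def is_arg_min_def by blast+
    thus "u \<in> {\<theta> (us, e)}" using less[OF p] by blast
  next
    fix u assume "u \<in> {\<theta> (us, e)}"
    thus "u \<in> M_argmin \<psi> u0 \<rho> (us, e)"
      using \<theta>b[OF p] le[OF p] by (auto simp: M_argmin_def is_arg_min_def not_less)
  qed
  have m: "m_val \<psi> u0 \<rho> (us, e) = ereal (f (\<theta> (us, e), e) - us \<bullet> \<theta> (us, e))" if p: "(us, e) \<in> W" for us e
  proof -
    have "m_val \<psi> u0 \<rho> (us, e) = perturbed_objective \<psi> (us, e) (\<theta> (us, e))"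
      unfolding m_val_def by (intro antisym INF_lower INF_greatest \<theta>b[OF p] le[OF p])
    thus ?thesis using obj[OF p \<theta>b[OF p]] \<theta>[OF W[OF p]] by simp
  qed
  \<comment> \<open>The summands bound the change of \<open>f\<close>, that of the inner product
    through \<theta>, and that of the inner product through \<open>us\<close>.\<close>
  define C where "C = L * (\<kappa> + 1) + (norm us0 + r) * \<kappa> + (norm u0 + r)"
  have C: "C \<ge> 0" using L \<kappa> r by (simp add: C_def)
  have mlip: "\<bar>(f (\<theta> (us, e), e) - us \<bullet> \<theta> (us, e)) - (f (\<theta> (us', e'), e') - us' \<bullet> \<theta> (us', e'))\<bar>
      \<le> C * (norm (us - us') + norm (e - e'))" if p: "(us, e) \<in> W" "(us', e') \<in> W" for us e us' e'
  proof -
    let ?a = "\<theta> (us, e)" and ?b = "\<theta> (us', e')"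
    define S where "S = norm (us - us') + norm (e - e')"
    have S: "norm (us - us') \<le> S" "norm (e - e') \<le> S" "S \<ge> 0" by (simp_all add: S_def)
    have ab: "norm (?a - ?b) \<le> \<kappa> * S"
      unfolding S_def using W[OF p(1)] W[OF p(2)] by (intro lip)
    have a: "norm (?a - u0) \<le> r" "norm (?b - u0) \<le> r" "norm (e - e0) \<le> r" "norm (e' - e0) \<le> r"
      using \<theta>[OF W[OF p(1)]] \<theta>[OF W[OF p(2)]] W[OF p(1)] W[OF p(2)] \<rho> \<tau> by auto
    have "\<bar>f (?a, e) - f (?b, e')\<bar> \<le> L * (norm (?a - ?b) + norm (e - e'))" by (rule f_lip[OF a])
    also have "\<dots> \<le> L * (\<kappa> * S + S)" using ab S L by (intro mult_left_mono add_mono) auto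
    finally have 1: "\<bar>f (?a, e) - f (?b, e')\<bar> \<le> L * (\<kappa> + 1) * S" by (simp add: algebra_simps)
    have "norm us \<le> norm us0 + norm (us - us0)" using norm_triangle_ineq[of us0 "us - us0"] by simp
    hence nus: "norm us \<le> norm us0 + r" using W(1)[OF p(1)] \<tau> by linarith
    have "norm ?b \<le> norm u0 + norm (?b - u0)" using norm_triangle_ineq[of u0 "?b - u0"] by simp
    hence nb: "norm ?b \<le> norm u0 + r" using a by linarith
    have "\<bar>us \<bullet> (?a - ?b)\<bar> \<le> norm us * norm (?a - ?b)" by (rule Cauchy_Schwarz_ineq2)
    also have "\<dots> \<le> (norm us0 + r) * (\<kappa> * S)" using nus ab r by (intro mult_mono) auto
    finally have 2: "\<bar>us \<bullet> (?a - ?b)\<bar> \<le> (norm us0 + r) * \<kappa> * S" by (simp add: mult_ac)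
    have "\<bar>(us - us') \<bullet> ?b\<bar> \<le> norm (us - us') * norm ?b" by (rule Cauchy_Schwarz_ineq2)
    also have "\<dots> \<le> S * (norm u0 + r)" using nb S by (intro mult_mono) auto
    finally have 3: "\<bar>(us - us') \<bullet> ?b\<bar> \<le> (norm u0 + r) * S" by (simp add: mult_ac)
    have "(f (?a, e) - us \<bullet> ?a) - (f (?b, e') - us' \<bullet> ?b) = (f (?a, e) - f (?b, e')) - us \<bullet> (?a - ?b) - (us - us') \<bullet> ?b"
      by (simp add: inner_diff_left inner_diff_right)
    moreover have "C * S = L * (\<kappa> + 1) * S + (norm us0 + r) * \<kappa> * S + (norm u0 + r) * S"
      by (simp add: C_def distrib_right)
    ultimately show ?thesis using 1 2 3 unfolding S_def by linarith
  qed
  have pW: "(us0, e0) \<in> W" using \<tau> by (simp add: W_def)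
  show ?thesis
    unfolding lipschitz_fully_stable_def
  proof (intro exI[of _ \<rho>] exI[of _ W] exI[of _ \<theta>] conjI)
    show "open W" by (simp add: W_def open_Times)
    show "\<forall>p\<in>W. M_argmin \<psi> u0 \<rho> p = {\<theta> p}" using argmin by auto
    show "sum_lipschitz_on W \<theta>"
      unfolding sum_lipschitz_on_def using \<kappa> lip W by (intro exI[of _ \<kappa>]) auto
    show "M_argmin \<psi> u0 \<rho> (us0, e0) = {u0}" using argmin[OF pW] \<theta>0 by simp
    show "ereal_lipschitz_on W (m_val \<psi> u0 \<rho>)"
      unfolding ereal_lipschitz_on_def sum_lipschitz_on_def
      using m mlip C by (intro conjI exI[of _ C]) auto
  qed (use \<rho> pW in auto)
qed

lemma coderivative_bound_of_hoelder_fully_stable: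
  assumes "hoelder_fully_stable \<psi> u0 us0 e0"
  shows "\<exists>\<eta> \<delta>. 0 < \<eta> \<and> \<eta> \<le> r \<and> 0 < \<delta> \<and> coderivative_bound \<eta> \<delta>"
proof -
  from assms obtain \<gamma> \<kappa> U V \<theta> where \<gamma>: "\<gamma> > 0" and \<kappa>: "\<kappa> > 0" and U: "open U" "us0 \<in> U" and V: "open V" "e0 \<in> V"
    and M: "\<forall>p\<in>U \<times> V. M_argmin \<psi> u0 \<gamma> p = {\<theta> p}" and M0: "M_argmin \<psi> u0 \<gamma> (us0, e0) = {u0}"
    and lip: "\<forall>us\<in>U. \<forall>us'\<in>U. \<forall>e\<in>V. \<forall>e'\<in>V.
       norm (\<theta> (us, e) - \<theta> (us', e')) \<le> \<kappa> * (norm (us - us') + sqrt (norm (e - e')))"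
    unfolding hoelder_fully_stable_def by (elim exE conjE) (rule that)
  have hoelder: "norm (\<theta> (us, e) - \<theta> (us', e')) \<le> \<kappa> * (norm (us - us') + sqrt (norm (e - e')))"
    if "us \<in> U" "us' \<in> U" "e \<in> V" "e' \<in> V" for us us' e e'
    using lip that by blast
  have \<theta>0: "\<theta> (us0, e0) = u0" using M M0 U V by auto
  obtain a where a: "a > 0" "ball us0 a \<subseteq> U" using U open_contains_ball by blast
  obtain b where b: "b > 0" "ball e0 b \<subseteq> V" using V open_contains_ball by blast
  \<comment> \<open>Minimality on the \<gamma>-ball passes to a smaller ball as long as the
    minimizer stays inside it.\<close>
  define \<rho> where "\<rho> = min \<gamma> r"
  have \<rho>: "0 < \<rho>" "\<rho> \<le> r" "\<rho> \<le> \<gamma>" using \<gamma> r by (auto simp: \<rho>_def)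
  \<comment> \<open>With both \<open>norm (us - us0)\<close> and \<open>sqrt (norm (e - e0))\<close>
    at most \<open>w\<close>, the Hoelder estimate puts \<theta> strictly inside the \<rho>-ball, as
    the derivation of stationarity requires.\<close>
  define w where "w = min 1 (\<rho> / (2 * \<kappa> + 1))"
  have w: "0 < w" "w \<le> 1" "2 * \<kappa> * w < \<rho>"
  proof -
    show w0: "0 < w" "w \<le> 1" using \<rho> \<kappa> by (auto simp: w_def)
    have "(2 * \<kappa> + 1) * w \<le> (2 * \<kappa> + 1) * (\<rho> / (2 * \<kappa> + 1))"
      using \<kappa> by (intro mult_left_mono) (auto simp: w_def)
    also have "\<dots> = \<rho>" using \<kappa> by simp
    finally show "2 * \<kappa> * w < \<rho>" using w0 by (simp add: algebra_simps)
  qed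
  define \<tau> where "\<tau> = min (min a b) (min r (w\<^sup>2))"
  have \<tau>: "0 < \<tau>" "\<tau> \<le> r" using a b r w by (auto simp: \<tau>_def)
  have UV: "us \<in> U" if "norm (us - us0) < \<tau>" for us
    using that a by (auto simp: \<tau>_def dist_norm norm_minus_commute intro!: subsetD[OF a(2)])
  have VV: "e \<in> V" if "norm (e - e0) < \<tau>" for e
    using that b by (auto simp: \<tau>_def dist_norm norm_minus_commute intro!: subsetD[OF b(2)])
  have near: "norm (\<theta> (us, e) - u0) < \<rho>" if "norm (us - us0) < \<tau>" "norm (e - e0) < \<tau>" for us e
  proof -
    have "norm (\<theta> (us, e) - u0) \<le> \<kappa> * (norm (us - us0) + sqrt (norm (e - e0)))"
      using hoelder[of us us0 e e0] UV[OF that(1)] VV[OF that(2)] U V \<theta>0 by simp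
    also have "\<dots> \<le> \<kappa> * (w + w)"
    proof -
      have "norm (us - us0) \<le> w\<^sup>2" "norm (e - e0) \<le> w\<^sup>2" using that by (auto simp: \<tau>_def)
      moreover have "w\<^sup>2 \<le> w" using w by (simp add: power2_eq_square mult_left_le)
      moreover have "sqrt (norm (e - e0)) \<le> w" using \<open>norm (e - e0) \<le> w\<^sup>2\<close> w by (intro real_le_lsqrt) auto
      ultimately show ?thesis using \<kappa> by (intro mult_left_mono) auto
    qed
    finally show ?thesis using w by simp
  qed
  have opt: "perturbed_objective \<psi> (us, e) (\<theta> (us, e)) \<le> perturbed_objective \<psi> (us, e) k"
    if "norm (us - us0) < \<tau>" "norm (e - e0) < \<tau>" "norm (k - u0) \<le> \<rho>" for us e k
  proof -
    have "\<theta> (us, e) \<in> M_argmin \<psi> u0 \<gamma> (us, e)" using M UV[OF that(1)] VV[OF that(2)] by auto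
    moreover have "k \<in> cball u0 \<gamma>" using that \<rho> by (simp add: dist_norm norm_minus_commute)
    ultimately show ?thesis by (auto simp: M_argmin_def is_arg_min_def not_less)
  qed
  have er: "norm (e - e0) \<le> r" if "norm (e - e0) < \<tau>" for e using that \<tau> by linarith
  have \<theta>K: "\<theta> (us, e) \<in> K" if p: "norm (us - us0) < \<tau>" "norm (e - e0) < \<tau>" for us e
  proof (rule ccontr)
    assume "\<theta> (us, e) \<notin> K"
    hence "perturbed_objective \<psi> (us, e) (\<theta> (us, e)) = \<infinity>"
      using psi_out by (simp add: perturbed_objective_def)
    \<comment> \<open>\<open>u0\<close> is a competitor with finite value, which excludes minimizers
      outside \<open>K\<close>.\<close>
    moreover have "perturbed_objective \<psi> (us, e) u0 = ereal (f (u0, e) - us \<bullet> u0)"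
      using perturbed_objective_near[of u0 e us] er[OF p(2)] r K by simp
    ultimately show False using opt[OF p, of u0] \<rho> by simp
  qed
  obtain \<eta> \<delta> where "0 < \<eta>" "\<eta> \<le> r" "0 < \<delta>" "coderivative_bound \<eta> \<delta>"
  proof (rule coderivative_bound_of_hoelder[where \<theta> = \<theta>, OF \<kappa> \<rho>(1,2) \<tau> \<theta>0])
    show "\<theta> (us, e) \<in> K \<and> norm (\<theta> (us, e) - u0) < \<rho>" if "norm (us - us0) < \<tau>" "norm (e - e0) < \<tau>" for us e
      using \<theta>K[OF that] near[OF that] by blast
    show "f (\<theta> (us, e), e) - us \<bullet> \<theta> (us, e) \<le> f (k, e) - us \<bullet> k"
      if p: "norm (us - us0) < \<tau>" "norm (e - e0) < \<tau>" and k: "k \<in> K" "norm (k - u0) \<le> \<rho>" for us e k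
      using opt[OF p k(2)] perturbed_objective_near[of k e us] perturbed_objective_near[of "\<theta> (us, e)" e us]
        \<theta>K[OF p] near[OF p] er[OF p(2)] k \<rho> by simp
    show "norm (\<theta> (us, e) - \<theta> (us', e')) \<le> \<kappa> * (norm (us - us') + sqrt (norm (e - e')))"
      if "norm (us - us0) < \<tau>" "norm (e - e0) < \<tau>" "norm (us' - us0) < \<tau>" "norm (e' - e0) < \<tau>" for us e us' e'
      using that by (intro hoelder UV VV)
  qed blast
  thus ?thesis by blast
qed

end

section \<open>Local constants and the partial gradient of a function of class C^2\<close>

lemma C2_around_partial_gradient:
  fixes \<phi> :: "'x::{real_inner,complete_space} \<times> 'e::real_normed_vector \<Rightarrow> ereal"
  assumes "C2_around \<phi> (u0, e0)"
  obtains f and g :: "'x \<times> 'e \<Rightarrow> 'x" and r L :: real where "r > 0" "L \<ge> 1"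
    "\<And>u e. norm (u - u0) \<le> r \<Longrightarrow> norm (e - e0) \<le> r \<Longrightarrow> \<phi> (u, e) = ereal (f (u, e))"
    "\<And>u u' e. norm (u - u0) \<le> r \<Longrightarrow> norm (u' - u0) \<le> r \<Longrightarrow> norm (e - e0) \<le> r \<Longrightarrow>
      \<bar>f (u', e) - f (u, e) - g (u, e) \<bullet> (u' - u)\<bar> \<le> L * (norm (u' - u))\<^sup>2"
    "\<And>u u' e e'. norm (u - u0) \<le> r \<Longrightarrow> norm (u' - u0) \<le> r \<Longrightarrow> norm (e - e0) \<le> r \<Longrightarrow> norm (e' - e0) \<le> r \<Longrightarrow>
      \<bar>f (u, e) - f (u', e')\<bar> \<le> L * (norm (u - u') + norm (e - e'))"
    "\<And>u u' e e'. norm (u - u0) \<le> r \<Longrightarrow> norm (u' - u0) \<le> r \<Longrightarrow> norm (e - e0) \<le> r \<Longrightarrow> norm (e' - e0) \<le> r \<Longrightarrow>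
      norm (g (u, e) - g (u', e')) \<le> L * (norm (u - u') + norm (e - e'))"
    "\<And>u e. norm (u - u0) \<le> r \<Longrightarrow> norm (e - e0) \<le> r \<Longrightarrow> ((\<lambda>x. f (x, e)) has_derivative (\<bullet>) (g (u, e))) (at u)"
    "\<And>u e v. norm (u - u0) \<le> r \<Longrightarrow> norm (e - e0) \<le> r \<Longrightarrow> \<exists>es :: 'e \<Rightarrow>\<^sub>L real. \<forall>\<epsilon>>0. \<exists>d>0. \<forall>u' e'.
        norm (u' - u) < d \<longrightarrow> norm (e' - e) < d \<longrightarrow>
        \<bar>v \<bullet> (g (u', e') - g (u', e)) - blinfun_apply es (e' - e)\<bar> \<le> \<epsilon> * (norm (u' - u) + norm (e' - e))"
proof -
  obtain S and \<phi>' :: "'x \<times> 'e \<Rightarrow> ('x \<times> 'e) \<Rightarrow>\<^sub>L real" and \<phi>'' where S: "open S" "(u0, e0) \<in> S"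
    and D: "\<forall>z\<in>S. \<bar>\<phi> z\<bar> \<noteq> \<infinity> \<and>
      ((\<lambda>x. real_of_ereal (\<phi> x)) has_derivative blinfun_apply (\<phi>' z)) (at z) \<and>
      (\<phi>' has_derivative blinfun_apply (\<phi>'' z)) (at z)"
    and cont: "continuous_on S \<phi>''"
    using assms unfolding C2_around_def by (elim exE conjE) (rule that)
  have fin: "\<bar>\<phi> z\<bar> \<noteq> \<infinity>"
    and d1: "((\<lambda>x. real_of_ereal (\<phi> x)) has_derivative blinfun_apply (\<phi>' z)) (at z)"
    and d2: "(\<phi>' has_derivative blinfun_apply (\<phi>'' z)) (at z)" if "z \<in> S" for z
    using bspec[OF D that] by simp_all
  let ?z = "(u0, e0)"
  define f where "f z = real_of_ereal (\<phi> z)" for z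
  have "\<forall>z. \<exists>a. \<forall>h. blinfun_apply (\<phi>' z) (h, 0) = a \<bullet> h"
  proof
    fix z
    have "bounded_linear (\<lambda>h::'x. (h, 0::'e))"
      by (intro bounded_linear_Pair bounded_linear_ident bounded_linear_zero)
    hence "blinfun_apply (\<phi>' z o\<^sub>L Blinfun (\<lambda>h. (h, 0))) h = blinfun_apply (\<phi>' z) (h, 0)" for h
      by (simp add: bounded_linear_Blinfun_apply)
    thus "\<exists>a. \<forall>h. blinfun_apply (\<phi>' z) (h, 0) = a \<bullet> h"
      using riesz_representation[of "\<phi>' z o\<^sub>L Blinfun (\<lambda>h. (h, 0))"] by metis
  qed
  from choice[OF this] obtain g where g: "\<And>z h. blinfun_apply (\<phi>' z) (h, 0) = g z \<bullet> h" by blast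
  have "isCont \<phi>'' ?z" using cont S by (simp add: continuous_on_eq_continuous_at)
  moreover have "isCont \<phi>' ?z" using d2[OF S(2)] by (rule has_derivative_continuous)
  moreover have "\<forall>\<^sub>F z in nhds ?z. z \<in> S" using S by (rule eventually_nhds_in_open)
  ultimately have "\<forall>\<^sub>F z in nhds ?z. dist (\<phi>'' z) (\<phi>'' ?z) < 1 \<and> dist (\<phi>' z) (\<phi>' ?z) < 1 \<and> z \<in> S"
    by (intro eventually_conj tendstoD) (simp_all add: isCont_def tendsto_at_iff_tendsto_nhds)
  then obtain d where d: "d > 0" and dS: "\<And>z. dist z ?z < d \<Longrightarrow> dist (\<phi>'' z) (\<phi>'' ?z) < 1 \<and> dist (\<phi>' z) (\<phi>' ?z) < 1 \<and> z \<in> S"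
    unfolding eventually_nhds_metric by blast
  \<comment> \<open>Two components at distance at most \<open>r\<close> add up to less than
    \<open>d\<close>.\<close>
  define r where "r = d / 4"
  define L where "L = 3 + norm (\<phi>'' ?z) + norm (\<phi>' ?z)"
  have r: "r > 0" using d by (simp add: r_def)
  have L: "L \<ge> 1" by (simp add: L_def add_nonneg_nonneg)
  define C where "C = cball u0 r \<times> cball e0 r"
  have convC: "convex C" unfolding C_def by (intro convex_Times convex_cball)
  have mem: "(u, e) \<in> C \<longleftrightarrow> norm (u - u0) \<le> r \<and> norm (e - e0) \<le> r" for u e
    by (simp add: C_def dist_norm norm_minus_commute)
  have C: "z \<in> S" "norm (\<phi>'' z) \<le> L" "norm (\<phi>' z) \<le> L" if "z \<in> C" for z
  proof -
    obtain u e where z: "z = (u, e)" by (cases z)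
    have "norm ((u, e) - ?z) \<le> norm (u - u0) + norm (e - e0)" using norm_Pair_le[of "u - u0" "e - e0"] by simp
    also have "\<dots> < d" using that d by (simp add: z mem r_def)
    finally have "dist z ?z < d" by (simp add: z dist_norm)
    note * = dS[OF this]
    show "z \<in> S" using * by blast
    have "norm (\<phi>'' z) \<le> norm (\<phi>'' ?z) + dist (\<phi>'' z) (\<phi>'' ?z)"
      by (metis dist_norm norm_triangle_sub)
    thus "norm (\<phi>'' z) \<le> L" using * norm_ge_zero[of "\<phi>' ?z"] unfolding L_def by linarith
    have "norm (\<phi>' z) \<le> norm (\<phi>' ?z) + dist (\<phi>' z) (\<phi>' ?z)"
      by (metis dist_norm norm_triangle_sub)
    thus "norm (\<phi>' z) \<le> L" using * norm_ge_zero[of "\<phi>'' ?z"] unfolding L_def by linarith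
  qed
  have pair: "L * norm ((u, e) - (u', e')) \<le> L * (norm (u - u') + norm (e - e'))"
    for u u' :: 'x and e e' :: 'e
    using L norm_Pair_le[of "u - u'" "e - e'"] by (intro mult_left_mono) auto
  have f_lip: "\<bar>f z - f z'\<bar> \<le> L * norm (z - z')" if "z \<in> C" "z' \<in> C" for z z'
  proof -
    have "norm (f z - f z') \<le> L * norm (z - z')"
    proof (rule differentiable_bound[OF convC _ _ that])
      show "(f has_derivative blinfun_apply (\<phi>' x)) (at x within C)" if "x \<in> C" for x
        using d1[OF C(1)[OF that]] unfolding f_def[abs_def] by (rule has_derivative_at_withinI)
      show "onorm (blinfun_apply (\<phi>' x)) \<le> L" if "x \<in> C" for x
        using C(3)[OF that] by (simp add: norm_blinfun.rep_eq)
    qed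
    thus ?thesis by simp
  qed
  have \<phi>'_lip: "norm (\<phi>' z - \<phi>' z') \<le> L * norm (z - z')" if "z \<in> C" "z' \<in> C" for z z'
  proof (rule differentiable_bound[OF convC _ _ that])
    show "(\<phi>' has_derivative blinfun_apply (\<phi>'' x)) (at x within C)" if "x \<in> C" for x
      using d2[OF C(1)[OF that]] by (rule has_derivative_at_withinI)
    show "onorm (blinfun_apply (\<phi>'' x)) \<le> L" if "x \<in> C" for x
      using C(2)[OF that] by (simp add: norm_blinfun.rep_eq)
  qed
  have g_lip: "norm (g z - g z') \<le> L * norm (z - z')" if "z \<in> C" "z' \<in> C" for z z'
  proof -
    let ?D = "g z - g z'"
    have "norm ?D * norm ?D = ?D \<bullet> ?D" by (simp add: power2_norm_eq_inner flip: power2_eq_square)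
    also have "\<dots> = blinfun_apply (\<phi>' z - \<phi>' z') (?D, 0)"
      by (simp add: blinfun.diff_left g inner_diff_left)
    also have "\<dots> \<le> norm (\<phi>' z - \<phi>' z') * norm (?D, 0::'e)"
      using norm_blinfun[of "\<phi>' z - \<phi>' z'" "(?D, 0)"] by simp
    also have "norm (?D, 0::'e) = norm ?D" by (simp add: norm_Pair)
    finally have "norm ?D \<le> norm (\<phi>' z - \<phi>' z')" by (cases "?D = 0") simp_all
    thus ?thesis using \<phi>'_lip[OF that] by linarith
  qed
  have f_der: "((\<lambda>x. f (x, e)) has_derivative (\<bullet>) (g (u, e))) (at u)" if "(u, e) \<in> C" for u e
  proof -
    have "((\<lambda>x. (x, e)) has_derivative (\<lambda>h. (h, 0))) (at u)"
      by (intro has_derivative_Pair has_derivative_ident has_derivative_const)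
    moreover have "(f has_derivative blinfun_apply (\<phi>' (u, e))) (at (u, e))"
      using d1[OF C(1)[OF that]] unfolding f_def[abs_def] .
    ultimately have "((\<lambda>x. f (x, e)) has_derivative (\<lambda>h. blinfun_apply (\<phi>' (u, e)) (h, 0))) (at u)"
      by (rule has_derivative_compose)
    thus ?thesis by (simp add: g)
  qed
  show thesis
  proof (rule that[OF r L])
    show "\<phi> (u, e) = ereal (f (u, e))" if "norm (u - u0) \<le> r" "norm (e - e0) \<le> r" for u e
      using fin[OF C(1), of "(u, e)"] that by (simp add: mem f_def ereal_real)
    show "\<bar>f (u', e) - f (u, e) - g (u, e) \<bullet> (u' - u)\<bar> \<le> L * (norm (u' - u))\<^sup>2"
      if "norm (u - u0) \<le> r" "norm (u' - u0) \<le> r" "norm (e - e0) \<le> r" for u u' e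
    proof (rule lipschitz_gradient_taylor[where C = "cball u0 r" and G = "\<lambda>x. g (x, e)" and F = "\<lambda>x. f (x, e)"])
      show "((\<lambda>x. f (x, e)) has_derivative (\<bullet>) (g (x, e))) (at x)" if "x \<in> cball u0 r" for x
        using that \<open>norm (e - e0) \<le> r\<close> by (intro f_der) (simp add: mem dist_norm norm_minus_commute)
      show "norm (g (x, e) - g (y, e)) \<le> L * norm (x - y)" if "x \<in> cball u0 r" "y \<in> cball u0 r" for x y
        using g_lip[of "(x, e)" "(y, e)"] that \<open>norm (e - e0) \<le> r\<close>
        by (simp add: mem dist_norm norm_minus_commute norm_Pair)
    qed (use that L in \<open>auto simp: dist_norm norm_minus_commute\<close>)
    show "\<bar>f (u, e) - f (u', e')\<bar> \<le> L * (norm (u - u') + norm (e - e'))"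
      if "norm (u - u0) \<le> r" "norm (u' - u0) \<le> r" "norm (e - e0) \<le> r" "norm (e' - e0) \<le> r" for u u' e e'
      by (rule order_trans[OF f_lip pair]) (use that in \<open>simp_all add: mem\<close>)
    show "norm (g (u, e) - g (u', e')) \<le> L * (norm (u - u') + norm (e - e'))"
      if "norm (u - u0) \<le> r" "norm (u' - u0) \<le> r" "norm (e - e0) \<le> r" "norm (e' - e0) \<le> r" for u u' e e'
      by (rule order_trans[OF g_lip pair]) (use that in \<open>simp_all add: mem\<close>)
    show "((\<lambda>x. f (x, e)) has_derivative (\<bullet>) (g (u, e))) (at u)"
      if "norm (u - u0) \<le> r" "norm (e - e0) \<le> r" for u e
      using that by (intro f_der) (simp add: mem)
    show "\<exists>es :: 'e \<Rightarrow>\<^sub>L real. \<forall>\<epsilon>>0. \<exists>d>0. \<forall>u' e'.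
        norm (u' - u) < d \<longrightarrow> norm (e' - e) < d \<longrightarrow>
        \<bar>v \<bullet> (g (u', e') - g (u', e)) - blinfun_apply es (e' - e)\<bar> \<le> \<epsilon> * (norm (u' - u) + norm (e' - e))"
      if "norm (u - u0) \<le> r" "norm (e - e0) \<le> r" for u e v
    proof -
      have zS: "(u, e) \<in> S" using that by (intro C) (simp add: mem)
      \<comment> \<open>The derivative at \<open>(u, e)\<close> of
        \<open>z \<mapsto> g z \<bullet> v\<close>; restricted to the second variable it is the
        required functional.\<close>
      define A where "A w = blinfun_apply (blinfun_apply (\<phi>'' (u, e)) w) (v, 0)" for w
      have A: "bounded_linear A"
        unfolding A_def
        by (rule bounded_linear_compose[OF blinfun.bounded_linear_left blinfun.bounded_linear_right])
      have "bounded_linear (\<lambda>h::'e. A (0, h))"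
        by (rule bounded_linear_compose[OF A]) (intro bounded_linear_Pair bounded_linear_ident bounded_linear_zero)
      hence es: "blinfun_apply (Blinfun (\<lambda>h. A (0, h))) h = A (0, h)" for h
        by (simp add: bounded_linear_Blinfun_apply)
      show ?thesis
      proof (intro exI[of _ "Blinfun (\<lambda>h. A (0, h))"] allI impI)
        fix \<epsilon> :: real assume \<epsilon>: "\<epsilon> > 0"
        define \<epsilon>' where "\<epsilon>' = \<epsilon> / (2 * (norm v + 1))"
        have n1: "norm v + 1 > 0" by (simp add: add_nonneg_pos)
        have \<epsilon>': "\<epsilon>' > 0" using \<epsilon> n1 by (simp add: \<epsilon>'_def)
        from d2[OF zS, unfolded has_derivative_at_alt] \<epsilon>' obtain c where c: "c > 0"
          "\<And>y. norm (y - (u, e)) < c \<Longrightarrow> norm (\<phi>' y - \<phi>' (u, e) - blinfun_apply (\<phi>'' (u, e)) (y - (u, e))) \<le> \<epsilon>' * norm (y - (u, e))"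
          by blast
        have approx: "\<bar>g y \<bullet> v - g (u, e) \<bullet> v - A (y - (u, e))\<bar> \<le> \<epsilon> / 2 * norm (y - (u, e))"
          if "norm (y - (u, e)) < c" for y
        proof -
          have "\<bar>g y \<bullet> v - g (u, e) \<bullet> v - A (y - (u, e))\<bar>
              = norm (blinfun_apply (\<phi>' y - \<phi>' (u, e) - blinfun_apply (\<phi>'' (u, e)) (y - (u, e))) (v, 0))"
            by (simp add: blinfun.diff_left g A_def)
          also have "\<dots> \<le> norm (\<phi>' y - \<phi>' (u, e) - blinfun_apply (\<phi>'' (u, e)) (y - (u, e))) * norm (v, 0::'e)"
            by (rule norm_blinfun)
          also have "\<dots> \<le> (\<epsilon>' * norm (y - (u, e))) * (norm v + 1)"
            using c(2)[OF that] \<epsilon>' by (intro mult_mono) (auto simp: norm_Pair)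
          also have "\<dots> = (\<epsilon>' * (norm v + 1)) * norm (y - (u, e))" by (simp add: mult_ac)
          also have "\<epsilon>' * (norm v + 1) = \<epsilon> / 2"
          proof -
            have "a / (2 * N) * N = a / 2" if "N > 0" for a N :: real using that by simp
            thus ?thesis unfolding \<epsilon>'_def using n1 by blast
          qed
          finally show ?thesis .
        qed
        show "\<exists>d>0. \<forall>u' e'. norm (u' - u) < d \<longrightarrow> norm (e' - e) < d \<longrightarrow>
            \<bar>v \<bullet> (g (u', e') - g (u', e)) - blinfun_apply (Blinfun (\<lambda>h. A (0, h))) (e' - e)\<bar> \<le> \<epsilon> * (norm (u' - u) + norm (e' - e))"
        proof (intro exI[of _ "c / 2"] conjI allI impI)
          fix u' e' assume near: "norm (u' - u) < c / 2" "norm (e' - e) < c / 2"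
          have n1: "norm ((u', e') - (u, e)) \<le> norm (u' - u) + norm (e' - e)"
            using norm_Pair_le[of "u' - u" "e' - e"] by simp
          have n2: "norm ((u', e) - (u, e)) \<le> norm (u' - u) + norm (e' - e)"
            using norm_Pair_le[of "u' - u" "0::'e"] norm_ge_zero[of "e' - e"] by simp
          have lt: "norm ((u', e') - (u, e)) < c" "norm ((u', e) - (u, e)) < c"
            using n1 n2 near by linarith+
          \<comment> \<open>Both increments start at \<open>(u, e)\<close>; their difference cancels
            \<open>g (u, e)\<close> and leaves \<open>A (0, e' - e)\<close>, with an error
            \<open>\<epsilon> / 2\<close> from each.\<close>
          have "\<bar>g (u', e') \<bullet> v - g (u, e) \<bullet> v - A ((u', e') - (u, e))\<bar> \<le> \<epsilon> / 2 * (norm (u' - u) + norm (e' - e))"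
            by (rule order_trans[OF approx[OF lt(1)] mult_left_mono[OF n1]]) (use \<epsilon> in simp)
          moreover have "\<bar>g (u', e) \<bullet> v - g (u, e) \<bullet> v - A ((u', e) - (u, e))\<bar> \<le> \<epsilon> / 2 * (norm (u' - u) + norm (e' - e))"
            by (rule order_trans[OF approx[OF lt(2)] mult_left_mono[OF n2]]) (use \<epsilon> in simp)
          moreover have "A ((u', e') - (u, e)) - A ((u', e) - (u, e)) = A (0, e' - e)"
            using linear_diff[OF bounded_linear.linear[OF A], of "(u', e') - (u, e)" "(u', e) - (u, e)"] by simp
          moreover have "v \<bullet> (g (u', e') - g (u', e)) = g (u', e') \<bullet> v - g (u', e) \<bullet> v"
            by (simp add: inner_diff_right inner_commute)
          ultimately show "\<bar>v \<bullet> (g (u', e') - g (u', e)) - blinfun_apply (Blinfun (\<lambda>h. A (0, h))) (e' - e)\<bar> \<le> \<epsilon> * (norm (u' - u) + norm (e' - e))"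
            unfolding es by linarith
        qed (use c in simp)
      qed
    qed
  qed
qed

theorem theorem3p3:
  fixes \<phi> \<psi> :: "'x::{real_inner,complete_space} \<times> 'e::banach \<Rightarrow> ereal"
    and K :: "'x set" and u0 us0 :: 'x and e0 :: 'e
  assumes "asplund_space TYPE('e)"
    and "closed K" and "convex K"
    and "\<And>u e. \<psi> (u, e) = \<phi> (u, e) + set_delta K u"
    and "(u0, e0) \<in> eff_dom \<psi>"
    and "C2_around \<phi> (u0, e0)"
    and "us0 \<in> partial_subdifferential \<psi> (u0, e0)"
  defines "stmt_i \<equiv> lipschitz_fully_stable \<psi> u0 us0 e0"
    and "stmt_ii \<equiv> hoelder_fully_stable \<psi> u0 us0 e0"
    and "stmt_iii \<equiv>
      (\<exists>\<eta>>0. \<exists>\<delta>>0. \<forall>u e us.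
         ((u, e), us) \<in> mgraph (partial_subdifferential \<psi>) \<and>
         norm (u - u0) + norm (e - e0) + norm (us - us0) \<le> \<eta> \<longrightarrow>
         (\<forall>v vs (es::'e \<Rightarrow>\<^sub>L real).
            pair_functional (blinfun_inner_right vs) es
              \<in> regular_coderivative (partial_subdifferential \<psi>) (u, e) us (blinfun_inner_right v)
            \<longrightarrow> vs \<bullet> v \<ge> \<delta> * (norm v)\<^sup>2))"
    and "stmt_iv \<equiv>
      (\<exists>\<eta>>0. \<exists>\<delta>>0. \<forall>u e us.
         ((u, e), us) \<in> mgraph (partial_subdifferential \<psi>) \<and>
         norm (u - u0) + norm (e - e0) + norm (us - us0) \<le> \<eta> \<longrightarrow>
         (\<forall>v vs.
            vs \<in> combined_second_subdifferential (\<lambda>x. \<psi> (x, e)) u us v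
            \<longrightarrow> vs \<bullet> v \<ge> \<delta> * (norm v)\<^sup>2))"
  shows "(stmt_i \<longleftrightarrow> stmt_ii) \<and> (stmt_ii \<longleftrightarrow> stmt_iii) \<and> (stmt_iii \<longleftrightarrow> stmt_iv)"
proof -
  obtain f and g :: "'x \<times> 'e \<Rightarrow> 'x" and r L :: real where r: "r > 0" and L: "L \<ge> 1"
    and \<phi>: "\<And>u e. norm (u - u0) \<le> r \<Longrightarrow> norm (e - e0) \<le> r \<Longrightarrow> \<phi> (u, e) = ereal (f (u, e))"
    and f_taylor: "\<And>u u' e. norm (u - u0) \<le> r \<Longrightarrow> norm (u' - u0) \<le> r \<Longrightarrow> norm (e - e0) \<le> r \<Longrightarrow>
      \<bar>f (u', e) - f (u, e) - g (u, e) \<bullet> (u' - u)\<bar> \<le> L * (norm (u' - u))\<^sup>2"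
    and f_lip: "\<And>u u' e e'. norm (u - u0) \<le> r \<Longrightarrow> norm (u' - u0) \<le> r \<Longrightarrow> norm (e - e0) \<le> r \<Longrightarrow> norm (e' - e0) \<le> r \<Longrightarrow>
      \<bar>f (u, e) - f (u', e')\<bar> \<le> L * (norm (u - u') + norm (e - e'))"
    and g_lip: "\<And>u u' e e'. norm (u - u0) \<le> r \<Longrightarrow> norm (u' - u0) \<le> r \<Longrightarrow> norm (e - e0) \<le> r \<Longrightarrow> norm (e' - e0) \<le> r \<Longrightarrow>
      norm (g (u, e) - g (u', e')) \<le> L * (norm (u - u') + norm (e - e'))"
    and f_der: "\<And>u e. norm (u - u0) \<le> r \<Longrightarrow> norm (e - e0) \<le> r \<Longrightarrow> ((\<lambda>x. f (x, e)) has_derivative (\<bullet>) (g (u, e))) (at u)"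
    and g_der: "\<And>u e v. norm (u - u0) \<le> r \<Longrightarrow> norm (e - e0) \<le> r \<Longrightarrow> \<exists>es :: 'e \<Rightarrow>\<^sub>L real. \<forall>\<epsilon>>0. \<exists>d>0. \<forall>u' e'.
        norm (u' - u) < d \<longrightarrow> norm (e' - e) < d \<longrightarrow>
        \<bar>v \<bullet> (g (u', e') - g (u', e)) - blinfun_apply es (e' - e)\<bar> \<le> \<epsilon> * (norm (u' - u) + norm (e' - e))"
    using that by (rule C2_around_partial_gradient[OF assms(6)])
  have psi: "\<psi> (u, e) = (if u \<in> K then ereal (f (u, e)) else \<infinity>)"
    if "norm (u - u0) \<le> r" "norm (e - e0) \<le> r" for u e
    using \<phi>[OF that] by (simp add: assms(4) set_delta_def)
  have u0: "u0 \<in> K"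
    using assms(5) by (auto simp: eff_dom_def assms(4) set_delta_def split: if_splits)
  have base: "\<forall>k\<in>K. (us0 - g (u0, e0)) \<bullet> (k - u0) \<le> 0"
  proof -
    have "us0 \<in> partial_subdifferential \<psi> (u0, e0) \<longleftrightarrow> u0 \<in> K \<and> (\<forall>k\<in>K. (us0 - g (u0, e0)) \<bullet> (k - u0) \<le> 0)"
      by (rule partial_subdifferential_smooth_plus_indicator[OF assms(2,3) psi f_der g_lip]) (use r L in auto)
    thus ?thesis using assms(7) by blast
  qed
  interpret parametric_objective f g K u0 us0 e0 r L \<psi>
  proof
    show "\<psi> (u, e) = \<infinity>" if "u \<notin> K" for u e
      using that by (simp add: assms(4) set_delta_def)
  qed (use r L assms(2,3) u0 base psi f_taylor f_lip g_lip f_der g_der in auto)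
  \<comment> \<open>The pivot: \<open>stmt_i\<close> and \<open>stmt_ii\<close> form a cycle of
    implications with it, \<open>stmt_iii\<close> and \<open>stmt_iv\<close> are each equivalent to
    it.\<close>
  define R where "R \<longleftrightarrow> (\<exists>\<eta> \<delta>. 0 < \<eta> \<and> \<eta> \<le> r \<and> 0 < \<delta> \<and> coderivative_bound \<eta> \<delta>)"
  have "R \<Longrightarrow> stmt_i"
    unfolding R_def stmt_i_def using lipschitz_fully_stable_of_coderivative_bound by blast
  moreover have "stmt_i \<Longrightarrow> stmt_ii"
    unfolding stmt_i_def stmt_ii_def by (rule lipschitz_imp_hoelder_fully_stable)
  moreover have "stmt_ii \<Longrightarrow> R"
    unfolding R_def stmt_ii_def by (rule coderivative_bound_of_hoelder_fully_stable)
  moreover have "stmt_iii \<longleftrightarrow> R"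
    using coderivative_condition_iff[where N = "\<lambda>u e us vs v. \<exists>es. pair_functional (blinfun_inner_right vs) es
            \<in> regular_coderivative (partial_subdifferential \<psi>) (u, e) us (blinfun_inner_right v)", OF full_coderivative_iff]
    unfolding R_def stmt_iii_def by simp
  moreover have "stmt_iv \<longleftrightarrow> R"
    unfolding R_def stmt_iv_def
    by (rule coderivative_condition_iff) (rule combined_second_subdifferential_iff)
  ultimately show ?thesis by blast
qed

end
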